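(* Let $0<\alpha<1$ and let $\tau_0$ be a random variable with $\mathbf{P}(\tau_0>0)=1$ and $\mathbf{P}(\tau_0>t)=L(t)/t^\alpha$ for $t>0$, where $L$ is a nonvanishing slowly varying function at infinity. Let $V$ be the Lévy process, $\rho$ its associated random measure, and $c_\epsilon$, $g_\epsilon$ the constants and functions given in the context, and on the probability space where $V$ is defined put, for $\epsilon\in(0,1)$ and $i\in\mathbb{Z}$, $$\tau^{(\epsilon)}_i=\frac{1}{c_\epsilon}\,g_\epsilon\big(V_{\epsilon(i+1)}-V_{\epsilon i}\big),\qquad \tilde\rho^{(\epsilon)}=\sum_{i=-\infty}^{\infty}c_\epsilon\tau^{(\epsilon)}_i\,\delta_{\epsilon i}.$$ Then $\tau^{(\epsilon)}_i$ has the same distribution as $\tau_0$ for every $i\in\mathbb{Z}$ (and every $\epsilon$), and, almost surely, as $\epsilon\to0$, $\tilde\rho^{(\epsilon)}\to\rho$ both vaguely and in the point process sense.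
   Context: $V=(V_x)_{x\in\mathbb{R}}$, $V_0=0$, is the Lévy process (stationary independent increments, sample paths right-continuous with left limits) with $$\mathbf{E}\big[e^{ir(V_{x+x_0}-V_{x_0})}\big]=\exp\Big(\alpha x\int_0^\infty(e^{irw}-1)w^{-1-\alpha}\,dw\Big),\quad x_0\in\mathbb{R},\ x\ge0,$$ and $\rho$ is the random Lebesgue–Stieltjes measure on $\mathbb{R}$ with $\rho((a,b])=V_b-V_a$ for $a<b$. Constants and functions: $c_\epsilon=\left(\inf\{t\ge0:\mathbf{P}(\tau_0>t)\le\epsilon\}\right)^{-1}$ for $\epsilon\in(0,1)$. $G:[0,\infty)\to[0,\infty)$ is defined by $\mathbf{P}(V_1>G(x))=\mathbf{P}(\tau_0>x)$ for all $x\ge0$; it is nondecreasing and right-continuous, and $G^{-1}$ is its nondecreasing right-continuous generalized inverse. $g_\epsilon:[0,\infty)\to[0,\infty)$ is $g_\epsilon(x)=c_\epsilon G^{-1}(\epsilon^{-1/\alpha}x)$. Vague convergence: $\nu^{(\epsilon)}\to\nu$ vaguely if $\int f\,d\nu^{(\epsilon)}\to\int f\,d\nu$ for all continuous real-valued $f$ on $\mathbb{R}$ with bounded support. Point process convergence: for a locally finite measure $\nu$ let $V(\nu)=\{(y,\nu(\{y\})):\nu(\{y\})>0\}\subset\mathbb{R}\times(0,\infty)$. $\nu^{(\epsilon)}\to\nu$ in the point process sense if for any open $U$ whose closure is a compact subset of $\mathbb{R}\times(0,\infty)$ and whose boundary contains no points of $V(\nu)$, $|V(\nu^{(\epsilon)})\cap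 U|=|V(\nu)\cap U|$ for all $\epsilon$ small enough. *)

theory Defs
  imports "HOL-Probability.Probability"
begin

(* Measurability is not required: when L describes a tail, it is Borel on (0, \<infinity>) automatically,
   because t powr -\<alpha> * L t is the tail of a distribution function. *)
definition slowly_varying_at_infinity :: "(real \<Rightarrow> real) \<Rightarrow> bool" where
  "slowly_varying_at_infinity L \<longleftrightarrow> (\<forall>a>0. ((\<lambda>t. L (a * t) / L t) \<longlongrightarrow> 1) at_top)"

(* Two-sided in time: the index runs over all of the real line. *)
definition levy_process :: "'a measure \<Rightarrow> (real \<Rightarrow> 'a \<Rightarrow> real) \<Rightarrow> bool" where
  "levy_process N V \<longleftrightarrow>
     prob_space N \<and>
     (\<forall>x. V x \<in> borel_measurable N) \<and>
     (\<forall>\<omega>\<in>space N. V 0 \<omega> = 0) \<and>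
     (\<forall>x x0 y0. x \<ge> 0 \<longrightarrow>
        distr N borel (\<lambda>\<omega>. V (x + x0) \<omega> - V x0 \<omega>) =
        distr N borel (\<lambda>\<omega>. V (x + y0) \<omega> - V y0 \<omega>)) \<and>
     (\<forall>(n::nat) t. strict_mono_on {..n} t \<longrightarrow>
        prob_space.indep_vars N (\<lambda>_. borel) (\<lambda>k \<omega>. V (t (Suc k)) \<omega> - V (t k) \<omega>) {..<n}) \<and>
     (\<forall>\<omega>\<in>space N. \<forall>x. continuous (at_right x) (\<lambda>y. V y \<omega>) \<and>
        (\<exists>l. ((\<lambda>y. V y \<omega>) \<longlongrightarrow> l) (at_left x)))"

definition stable_levy_process :: "real \<Rightarrow> 'a measure \<Rightarrow> (real \<Rightarrow> 'a \<Rightarrow> real) \<Rightarrow> bool" where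
  "stable_levy_process \<alpha> N V \<longleftrightarrow>
     levy_process N V \<and>
     (\<forall>x x0 r. x \<ge> 0 \<longrightarrow>
        char (distr N borel (\<lambda>\<omega>. V (x + x0) \<omega> - V x0 \<omega>)) r =
        exp (complex_of_real (\<alpha> * x) *
          (LINT w:{0<..}|lborel. (iexp (r * w) - 1) * complex_of_real (w powr (-1 - \<alpha>)))))"

(* The paths are right-continuous and almost surely nondecreasing; on the exceptional null set
   the value of interval_measure is irrelevant. *)
definition stieltjes_random_measure :: "(real \<Rightarrow> 'a \<Rightarrow> real) \<Rightarrow> 'a \<Rightarrow> real measure" where
  "stieltjes_random_measure V \<omega> = interval_measure (\<lambda>x. V x \<omega>)"

definition c_eps :: "'b measure \<Rightarrow> ('b \<Rightarrow> real) \<Rightarrow> real \<Rightarrow> real" where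
  "c_eps M \<tau>0 \<epsilon> = inverse (Inf {t. 0 \<le> t \<and> \<P>(\<omega> in M. \<tau>0 \<omega> > t) \<le> \<epsilon>})"

definition G_fun ::
    "'a measure \<Rightarrow> (real \<Rightarrow> 'a \<Rightarrow> real) \<Rightarrow> 'b measure \<Rightarrow> ('b \<Rightarrow> real) \<Rightarrow> real \<Rightarrow> real" where
  "G_fun N V M \<tau>0 x = (THE y. 0 \<le> y \<and> \<P>(\<omega> in N. V 1 \<omega> > y) = \<P>(\<omega> in M. \<tau>0 \<omega> > x))"

(* The strict inequality selects the right-continuous version of the inverse. *)
definition right_cont_inverse :: "(real \<Rightarrow> real) \<Rightarrow> real \<Rightarrow> real" where
  "right_cont_inverse G y = Inf {x. 0 \<le> x \<and> y < G x}"

definition g_eps ::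
    "real \<Rightarrow> 'a measure \<Rightarrow> (real \<Rightarrow> 'a \<Rightarrow> real) \<Rightarrow> 'b measure \<Rightarrow> ('b \<Rightarrow> real) \<Rightarrow> real \<Rightarrow> real \<Rightarrow> real"
  where
  "g_eps \<alpha> N V M \<tau>0 \<epsilon> x =
     c_eps M \<tau>0 \<epsilon> * right_cont_inverse (G_fun N V M \<tau>0) (\<epsilon> powr (- 1 / \<alpha>) * x)"

definition tau_eps ::
    "real \<Rightarrow> 'a measure \<Rightarrow> (real \<Rightarrow> 'a \<Rightarrow> real) \<Rightarrow> 'b measure \<Rightarrow> ('b \<Rightarrow> real) \<Rightarrow> real \<Rightarrow> int \<Rightarrow> 'a \<Rightarrow> real"
  where
  "tau_eps \<alpha> N V M \<tau>0 \<epsilon> i \<omega> =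
     1 / c_eps M \<tau>0 \<epsilon> *
       g_eps \<alpha> N V M \<tau>0 \<epsilon> (V (\<epsilon> * (of_int i + 1)) \<omega> - V (\<epsilon> * of_int i) \<omega>)"

(* The sum over all integers i of w i times the unit point mass at y i,
   see emeasure_point_mass_sum. *)
definition point_mass_sum :: "(int \<Rightarrow> real) \<Rightarrow> (int \<Rightarrow> real) \<Rightarrow> real measure" where
  "point_mass_sum w y = distr (density (count_space UNIV) (\<lambda>i. ennreal (w i))) borel y"

lemma sets_point_mass_sum: "sets (point_mass_sum w y) = sets borel"
  by (simp add: point_mass_sum_def)

lemma emeasure_point_mass_sum:
  assumes "A \<in> sets borel"
  shows "emeasure (point_mass_sum w y) A =
    (\<integral>\<^sup>+ i. ennreal (w i) * emeasure (return borel (y i)) A \<partial>count_space UNIV)"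
proof -
  have "emeasure (point_mass_sum w y) A =
      emeasure (density (count_space UNIV) (\<lambda>i. ennreal (w i))) (y -` A)"
    unfolding point_mass_sum_def using assms by (subst emeasure_distr) auto
  also have "\<dots> = (\<integral>\<^sup>+ i. ennreal (w i) * indicator (y -` A) i \<partial>count_space UNIV)"
    by (subst emeasure_density) auto
  also have "\<dots> = (\<integral>\<^sup>+ i. ennreal (w i) * emeasure (return borel (y i)) A \<partial>count_space UNIV)"
    using assms by (intro nn_integral_cong) (simp add: indicator_def)
  finally show ?thesis .
qed

definition rho_eps ::
    "real \<Rightarrow> 'a measure \<Rightarrow> (real \<Rightarrow> 'a \<Rightarrow> real) \<Rightarrow> 'b measure \<Rightarrow> ('b \<Rightarrow> real) \<Rightarrow> real \<Rightarrow> 'a \<Rightarrow> real measure"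
  where
  "rho_eps \<alpha> N V M \<tau>0 \<epsilon> \<omega> =
     point_mass_sum (\<lambda>i. c_eps M \<tau>0 \<epsilon> * tau_eps \<alpha> N V M \<tau>0 \<epsilon> i \<omega>) (\<lambda>i. \<epsilon> * of_int i)"

(* In both notions of convergence \<epsilon> is a continuous parameter decreasing to 0. *)
definition vague_convergence :: "(real \<Rightarrow> real measure) \<Rightarrow> real measure \<Rightarrow> bool" where
  "vague_convergence \<nu>e \<nu> \<longleftrightarrow>
     (\<forall>f::real \<Rightarrow> real. continuous_on UNIV f \<and> bounded {x. f x \<noteq> 0} \<longrightarrow>
        ((\<lambda>\<epsilon>. \<integral>x. f x \<partial>\<nu>e \<epsilon>) \<longlongrightarrow> (\<integral>x. f x \<partial>\<nu>)) (at_right 0))"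

definition atom_set :: "real measure \<Rightarrow> (real \<times> real) set" where
  "atom_set \<nu> = {(y, measure \<nu> {y}) | y. measure \<nu> {y} > 0}"

(* For locally finite measures the sets counted are finite: the closure of U is compact in
   the open half plane, so only atoms in a bounded interval with mass bounded away from 0
   contribute. *)
definition point_process_convergence :: "(real \<Rightarrow> real measure) \<Rightarrow> real measure \<Rightarrow> bool" where
  "point_process_convergence \<nu>e \<nu> \<longleftrightarrow>
     (\<forall>U. open U \<and> compact (closure U) \<and> closure U \<subseteq> UNIV \<times> {0<..} \<and>
          frontier U \<inter> atom_set \<nu> = {} \<longrightarrow>
        (\<forall>\<^sub>F \<epsilon> in at_right 0. card (atom_set (\<nu>e \<epsilon>) \<inter> U) = card (atom_set \<nu> \<inter> U)))"

end

theory Submission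
  imports Defs "HOL-Real_Asymp.Real_Asymp"
begin

text \<open>
  The trap times are obtained from the increments of \<open>V\<close> by a monotone change of
  variables, so both assertions are about what that change of variables does to a stable law.

  \<^bold>\<open>The law of a trap time.\<close> By self-similarity an increment over a time \<open>\<epsilon>\<close> is distributed as
  \<open>\<epsilon> powr (1/\<alpha>) * V 1\<close>, so \<open>tau_eps\<close> is distributed as \<open>G\<inverse> (V 1)\<close>, where \<open>G\<close> matches
  the tails of \<open>\<tau>0\<close> and \<open>V 1\<close>. That this is the law of \<open>\<tau>0\<close> is the quantile transformation
  (\<open>distr_G_inverse\<close>). It presupposes that \<open>G\<close> is well defined: the law of \<open>V 1\<close> must be free of
  atoms, live on \<open>(0, \<infinity>)\<close> and charge every interval there. All three are derived from the
  characteristic function and the independence of the increments (\<open>no_atoms\<close>, \<open>V_1_nonneg\<close>, \<open>tail_strict_antimono\<close>).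

  \<^bold>\<open>Convergence of the transfer functions.\<close> The tail of \<open>V 1\<close> is asymptotic to \<open>y powr - \<alpha>\<close>, with
  constant exactly 1 (\<open>upper_tail\<close>), and \<open>1/c_eps\<close> is the \<open>\<epsilon>\<close>-quantile of a tail that is regularly
  varying of the same index. Hence \<open>g_eps \<epsilon> x\<close> tends to \<open>x\<close> for each \<open>x\<close> (\<open>g_tendsto\<close>). Since slow
  variation gives no control of the constant, near 0 only the weaker bound
  \<open>g_eps \<epsilon> x \<le> C * (x powr \<beta> + \<epsilon> powr (\<beta> / \<alpha>))\<close> with \<open>\<alpha> < \<beta> < 1\<close> is available
  (\<open>g_power_bound\<close>).

  \<^bold>\<open>Small increments.\<close> To use that bound, the sum of the \<open>\<beta>\<close>-th powers of the small increments of \<open>V\<close>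
  over a bounded interval has to be small uniformly in the mesh. For
  \<open>\<phi> x = min x \<delta> powr \<beta>\<close>, the tail bound gives an expected value of order \<open>h * \<delta> powr (\<beta> - \<alpha>)\<close> for
  \<open>\<phi>\<close> of an increment over a time \<open>h\<close>, so that the expected sum over a mesh of an interval is of order
  \<open>\<delta> powr (\<beta> - \<alpha>)\<close>, whatever the mesh. As \<open>\<phi>\<close> is subadditive, these sums increase along dyadic
  refinements, and their supremum over the dyadic meshes dominates the sum for every mesh because the
  paths are right-continuous. Monotone convergence bounds the expected supremum, and letting \<open>\<delta>\<close> tend
  to 0 yields \<open>paths_negligible_small_increments\<close>. This replaces the description of \<open>V\<close> as
  the sum of its jumps.

  \<^bold>\<open>Convergence of the measures.\<close> What remains concerns one fixed path: a monotone right-continuous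
  function whose small increments are negligible. Large increments are few and \<open>g_eps\<close> is uniformly
  close to the identity on them, small ones are negligible before and after applying \<open>g_eps\<close>; this is
  vague convergence (\<open>vague\<close>). Near a point \<open>y\<close> the only cell of the mesh of non-negligible weight is
  the one that contains \<open>y\<close>, and its weight tends to the atom at \<open>y\<close>; compactness of the closure of
  the test set turns this into convergence of the numbers of atoms (\<open>point_process\<close>).
\<close>

section \<open>The stable exponent and its Levy measure\<close>

text \<open>The jumps of \<open>V\<close> per unit of time: normalised so that the mass of \<open>{a..}\<close> is \<open>a powr - \<alpha>\<close>.\<close>

definition levy_measure :: "real \<Rightarrow> real measure" where
  "levy_measure \<alpha> = density lborel (\<lambda>w. ennreal (indicator {0<..} w * (\<alpha> * w powr (-1 - \<alpha>))))"

lemma sets_levy_measure [simp, measurable_cong]: "sets (levy_measure \<alpha>) = sets borel"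
  by (simp add: levy_measure_def)

lemma space_levy_measure [simp]: "space (levy_measure \<alpha>) = UNIV"
  by (simp add: levy_measure_def)

lemma sigma_finite_levy_measure: "sigma_finite_measure (levy_measure \<alpha>)"
  unfolding levy_measure_def
  by (subst sigma_finite_measure.sigma_finite_iff_density_finite[OF sigma_finite_lborel]) auto

lemma AE_levy_measure_pos: "AE w in levy_measure \<alpha>. 0 < w"
  unfolding levy_measure_def
  by (subst AE_density) (auto simp: indicator_def split: if_splits)

lemma emeasure_levy_measure_tail:
  assumes "0 < \<alpha>" "0 < a"
  shows "emeasure (levy_measure \<alpha>) {a..} = ennreal (a powr - \<alpha>)"
proof -
  have I: "((\<lambda>x. x powr (-1-\<alpha>)) has_integral (a powr - \<alpha>) / \<alpha>) {a..}"
    using has_integral_powr_to_inf[of "-1-\<alpha>" a] assms by (simp add: field_simps)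
  have I2: "((\<lambda>x. \<alpha> * x powr (-1-\<alpha>)) has_integral (a powr - \<alpha>)) {a..}"
    using has_integral_mult_right[OF I, of \<alpha>] assms by simp
  have "emeasure (levy_measure \<alpha>) {a..} =
      (\<integral>\<^sup>+ w. ennreal (indicator {0<..} w * (\<alpha> * w powr (-1 - \<alpha>))) * indicator {a..} w \<partial>lborel)"
    unfolding levy_measure_def by (subst emeasure_density) auto
  also have "\<dots> = (\<integral>\<^sup>+ w. ennreal (\<alpha> * w powr (-1 - \<alpha>)) * indicator {a..} w \<partial>lborel)"
    using assms by (intro nn_integral_cong) (auto simp: indicator_def)
  also have "\<dots> = ennreal (a powr - \<alpha>)"
    using assms by (intro nn_integral_has_integral_lebesgue' I2) auto
  finally show ?thesis .
qed

text \<open>Both the integrability at 0 of \<open>w\<close>, which needs \<open>\<alpha> < 1\<close>, and that of constants at infinity are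
  used; this is why no compensating term occurs in the exponent.\<close>

lemma integrable_levy_measure_min:
  assumes "0 < \<alpha>" "\<alpha> < 1"
  shows "integrable (levy_measure \<alpha>) (\<lambda>w. min 1 \<bar>w\<bar>)"
proof (rule integrableI_bounded)
  have I: "((\<lambda>x. \<alpha> * x powr (-\<alpha>)) has_integral (\<alpha> / (1-\<alpha>))) {0..1}"
    using has_integral_mult_right[OF has_integral_powr_from_0[of "-\<alpha>" 1], of \<alpha>] assms by simp
  have "(\<integral>\<^sup>+ w. ennreal (norm (min 1 \<bar>w\<bar>)) \<partial>levy_measure \<alpha>) =
     (\<integral>\<^sup>+ w. ennreal (indicator {0<..} w * (\<alpha> * w powr (-1 - \<alpha>))) * ennreal (norm (min 1 \<bar>w\<bar>)) \<partial>lborel)"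
    unfolding levy_measure_def by (subst nn_integral_density) auto
  also have "\<dots> \<le> (\<integral>\<^sup>+ w. ennreal (\<alpha> * w powr (-\<alpha>)) * indicator {0..1} w +
      ennreal (indicator {0<..} w * (\<alpha> * w powr (-1 - \<alpha>))) * indicator {1..} w \<partial>lborel)"
  proof (intro nn_integral_mono)
    fix w :: real
    have "w powr (-1-\<alpha>) * w = w powr (-\<alpha>)" if "w > 0"
      using that powr_mult_base[of w "-1-\<alpha>"] by (simp add: mult.commute)
    then show "ennreal (indicator {0<..} w * (\<alpha> * w powr (-1 - \<alpha>))) * ennreal (norm (min 1 \<bar>w\<bar>))
      \<le> ennreal (\<alpha> * w powr (-\<alpha>)) * indicator {0..1} w +
        ennreal (indicator {0<..} w * (\<alpha> * w powr (-1 - \<alpha>))) * indicator {1..} w"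
      using assms by (cases "w \<le> 0"; cases "w < 1"; cases "w = 1")
        (auto simp: indicator_def ennreal_mult'[symmetric] mult.assoc min_def)
  qed
  also have "\<dots> = (\<integral>\<^sup>+ w. ennreal (\<alpha> * w powr (-\<alpha>)) * indicator {0..1} w \<partial>lborel) +
      emeasure (levy_measure \<alpha>) {1..}"
    unfolding levy_measure_def
    by (subst nn_integral_add) (auto simp: emeasure_density)
  also have "\<dots> = ennreal (\<alpha> / (1-\<alpha>)) + ennreal (1 powr - \<alpha>)"
    using assms by (subst emeasure_levy_measure_tail, simp, simp)
      (intro arg_cong2[where f="(+)"] nn_integral_has_integral_lebesgue' I, auto)
  also have "\<dots> < \<infinity>" by simp
  finally show "(\<integral>\<^sup>+ w. ennreal (norm (min 1 \<bar>w\<bar>)) \<partial>levy_measure \<alpha>) < \<infinity>" .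
qed simp

lemma norm_iexp_minus_1_le: "cmod (iexp (r * w) - 1) \<le> (2 + \<bar>r\<bar>) * min 1 \<bar>w\<bar>"
proof -
  have "cmod (iexp (r * w) - 1) \<le> \<bar>r * w\<bar>"
    using iexp_approx1[of "r * w" 0] by simp
  moreover have "cmod (iexp (r * w) - 1) \<le> 2"
    using norm_triangle_ineq4[of "iexp (r*w)" 1] by simp
  ultimately show ?thesis
    by (auto simp: min_def abs_mult algebra_simps intro: order_trans)
qed

definition stable_exponent :: "real \<Rightarrow> real \<Rightarrow> complex" where
  "stable_exponent \<alpha> r = (\<integral>w. iexp (r * w) - 1 \<partial>levy_measure \<alpha>)"

lemma integrable_stable_exponent:
  assumes "0 < \<alpha>" "\<alpha> < 1"
  shows "integrable (levy_measure \<alpha>) (\<lambda>w. iexp (r * w) - 1)"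
  by (rule Bochner_Integration.integrable_bound[OF
    integrable_mult_right[OF integrable_levy_measure_min[OF assms], of "2 + \<bar>r\<bar>"]])
    (use norm_iexp_minus_1_le[of r] in \<open>auto intro!: AE_I2 simp: abs_mult\<close>)

lemma stable_exponent_eq:
  assumes "0 < \<alpha>"
  shows "stable_exponent \<alpha> r = complex_of_real \<alpha> *
     (LINT w:{0<..}|lborel. (iexp (r * w) - 1) * complex_of_real (w powr (-1 - \<alpha>)))"
proof -
  have "stable_exponent \<alpha> r =
     (\<integral>w. (indicator {0<..} w * (\<alpha> * w powr (-1 - \<alpha>))) *\<^sub>R (iexp (r * w) - 1) \<partial>lborel)"
    unfolding stable_exponent_def levy_measure_def
    using assms by (subst integral_density) (auto simp: indicator_def)
  also have "\<dots> = (\<integral>w. complex_of_real \<alpha> *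
       (indicator {0<..} w *\<^sub>R ((iexp (r * w) - 1) * complex_of_real (w powr (-1 - \<alpha>)))) \<partial>lborel)"
    by (intro Bochner_Integration.integral_cong) (auto simp: indicator_def scaleR_conv_of_real)
  also have "\<dots> = complex_of_real \<alpha> * (\<integral>w.
       (indicator {0<..} w *\<^sub>R ((iexp (r * w) - 1) * complex_of_real (w powr (-1 - \<alpha>)))) \<partial>lborel)"
    by (rule integral_mult_right_zero)
  finally show ?thesis
    by (simp only: set_lebesgue_integral_def)
qed

lemma stable_exponent_0 [simp]: "stable_exponent \<alpha> 0 = 0"
  by (simp add: stable_exponent_def)

text \<open>The substitution \<open>w \<mapsto> w / k\<close> in the exponent; it is the source of the self-similarity of \<open>V\<close>.\<close>

lemma stable_exponent_scale:
  assumes "0 < \<alpha>" "0 < k"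
  shows "stable_exponent \<alpha> (k * r) = complex_of_real (k powr \<alpha>) * stable_exponent \<alpha> r"
proof -
  define f where "f = (\<lambda>w. indicator {0<..} w *\<^sub>R ((iexp (k * r * w) - 1) *
      complex_of_real (w powr (-1 - \<alpha>))))"
  define g where "g = (\<lambda>w. indicator {0<..} w *\<^sub>R ((iexp (r * w) - 1) * complex_of_real (w powr (-1 - \<alpha>))))"
  have pw: "(1/k) powr (-1-\<alpha>) = k powr \<alpha> * k"
    using assms by (simp add: powr_divide powr_minus powr_diff field_simps)
  have "f (w / k) = (k powr \<alpha> * k) *\<^sub>R g w" for w
  proof -
    have "(w/k) powr (-1-\<alpha>) = (k powr \<alpha> * k) * w powr (-1-\<alpha>)" if "w > 0"
      using powr_mult[of w "1/k" "-1-\<alpha>"] pw that assms by (simp add: mult.commute)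
    then show ?thesis
      using assms by (auto simp: f_def g_def indicator_def zero_less_divide_iff scaleR_conv_of_real
          algebra_simps)
  qed
  then have "(\<integral>w. f w \<partial>lborel) = \<bar>1/k\<bar> *\<^sub>R (\<integral>w. (k powr \<alpha> * k) *\<^sub>R g w \<partial>lborel)"
    using lborel_integral_real_affine[of "1/k" f 0] assms by simp
  also have "\<dots> = k powr \<alpha> *\<^sub>R (\<integral>w. g w \<partial>lborel)"
    using assms by simp
  finally show ?thesis
    unfolding stable_exponent_eq[OF assms(1)] set_lebesgue_integral_def f_def[symmetric] g_def[symmetric]
    by (simp add: scaleR_conv_of_real)
qed

lemma stable_exponent_minus: "stable_exponent \<alpha> (- r) = cnj (stable_exponent \<alpha> r)"
proof -
  have "stable_exponent \<alpha> (-r) = (\<integral>w. cnj (iexp (r * w) - 1) \<partial>levy_measure \<alpha>)"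
    unfolding stable_exponent_def
    by (intro Bochner_Integration.integral_cong) (auto simp: exp_cnj)
  then show ?thesis by (simp only: Bochner_Integration.integral_cnj stable_exponent_def)
qed

text \<open>The real part is minus the integral of \<open>1 - cos w\<close>, which is bounded below on \<open>{1..<2}\<close>. Its sign
  makes the characteristic functions of the increments integrable.\<close>

lemma Re_stable_exponent_1_neg:
  assumes "0 < \<alpha>" "\<alpha> < 1"
  shows "Re (stable_exponent \<alpha> 1) < 0"
proof -
  note [measurable] = sets_levy_measure
  have int: "integrable (levy_measure \<alpha>) (\<lambda>w. 1 - cos w)"
  proof -
    have "integrable (levy_measure \<alpha>) (\<lambda>w. - Re (iexp (1 * w) - 1))"
      using integrable_stable_exponent[OF assms, of 1]
      by (intro Bochner_Integration.integrable_minus integrable_Re)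
    then show ?thesis by (simp add: Re_exp)
  qed
  have "Re (stable_exponent \<alpha> 1) = (\<integral>w. Re (iexp (1 * w) - 1) \<partial>levy_measure \<alpha>)"
    unfolding stable_exponent_def using integrable_stable_exponent[OF assms, of 1]
    by (subst integral_Re) auto
  also have "\<dots> = - (\<integral>w. 1 - cos w \<partial>levy_measure \<alpha>)"
    by (subst Bochner_Integration.integral_minus[symmetric]) (simp add: Re_exp)
  finally have eq: "Re (stable_exponent \<alpha> 1) = - (\<integral>w. 1 - cos w \<partial>levy_measure \<alpha>)" .
  have e1: "emeasure (levy_measure \<alpha>) {1..} =
      emeasure (levy_measure \<alpha>) {1..<2} + emeasure (levy_measure \<alpha>) {2..}"
    by (subst plus_emeasure) (auto intro!: arg_cong[where f="emeasure _"])
  then have fin: "emeasure (levy_measure \<alpha>) {1..<2} < \<infinity>"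
    by (simp add: emeasure_levy_measure_tail assms less_top[symmetric])
      (metis ennreal_add_eq_top ennreal_one_neq_top)
  have "emeasure (levy_measure \<alpha>) {2..} < \<infinity>"
    by (simp add: emeasure_levy_measure_tail assms)
  then have "measure (levy_measure \<alpha>) {1..} =
      measure (levy_measure \<alpha>) {1..<2} + measure (levy_measure \<alpha>) {2..}"
    using e1 fin by (simp add: measure_def enn2real_plus)
  then have m12: "measure (levy_measure \<alpha>) {1..<2} = 1 - 2 powr -\<alpha>"
    by (simp add: measure_def emeasure_levy_measure_tail assms)
  have [measurable]: "{1..<2::real} \<in> sets (levy_measure \<alpha>)" by (simp add: sets_levy_measure)
  have "integrable (levy_measure \<alpha>) (indicat_real {1..<2})"
    by (rule integrable_real_indicator) (use fin in simp_all)
  then have int2: "integrable (levy_measure \<alpha>) (\<lambda>w. (1 - cos (1::real)) * indicator {1..<2::real} w)"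
    by (rule integrable_mult_right)
  have "0 < (1 - cos 1) * (1 - 2 powr -\<alpha>)"
    using assms cos_monotone_0_pi[of 0 1] pi_gt3 powr_less_one[of 2 "-\<alpha>"]
    by (intro mult_pos_pos) (auto simp: powr_minus field_simps)
  also have "\<dots> = (\<integral>w. (1 - cos 1) * indicator {1..<2::real} w \<partial>levy_measure \<alpha>)"
    using m12 by simp
  also have "\<dots> \<le> (\<integral>w. 1 - cos w \<partial>levy_measure \<alpha>)"
  proof (intro integral_mono int int2)
    fix w :: real
    show "(1 - cos 1) * indicator {1..<2::real} w \<le> 1 - cos w"
      using cos_monotone_0_pi_le[of 1 w] pi_gt3 by (auto simp: indicator_def)
  qed
  finally show ?thesis using eq by simp
qed

text \<open>Scaling determines the exponent from its values at 1 and \<open>-1\<close>. In particular it is measurable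
  and grows like a power, as dominated convergence requires below.\<close>

lemma stable_exponent_abs:
  assumes "0 < \<alpha>" "r \<noteq> 0"
  shows "stable_exponent \<alpha> r = complex_of_real (\<bar>r\<bar> powr \<alpha>) * stable_exponent \<alpha> (sgn r)"
  using stable_exponent_scale[OF assms(1), of "\<bar>r\<bar>" "sgn r"] assms(2)
  by (simp add: abs_mult_sgn)

lemma norm_stable_exponent:
  assumes "0 < \<alpha>"
  shows "cmod (stable_exponent \<alpha> r) = \<bar>r\<bar> powr \<alpha> * cmod (stable_exponent \<alpha> 1)"
proof (cases "r = 0")
  case False
  have "cmod (stable_exponent \<alpha> (sgn r)) = cmod (stable_exponent \<alpha> 1)"
    using False stable_exponent_minus[of \<alpha> 1] by (cases "r > 0") auto
  then show ?thesis
    unfolding stable_exponent_abs[OF assms False] norm_mult norm_of_real by simp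
qed simp

lemma Re_stable_exponent:
  assumes "0 < \<alpha>"
  shows "Re (stable_exponent \<alpha> r) = \<bar>r\<bar> powr \<alpha> * Re (stable_exponent \<alpha> 1)"
proof (cases "r = 0")
  case False
  have "Re (stable_exponent \<alpha> (sgn r)) = Re (stable_exponent \<alpha> 1)"
    using False stable_exponent_minus[of \<alpha> 1] by (cases "r > 0") auto
  then show ?thesis
    unfolding stable_exponent_abs[OF assms False]
        by (simp only: Re_complex_of_real Im_complex_of_real times_complex.simps)
qed simp

lemma measurable_stable_exponent:
  assumes "0 < \<alpha>"
  shows "stable_exponent \<alpha> \<in> borel_measurable borel"
proof -
  have eq: "stable_exponent \<alpha> = (\<lambda>r. if r =
      0 then 0 else if r > 0 then complex_of_real (\<bar>r\<bar> powr \<alpha>) * stable_exponent \<alpha> 1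
      else complex_of_real (\<bar>r\<bar> powr \<alpha>) * stable_exponent \<alpha> (-1))"
  proof
    fix r :: real
    show "stable_exponent \<alpha> r = (if r = 0 then 0 else if r > 0 then complex_of_real (\<bar>r\<bar> powr \<alpha>) *
        stable_exponent \<alpha> 1
      else complex_of_real (\<bar>r\<bar> powr \<alpha>) * stable_exponent \<alpha> (-1))"
      using stable_exponent_abs[OF assms, of r] by (cases r "0::real" rule: linorder_cases) simp_all
  qed
  show ?thesis by (subst eq) measurable
qed

lemma integral_cos_0_1:
  "(\<integral>h. indicator {0..1} h *\<^sub>R (1 - cos (h * w)) \<partial>lborel) = 1 - sinc w" for w :: real
proof (cases "w = 0")
  case False
  define F where "F = (\<lambda>h. h - sin (h * w) / w)"
  have "(\<integral>h. (1 - cos (h * w)) * indicator {0..1} h \<partial>lborel) = F 1 - F 0"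
    unfolding F_def using False
    by (intro integral_FTC_Icc_real) (auto intro!: derivative_eq_intros continuous_intros)
  then show ?thesis
    using False by (simp add: F_def mult.commute)
qed simp

lemma sinc_le_1: "sinc w \<le> 1" 
proof -
  have "sin w / w \<le> 1" if "w \<noteq> 0"
    using that sin_x_le_x[of w] sin_x_ge_neg_x[of "-w"] sin_x_le_x[of "-w"]
        by (cases "w > 0") (auto simp: divide_simps)
  then show ?thesis by auto
qed

lemma one_minus_cos_le: "0 \<le> h \<Longrightarrow> h \<le> 1 \<Longrightarrow> \<bar>1 - cos (h * w)\<bar> \<le> 3 * min 1 \<bar>w\<bar>" for w :: real
proof -
  assume h: "0 \<le> h" "h \<le> 1"
  have "\<bar>1 - cos (h * w)\<bar> \<le> cmod (iexp (h * w) - 1)"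
    using abs_Re_le_cmod[of "iexp (h * w) - 1"] by (simp add: Re_exp abs_minus_commute)
  also have "\<dots> \<le> (2 + \<bar>h\<bar>) * min 1 \<bar>w\<bar>" by (rule norm_iexp_minus_1_le)
  also have "\<dots> \<le> 3 * min 1 \<bar>w\<bar>" using h by (intro mult_right_mono) auto
  finally show ?thesis .
qed

lemma one_minus_sinc_le: "\<bar>1 - sinc w\<bar> \<le> 3 * min 1 \<bar>w\<bar>"
proof -
  have "norm (\<integral>h. indicator {0..1} h *\<^sub>R (1 - cos (h * w)) \<partial>lborel) \<le>
      (\<integral>h. indicator {0..1::real} h * (3 * min 1 \<bar>w\<bar>) \<partial>lborel)"
  proof (rule order_trans[OF integral_norm_bound integral_mono])
    have i: "integrable lborel (\<lambda>h. indicator {0..1} h *\<^sub>R (1 - cos (h * w)))"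
      by (intro borel_integrable_atLeastAtMost'[unfolded set_integrable_def] continuous_intros)
    show "integrable lborel (\<lambda>h. norm (indicator {0..1} h *\<^sub>R (1 - cos (h * w))))"
      by (rule integrable_norm[OF i])
    show "integrable lborel (\<lambda>h::real. indicator {0..1} h * (3 * min 1 \<bar>w\<bar>))"
      by (intro integrable_mult_left integrable_real_indicator) auto
  qed (use one_minus_cos_le[of _ w] in \<open>auto simp: indicator_def\<close>)
  then show ?thesis unfolding integral_cos_0_1 by simp
qed

text \<open>Averaging the factors \<open>1 - cos (h * w)\<close> over \<open>h\<close> in the unit interval gives a weight that vanishes
  only at 0 and stays away from 0 at infinity, in contrast to each single factor. The weighted
  transform is still accessible from the characteristic function, because each factor is.\<close>

lemma sinc_average:
  fixes \<eta> :: "real measure"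
  assumes "sigma_finite_measure \<eta>" and [measurable_cong]: "sets \<eta> = sets borel"
    and int: "integrable \<eta> (\<lambda>w. min 1 \<bar>w\<bar>)"
  shows "(\<integral>h. indicator {0..1} h *\<^sub>R (\<integral>w. (1 - cos (h * w)) *\<^sub>R iexp (r * w) \<partial>\<eta>) \<partial>lborel) =
    (\<integral>w. (1 - sinc w) *\<^sub>R iexp (r * w) \<partial>\<eta>)"
proof -
  interpret \<eta>: sigma_finite_measure \<eta> by fact
  interpret P: pair_sigma_finite lborel \<eta> ..
  define f where "f = (\<lambda>(h::real, w::real). (indicator {0..1} h * (1 - cos (h * w))) *\<^sub>R iexp (r * w))"
  have f[measurable]: "f \<in> borel_measurable (lborel \<Otimes>\<^sub>M \<eta>)"
    unfolding f_def by measurable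
  have bnd: "norm (f (h, w)) \<le> indicator {0..1} h * (3 * min 1 \<bar>w\<bar>)" for h w
    using one_minus_cos_le[of h w] by (auto simp: f_def indicator_def)
  have i1: "integrable \<eta> (\<lambda>w. f (h, w))" for h
    by (rule Bochner_Integration.integrable_bound[OF
      integrable_mult_right[OF integrable_mult_right[OF int, of 3], of "indicator {0..1} h"]])
      (use bnd[of h] in \<open>auto intro!: AE_I2 simp: abs_mult\<close>)
  have "integrable (lborel \<Otimes>\<^sub>M \<eta>) f"
  proof (rule P.Fubini_integrable)
    have "integrable lborel (\<lambda>h. indicator {0..1::real} h * (3 * (\<integral>w. min 1 \<bar>w\<bar> \<partial>\<eta>)))"
      by (intro integrable_mult_left integrable_real_indicator) auto
    then show "integrable lborel (\<lambda>h. \<integral>w. norm (f (h, w)) \<partial>\<eta>)"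
    proof (rule Bochner_Integration.integrable_bound)
      show "AE h in lborel. norm (\<integral>w. norm (f (h, w)) \<partial>\<eta>) \<le>
          norm (indicator {0..1::real} h * (3 * (\<integral>w. min 1 \<bar>w\<bar> \<partial>\<eta>)))"
      proof (rule AE_I2)
        fix h
        have "(\<integral>w. norm (f (h, w)) \<partial>\<eta>) \<le> (\<integral>w. indicator {0..1} h * (3 * min 1 \<bar>w\<bar>) \<partial>\<eta>)"
          by (intro integral_mono integrable_norm i1 bnd integrable_mult_right int)
        then show "norm (\<integral>w. norm (f (h, w)) \<partial>\<eta>) \<le>
            norm (indicator {0..1::real} h * (3 * (\<integral>w. min 1 \<bar>w\<bar> \<partial>\<eta>)))"
          using int by simp
      qed
    qed measurable
  qed (use i1 in auto)
  then have "(\<integral>h. (\<integral>w. f (h, w) \<partial>\<eta>) \<partial>lborel) = (\<integral>w. (\<integral>h. f (h, w) \<partial>lborel) \<partial>\<eta>)"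
    using P.Fubini_integral[of "\<lambda>h w. f (h, w)"] by simp
  moreover have "(\<integral>h. f (h, w) \<partial>lborel) = (1 - sinc w) *\<^sub>R iexp (r * w)" for w
  proof -
    have "(\<integral>h. f (h, w) \<partial>lborel) = (\<integral>h. (indicator {0..1} h *\<^sub>R (1 - cos (h * w))) *\<^sub>R iexp (r *
        w) \<partial>lborel)"
      by (simp add: f_def)
    also have "\<dots> = (\<integral>h. indicator {0..1} h *\<^sub>R (1 - cos (h * w)) \<partial>lborel) *\<^sub>R iexp (r * w)"
      by (intro integral_scaleR_left impI borel_integrable_atLeastAtMost'[unfolded set_integrable_def]
        continuous_intros)
    finally show ?thesis by (simp only: integral_cos_0_1)
  qed
  moreover have "(\<integral>w. f (h, w) \<partial>\<eta>) = indicator {0..1} h *\<^sub>R (\<integral>w. (1 - cos (h * w)) *\<^sub>R iexp (r * w) \<partial>\<eta>)"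
      for h
    by (simp add: f_def scaleR_scaleR[symmetric] del: scaleR_scaleR)
  ultimately show ?thesis by simp
qed

section \<open>Stable laws: absence of atoms and tails\<close>

lemma norm_exp_minus_1_le:
  fixes z :: complex
  assumes "Re z \<le> 0"
  shows "cmod (exp z - 1) \<le> cmod z"
proof -
  have "cmod (exp z - exp 0) \<le> 1 * cmod (z - 0)"
  proof (rule field_differentiable_bound[where S="{z. Re z \<le> 0}" and f'=exp])
    show "convex {z. Re z \<le> 0}" by (rule convex_halfspace_Re_le)
  qed (use assms in \<open>auto intro!: derivative_eq_intros\<close>)
  then show ?thesis by simp
qed

text \<open>Applied to the exponent of an increment over the time \<open>1 / (n + 1)\<close>, whose characteristic function is
  \<open>exp (z / (n + 1))\<close>.\<close>

lemma tendsto_exp_difference_quotient: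
  fixes z :: complex
  shows "(\<lambda>n. of_nat (Suc n) * (exp (z / of_nat (Suc n)) - 1)) \<longlonglongrightarrow> z"
proof (cases "z = 0")
  case False
  have d: "((\<lambda>h. (exp h - 1) / h) \<longlongrightarrow> 1) (at (0::complex))"
    using DERIV_exp[of "0::complex"] by (simp add: DERIV_def)
  have "(\<lambda>n. z / of_nat (Suc n)) \<longlonglongrightarrow> 0"
    using tendsto_mult_right_zero[OF LIMSEQ_inverse_real_of_nat[THEN tendsto_of_real[where 'a=complex],
        simplified], of z]
    by (simp add: divide_inverse)
  then have "filterlim (\<lambda>n. z / of_nat (Suc n)) (at 0) sequentially"
    using False by (auto simp: filterlim_at simp del: of_nat_Suc)
  from filterlim_compose[OF d this]
  have "(\<lambda>n. (exp (z / of_nat (Suc n)) - 1) / (z / of_nat (Suc n))) \<longlonglongrightarrow> 1" .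
  from tendsto_mult[OF this tendsto_const[of z]] show ?thesis
    using False by (simp add: divide_divide_eq_right mult.commute del: of_nat_Suc)
qed simp

lemma integrable_exp_minus_powr:
  assumes "0 < c" "0 < \<alpha>"
  shows "integrable lborel (\<lambda>t::real. exp (- (c * \<bar>t\<bar> powr \<alpha>)))"
proof -
  \<comment> \<open>Comparing the exponential with a \<open>k\<close>-th power makes the integrand decay like
    \<open>1 / t\<^sup>2\<close> as soon as \<open>k * \<alpha> \<ge> 2\<close>.\<close>
  obtain k :: nat where k: "real k * \<alpha> \<ge> 2" "k > 0"
  proof -
    obtain k :: nat where "2 / \<alpha> < real k" using reals_Archimedean2 by blast
    moreover from this assms have "k > 0" by (cases k) (auto simp: field_simps)
    ultimately show ?thesis using assms by (intro that[of k]) (auto simp: field_simps)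
  qed
  define C where "C = 2 + 2 * (real k / c) ^ k"
  have i: "integrable lborel (\<lambda>t::real. C * inverse (1 + t\<^sup>2))"
    using integrable_inverse_1_plus_square by (simp add: set_integrable_def einterval_def)
  show ?thesis
  proof (rule Bochner_Integration.integrable_bound[OF i])
    show "AE t in lborel. norm (exp (- (c * \<bar>t\<bar> powr \<alpha>))) \<le> norm (C * inverse (1 + t\<^sup>2))"
    proof (rule AE_I2)
      fix t :: real
      have C0: "C \<ge> 2" using assms by (simp add: C_def)
      have pos: "0 < 1 + t\<^sup>2" by (simp add: add_pos_nonneg)
      have "exp (- (c * \<bar>t\<bar> powr \<alpha>)) * (1 + t\<^sup>2) \<le> C"
      proof (cases "\<bar>t\<bar> < 1")
        case True
        then have "t\<^sup>2 \<le> 1" by (simp add: abs_square_le_1)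
        moreover have "exp (- (c * \<bar>t\<bar> powr \<alpha>)) \<le> 1" using assms by simp
        ultimately have "exp (- (c * \<bar>t\<bar> powr \<alpha>)) * (1 + t\<^sup>2) \<le> 1 * 2"
          by (intro mult_mono) auto
        then show ?thesis using C0 by simp
      next
        case False
        define u where "u = c * \<bar>t\<bar> powr \<alpha>"
        have u: "u > 0" using False assms by (simp add: u_def)
        have "(u / k) ^ k \<le> exp (u / k) ^ k"
          using u k order_trans[OF _ exp_ge_add_one_self[of "u / k"], of "u / k"] by (intro power_mono) auto
        also have "\<dots> = exp u" using k by (simp add: exp_of_nat_mult[symmetric])
        finally have e1: "(u / k) ^ k \<le> exp u" .
        have "\<bar>t\<bar> powr 2 \<le> \<bar>t\<bar> powr (real k * \<alpha>)"
          using False k by (intro powr_mono) auto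
        also have "\<bar>t\<bar> powr 2 = t\<^sup>2" using False by (simp add: powr_numeral)
        also have "\<bar>t\<bar> powr (real k * \<alpha>) = (u / c) ^ k"
          using assms False by (simp add: u_def powr_powr[symmetric] powr_realpow mult.commute)
        finally have e2: "t\<^sup>2 \<le> (u / c) ^ k" .
        have "1 \<le> t\<^sup>2" using False by (simp add: abs_square_le_1 not_less one_le_power flip:
            abs_square_less_1)
        then have "1 + t\<^sup>2 \<le> 2 * (u / c) ^ k" using e2 by simp
        also have "\<dots> = (2 * (real k / c) ^ k) * (u / k) ^ k"
          using k by (simp add: power_divide)
        also have "\<dots> \<le> (2 * (real k / c) ^ k) * exp u"
          using e1 assms by (intro mult_left_mono) auto
        also have "\<dots> \<le> C * exp u"
          by (intro mult_right_mono) (auto simp: C_def)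
        finally show ?thesis by (simp add: u_def[symmetric] exp_minus field_simps)
      qed
      then show "norm (exp (- (c * \<bar>t\<bar> powr \<alpha>))) \<le> norm (C * inverse (1 + t\<^sup>2))"
        using pos C0 by (simp add: field_simps)
    qed
  qed measurable
qed

text \<open>In the inversion formula the kernel is bounded by \<open>b - a\<close>, so an integrable characteristic function
  makes the mass of an interval at most proportional to its length. The formula requires end points
  that are not atoms; these are dense, since atoms are countable.\<close>

lemma (in real_distribution) no_atoms_of_integrable_char:
  assumes int: "integrable lborel (\<lambda>t. cmod (char M t))"
  shows "measure M {x} = 0"
proof -
  define C where "C = 1 / (2 * pi) * (\<integral>t. cmod (char M t) \<partial>lborel)"
  have C0: "C \<ge> 0" by (simp add: C_def)
  have bnd: "measure M {a<..b} \<le> (b - a) * C"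
    if ab: "a \<le> b" "measure M {a} = 0" "measure M {b} = 0" for a b
  proof -
    define F where "F = (\<lambda>t::real. (iexp (-(t * a)) - iexp (-(t * b))) / (\<i> * t))"
    have F: "cmod (F t) \<le> b - a" for t
      using Levy_Inversion_aux2[of "-b" "-a" t] ab(1) by (cases "t = 0") (auto simp: F_def)
    have "norm (1 / (2 * pi) * (CLBINT t=-T..T. F t * char M t)) \<le> (b - a) * C" if "T \<ge> 0" for T :: real
    proof -
      have "cmod (CLBINT t=-T..T. F t * char M t) =
          cmod (\<integral>t. indicator {-T..T} t *\<^sub>R (F t * char M t) \<partial>lborel)"
        using that by (simp add: interval_integral_Icc set_lebesgue_integral_def)
      also have "\<dots> \<le> (\<integral>t. cmod (indicator {-T..T} t *\<^sub>R (F t * char M t)) \<partial>lborel)"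
        by (rule integral_norm_bound)
      also have "\<dots> \<le> (\<integral>t. (b - a) * cmod (char M t) \<partial>lborel)"
        using F ab(1)
        by (intro integral_mono' integrable_mult_right int)
          (auto simp: indicator_def norm_mult intro: mult_right_mono)
      also have "\<dots> = (b - a) * C * (2 * pi)"
        by (simp add: C_def)
      finally show ?thesis by (simp add: norm_mult norm_divide field_simps)
    qed
    then have "\<forall>\<^sub>F T in sequentially. norm (complex_of_real (1 / (2 * pi)) *
        (CLBINT t=-real T..real T. F t * char M t)) \<le> (b - a) * C"
      by (intro always_eventually) simp
    moreover have "(\<lambda>T::nat. norm (1 / (2 * pi) * (CLBINT t=-real T..real T. F t * char M t))) \<longlonglongrightarrow>
        norm (complex_of_real (measure M {a<..b}))"
      using Levy_Inversion[OF ab(1) ab(2,3)] unfolding F_def by (intro tendsto_norm) simp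
    ultimately have "norm (complex_of_real (measure M {a<..b})) \<le> (b - a) * C"
      by (intro tendsto_upperbound) auto
    then show ?thesis by simp
  qed
  have "measure M {x} \<le> e" if "e > 0" for e
  proof -
    define d where "d = e / (2 * (C + 1))"
    have d: "d > 0" using that C0 by (simp add: d_def)
    have cnt: "countable {x. measure M {x} \<noteq> 0}" by (rule countable_support)
    have ex: "\<exists>a\<in>{u<..<v}. measure M {a} = 0" if "u < v" for u v
    proof (rule ccontr)
      assume "\<not> ?thesis"
      then have "{u<..<v} \<subseteq> {x. measure M {x} \<noteq> 0}" by auto
      then have "countable {u<..<v}" by (rule countable_subset[OF _ cnt])
      then show False using uncountable_open_interval[of u v] that by blast
    qed
    obtain a where a: "x - d < a" "a < x" "measure M {a} = 0" using ex[of "x - d" x] d by auto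
    obtain b where b: "x < b" "b < x + d" "measure M {b} = 0" using ex[of x "x + d"] d by auto
    note ab = a b
    have "measure M {x} \<le> measure M {a<..b}"
      using ab by (intro finite_measure_mono) auto
    also have "\<dots> \<le> (b - a) * C" using ab by (intro bnd) auto
    also have "\<dots> \<le> (2 * d) * (C + 1)" using ab d C0 by (intro mult_mono) auto
    also have "\<dots> = e" using C0 by (simp add: d_def field_simps)
    finally show ?thesis .
  qed
  then show ?thesis
    using field_le_epsilon[of "measure M {x}" 0] measure_nonneg[of M "{x}"] by (intro antisym) auto
qed

text \<open>Monotonicity fills the gaps between the points \<open>2 * n powr (1/\<alpha>)\<close>, because the ratio of the values of
  \<open>y powr \<alpha>\<close> at consecutive points tends to 1.\<close>

lemma regular_tail_from_sequence:
  fixes T :: "real \<Rightarrow> real"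
  assumes \<alpha>: "0 < \<alpha>" and anti: "antimono T" and nonneg: "\<And>y. 0 \<le> T y"
    and lim: "(\<lambda>n. real n * T (2 * real n powr (1 / \<alpha>))) \<longlonglongrightarrow> c"
  shows "((\<lambda>y. y powr \<alpha> * T y) \<longlongrightarrow> 2 powr \<alpha> * c) at_top"
proof -
  \<comment> \<open>The index for which \<open>y\<close> lies between consecutive points \<open>2 * n powr (1/\<alpha>)\<close>.\<close>
  define m where "m = (\<lambda>y::real. nat \<lfloor>(y / 2) powr \<alpha>\<rfloor>)"
  have "filterlim (\<lambda>y::real. (y / 2) powr \<alpha>) at_top at_top"
    using \<alpha> by real_asymp
  then have m_top: "filterlim m at_top at_top"
    unfolding m_def
    by (intro filterlim_compose[OF filterlim_nat_sequentially]
      filterlim_compose[OF filterlim_floor_sequentially])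
  have m_le: "real (m y) \<le> (y / 2) powr \<alpha>" "(y / 2) powr \<alpha> \<le> real (Suc (m y))" for y
    unfolding m_def by (auto simp: of_nat_nat) linarith
  have up: "y powr \<alpha> * T y \<le> 2 powr \<alpha> * (real (Suc (m y)) * T (2 * real (m y) powr (1/\<alpha>)))"
    and low: "2 powr \<alpha> * (real (m y) * T (2 * real (Suc (m y)) powr (1/\<alpha>))) \<le> y powr \<alpha> * T y"
    if y: "y > 0" for y
  proof -
    have e: "((y / 2) powr \<alpha>) powr (1/\<alpha>) = y / 2" "y powr \<alpha> = 2 powr \<alpha> * (y / 2) powr \<alpha>"
      using y \<alpha> by (simp_all add: powr_powr powr_divide)
    have "real (m y) powr (1/\<alpha>) \<le> y / 2"
      using powr_mono2[OF _ _ m_le(1)[of y], of "1/\<alpha>"] \<alpha> e(1) by simp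
    then have 1: "T y \<le> T (2 * real (m y) powr (1/\<alpha>))"
      by (intro antimonoD[OF anti]) simp
    have "y / 2 \<le> real (Suc (m y)) powr (1/\<alpha>)"
      using powr_mono2[OF _ _ m_le(2)[of y], of "1/\<alpha>"] \<alpha> e(1) by simp
    then have 2: "T (2 * real (Suc (m y)) powr (1/\<alpha>)) \<le> T y"
      by (intro antimonoD[OF anti]) simp
    show "y powr \<alpha> * T y \<le> 2 powr \<alpha> * (real (Suc (m y)) * T (2 * real (m y) powr (1/\<alpha>)))"
      unfolding e(2) mult.assoc using m_le(2)[of y] 1 nonneg by (intro mult_left_mono mult_mono) auto
    show "2 powr \<alpha> * (real (m y) * T (2 * real (Suc (m y)) powr (1/\<alpha>))) \<le> y powr \<alpha> * T y"
      unfolding e(2) mult.assoc using m_le(1)[of y] 2 nonneg by (intro mult_left_mono mult_mono) auto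
  qed
  have r1: "(\<lambda>n. real (Suc n) / real n) \<longlonglongrightarrow> 1" and r2: "(\<lambda>n. real n / real (Suc n)) \<longlonglongrightarrow> 1"
    by real_asymp+
  have l1: "(\<lambda>n. real (Suc n) * T (2 * real n powr (1/\<alpha>))) \<longlonglongrightarrow> c"
  proof (rule Lim_transform_eventually)
    show "(\<lambda>n. (real (Suc n) / real n) * (real n * T (2 * real n powr (1/\<alpha>)))) \<longlonglongrightarrow> c"
      using tendsto_mult[OF r1 lim] by simp
    show "\<forall>\<^sub>F n in sequentially. (real (Suc n) / real n) * (real n * T (2 * real n powr (1/\<alpha>))) =
       real (Suc n) * T (2 * real n powr (1/\<alpha>))"
      using eventually_gt_at_top[of 0] by eventually_elim simp
  qed
  have l2: "(\<lambda>n. real n * T (2 * real (Suc n) powr (1/\<alpha>))) \<longlonglongrightarrow> c"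
    using tendsto_mult[OF r2 LIMSEQ_Suc[OF lim]] by simp
  show ?thesis
  proof (rule tendsto_sandwich)
    show "\<forall>\<^sub>F y in at_top. 2 powr \<alpha> * (real (m y) * T (2 * real (Suc (m y)) powr (1/\<alpha>))) \<le> y powr \<alpha> * T y"
      using eventually_gt_at_top[of 0] by eventually_elim (rule low)
    show "\<forall>\<^sub>F y in at_top. y powr \<alpha> * T y \<le> 2 powr \<alpha> * (real (Suc (m y)) * T (2 * real (m y) powr (1/\<alpha>)))"
      using eventually_gt_at_top[of 0] by eventually_elim (rule up)
  qed (intro tendsto_mult tendsto_const filterlim_compose[OF l1 m_top] filterlim_compose[OF l2 m_top])+
qed

locale stable_law = real_distribution \<mu> for \<mu> +
  fixes \<alpha> :: real
  assumes \<alpha>: "0 < \<alpha>" "\<alpha> < 1"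
    and char_eq: "char \<mu> r = exp (stable_exponent \<alpha> r)"
begin

lemma no_atoms: "measure \<mu> {x} = 0"
proof (rule no_atoms_of_integrable_char)
  have "(\<lambda>t. cmod (char \<mu> t)) = (\<lambda>t. exp (- (- Re (stable_exponent \<alpha> 1) * \<bar>t\<bar> powr \<alpha>)))"
    by (intro ext, subst char_eq, subst norm_exp_eq_Re, subst Re_stable_exponent[OF \<alpha>(1)])
      (simp add: mult.commute)
  then show "integrable lborel (\<lambda>t. cmod (char \<mu> t))"
    using integrable_exp_minus_powr[of "- Re (stable_exponent \<alpha> 1)" \<alpha>] Re_stable_exponent_1_neg[OF \<alpha>] \<alpha>(1)
    by simp
qed

definition rescaled :: "nat \<Rightarrow> real measure" where
  "rescaled n = distr \<mu> borel (\<lambda>w. w / real (Suc n) powr (1 / \<alpha>))"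

lemma real_distribution_rescaled: "real_distribution (rescaled n)"
  unfolding rescaled_def by (rule real_distribution_distr) simp

lemma char_rescaled: "char (rescaled n) r = exp (stable_exponent \<alpha> r / of_nat (Suc n))"
proof -
  have e: "(1 / real (Suc n) powr (1/\<alpha>)) powr \<alpha> = 1 / real (Suc n)"
    using \<alpha> by (simp add: powr_divide powr_powr)
  have "char (rescaled n) r = char \<mu> (1 / real (Suc n) powr (1/\<alpha>) * r)"
    unfolding char_def rescaled_def by (subst integral_distr) (auto simp: ac_simps)
  also have "\<dots> = exp (complex_of_real (1 / real (Suc n)) * stable_exponent \<alpha> r)"
    unfolding char_eq by (subst stable_exponent_scale[OF \<alpha>(1)]) (simp_all only: e, simp)
  finally show ?thesis by (simp add: field_simps del: of_nat_Suc)
qed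

text \<open>In terms of the characteristic functions of the \<open>n\<close>-th rescaled law, the left-hand side only involves
  \<open>n * (exp (z / n) - 1)\<close>, which tends to \<open>z\<close> and is dominated by \<open>cmod z\<close> when \<open>Re z \<le> 0\<close>.\<close>

lemma tendsto_rescaled_sinc:
  "(\<lambda>n. of_nat (Suc n) * (\<integral>w. (1 - sinc w) *\<^sub>R iexp (r * w) \<partial>rescaled n)) \<longlonglongrightarrow>
     (\<integral>w. (1 - sinc w) *\<^sub>R iexp (r * w) \<partial>levy_measure \<alpha>)"
proof -
  \<comment> \<open>Multiplying a measure by \<open>1 - cos (h * w)\<close> amounts to taking this second difference of its
    characteristic function. It annihilates constants, which is why it applies equally to
    characteristic functions and to the exponent, where 1 is subtracted under the integral.\<close>
  define D :: "(real \<Rightarrow> complex) \<Rightarrow> real \<Rightarrow> complex" where "D = (\<lambda>f h. f r - f (r + h) / 2 - f (r - h) / 2)"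
  have cosform: "(1 - cos (h * w)) *\<^sub>R iexp (r * w) = D (\<lambda>s. iexp (s * w)) h" for h w
  proof -
    have e: "iexp ((r + h) * w) = iexp (r * w) * iexp (h * w)"
        "iexp ((r - h) * w) = iexp (r * w) * iexp (- (h * w))"
      by (simp_all add: exp_add[symmetric] algebra_simps)
    have "iexp (h * w) + iexp (- (h * w)) = complex_of_real (2 * cos (h * w))"
      by (simp add: complex_eq_iff Re_exp Im_exp)
    then have c: "complex_of_real (1 - cos (h * w)) = 1 - (iexp (h * w) + iexp (- (h * w))) / 2"
      by simp
    show ?thesis
      unfolding D_def e scaleR_conv_of_real c by
          (simp only: algebra_simps add_divide_distrib times_divide_eq_left times_divide_eq_right mult_1)
  qed
  define \<phi> where "\<phi> = (\<lambda>n s. of_nat (Suc n) * (char (rescaled n) s - 1))"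
  have \<phi>_lim: "(\<lambda>n. \<phi> n s) \<longlonglongrightarrow> stable_exponent \<alpha> s" for s
    unfolding \<phi>_def char_rescaled by (rule tendsto_exp_difference_quotient)
  have Re_neg: "Re (stable_exponent \<alpha> s) \<le> 0" for s
    using Re_stable_exponent[OF \<alpha>(1), of s] Re_stable_exponent_1_neg[OF \<alpha>] by (simp add: mult_le_0_iff)
  have \<phi>_bound: "cmod (\<phi> n s) \<le> \<bar>s\<bar> powr \<alpha> * cmod (stable_exponent \<alpha> 1)" for n s
  proof -
    have "cmod (\<phi> n s) \<le> real (Suc n) * cmod (stable_exponent \<alpha> s / of_nat (Suc n))"
      unfolding \<phi>_def char_rescaled norm_mult norm_of_nat
      using Re_neg[of s] by (intro mult_left_mono norm_exp_minus_1_le)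
          (auto simp: Re_divide_of_nat divide_le_0_iff)
    also have "\<dots> = \<bar>s\<bar> powr \<alpha> * cmod (stable_exponent \<alpha> 1)"
      unfolding norm_divide norm_of_nat by (subst norm_stable_exponent[OF \<alpha>(1)]) (simp del: of_nat_Suc)
    finally show ?thesis .
  qed
  have [measurable]: "\<phi> n \<in> borel_measurable borel" for n
    unfolding \<phi>_def using real_distribution.char_measurable[OF real_distribution_rescaled] by measurable
  note [measurable] = measurable_stable_exponent[OF \<alpha>(1)]
  have int_cos: "of_nat (Suc n) * (\<integral>w. (1 - cos (h * w)) *\<^sub>R iexp (r * w) \<partial>rescaled n) = D (\<phi> n) h" for n h
  proof -
    interpret R: real_distribution "rescaled n" by (rule real_distribution_rescaled)
    have i: "complex_integrable (rescaled n) (\<lambda>w. iexp (s * w))" for s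
      by (intro R.integrable_iexp) simp_all
    have "(\<integral>w. (1 - cos (h * w)) *\<^sub>R iexp (r * w) \<partial>rescaled n) = D (char (rescaled n)) h"
      unfolding cosform unfolding D_def char_def
      by (simp only: Bochner_Integration.integral_diff Bochner_Integration.integrable_diff i
        integrable_divide integral_divide_zero)
    moreover have "of_nat (Suc n) * D (char (rescaled n)) h = D (\<phi> n) h"
      unfolding D_def \<phi>_def by (simp add: field_simps)
    ultimately show ?thesis by simp
  qed
  have int_cos_nu: "(\<integral>w. (1 - cos (h * w)) *\<^sub>R iexp (r * w) \<partial>levy_measure \<alpha>) = D (stable_exponent \<alpha>) h"
      for h
  proof -
    have "(1 - cos (h * w)) *\<^sub>R iexp (r * w) = D (\<lambda>s. iexp (s * w) - 1) h" for w
      unfolding cosform by (simp add: D_def diff_divide_distrib)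
    then show ?thesis
      unfolding D_def stable_exponent_def
      by (simp only: Bochner_Integration.integral_diff Bochner_Integration.integrable_diff
          integrable_stable_exponent[OF \<alpha>] integrable_divide integral_divide_zero)
  qed
  have sinc_n: "of_nat (Suc n) * (\<integral>w. (1 - sinc w) *\<^sub>R iexp (r * w) \<partial>rescaled n) =
      (\<integral>h. indicator {0..1} h *\<^sub>R D (\<phi> n) h \<partial>lborel)" for n
  proof -
    interpret R: real_distribution "rescaled n" by (rule real_distribution_rescaled)
    have "integrable (rescaled n) (\<lambda>w. min 1 \<bar>w\<bar>)"
      by (rule R.integrable_const_bound[where B=1]) auto
    then show ?thesis
      using R.sigma_finite_measure_axioms
      by (subst sinc_average[symmetric]) (auto simp: int_cos[symmetric]
        integral_mult_right_zero[symmetric] simp del: integral_mult_right_zero of_nat_Suc)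
  qed
  have sinc_nu: "(\<integral>w. (1 - sinc w) *\<^sub>R iexp (r * w) \<partial>levy_measure \<alpha>) =
      (\<integral>h. indicator {0..1} h *\<^sub>R D (stable_exponent \<alpha>) h \<partial>lborel)"
    by (subst sinc_average[symmetric]) (simp_all only: sigma_finite_levy_measure
      integrable_levy_measure_min[OF \<alpha>] int_cos_nu sets_levy_measure)
  define B where "B = 2 * ((\<bar>r\<bar> + 1) powr \<alpha> * cmod (stable_exponent \<alpha> 1))"
  show ?thesis
    unfolding sinc_n sinc_nu
  proof (rule integral_dominated_convergence[where w="\<lambda>h. indicator {0..1} h * B"])
    show "AE h in lborel. (\<lambda>n. indicator {0..1::real} h *\<^sub>R D (\<phi> n) h) \<longlonglongrightarrow>
        indicator {0..1} h *\<^sub>R D (stable_exponent \<alpha>) h"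
      unfolding D_def by (intro AE_I2 tendsto_intros \<phi>_lim) auto
    show "AE h in lborel. norm (indicator {0..1::real} h *\<^sub>R D (\<phi> n) h) \<le> indicator {0..1} h * B" for n
    proof (rule AE_I2)
      fix h :: real
      show "norm (indicator {0..1::real} h *\<^sub>R D (\<phi> n) h) \<le> indicator {0..1} h * B"
      proof (cases "h \<in> {0..1}")
        case True
        have b: "cmod (\<phi> n s) \<le> B / 2" if "\<bar>s\<bar> \<le> \<bar>r\<bar> + 1" for s
        proof -
          have "\<bar>s\<bar> powr \<alpha> * cmod (stable_exponent \<alpha> 1) \<le> (\<bar>r\<bar> + 1) powr \<alpha> * cmod (stable_exponent \<alpha> 1)"
            using that \<alpha> by (intro mult_right_mono powr_mono2) auto
          then show ?thesis using \<phi>_bound[of n s] by (simp add: B_def)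
        qed
        have "cmod (D (\<phi> n) h) \<le> cmod (\<phi> n r) + cmod (\<phi> n (r + h)) / 2 + cmod (\<phi> n (r - h)) / 2"
          unfolding D_def using norm_triangle_ineq4[of "\<phi> n r - \<phi> n (r+h) / 2" "\<phi> n (r - h) / 2"]
            norm_triangle_ineq4[of "\<phi> n r" "\<phi> n (r+h) / 2"] by (simp add: norm_divide)
        also have "\<dots> \<le> B / 2 + (B / 2) / 2 + (B / 2) / 2"
          using True by (intro add_mono divide_right_mono b) auto
        finally show ?thesis using True by simp
      qed simp
    qed
  qed (auto simp: D_def)
qed

text \<open>Away from 0, the law of an increment over a time \<open>1 / n\<close>, multiplied by \<open>n\<close>, converges to the Levy
  measure. The threshold 2 keeps \<open>1 - sinc\<close> above 1/2.\<close>

lemma tendsto_rescaled_measure: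
  assumes A: "open A" "A \<subseteq> {w. \<bar>w\<bar> \<ge> 2}" "frontier A \<subseteq> {-2, 2}"
  shows "(\<lambda>n. real (Suc n) * measure (rescaled n) A) \<longlonglongrightarrow> measure (levy_measure \<alpha>) A"
proof -
  \<comment> \<open>The weight \<open>K\<close> is bounded, at least 1/2 away from \<open>{-2<..<2}\<close>, and vanishes at 0 so fast that
    it turns the Levy measure into a finite measure. Normalised to a probability measure, the
    weighted laws converge by the continuity theorem; dividing by \<open>K\<close> again is harmless on \<open>A\<close>.\<close>
  define K where "K = (\<lambda>w. 1 - sinc w)"
  have K0: "0 \<le> K w" for w using sinc_le_1[of w] by (simp add: K_def)
  have K3: "K w \<le> 3 * min 1 \<bar>w\<bar>" for w
    using one_minus_sinc_le[of w] by (simp add: K_def)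
  have Khalf: "1 / 2 \<le> K w" if "\<bar>w\<bar> \<ge> 2" for w
  proof -
    have "sin w / w \<le> \<bar>sin w\<bar> / \<bar>w\<bar>" by (metis abs_divide abs_ge_self)
    also have "\<dots> \<le> 1 / 2" using that by (intro frac_le) auto
    finally show ?thesis using that by (auto simp: K_def)
  qed
  have [measurable]: "K \<in> borel_measurable borel" unfolding K_def by simp
  have Kcont: "isCont K w" for w
    unfolding K_def by (intro continuous_intros isCont_sinc)
  have [measurable]: "A \<in> sets borel" using A by simp
  define J where "J = (\<lambda>\<eta> r. \<integral>w. K w *\<^sub>R iexp (r * w) \<partial>\<eta>)"
  define Z where "Z = (\<lambda>\<eta>. \<integral>w. K w \<partial>\<eta>)"
  have JZ: "J \<eta> 0 = complex_of_real (Z \<eta>)" for \<eta>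
    unfolding J_def Z_def by (simp add: scaleR_conv_of_real)
  have Jlim: "(\<lambda>n. of_nat (Suc n) * J (rescaled n) r) \<longlonglongrightarrow> J (levy_measure \<alpha>) r" for r
    unfolding J_def K_def by (rule tendsto_rescaled_sinc)
  have "(\<lambda>n. Re (of_nat (Suc n) * J (rescaled n) 0)) \<longlonglongrightarrow> Re (J (levy_measure \<alpha>) 0)"
    by (intro tendsto_Re Jlim)
  then have Zlim: "(\<lambda>n. real (Suc n) * Z (rescaled n)) \<longlonglongrightarrow> Z (levy_measure \<alpha>)"
    unfolding JZ by simp
  have intK_nu: "integrable (levy_measure \<alpha>) K"
    by (rule Bochner_Integration.integrable_bound[OF
      integrable_mult_right[OF integrable_levy_measure_min[OF \<alpha>], of 3]])
      (use K0 K3 in \<open>auto intro!: AE_I2\<close>)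
  have intK_n: "integrable (rescaled n) K" for n
  proof -
    interpret R: real_distribution "rescaled n" by (rule real_distribution_rescaled)
    show ?thesis
      by (rule R.integrable_const_bound[where B=3])
        (use K0 K3 order_trans[OF K3, of _ 3] in \<open>auto intro!: AE_I2\<close>)
  qed
  have Zpos: "0 < Z (levy_measure \<alpha>)"
  proof -
    have f: "emeasure (levy_measure \<alpha>) {2..} < \<infinity>" by (simp add: emeasure_levy_measure_tail \<alpha>)
    have "0 < (1/2) * measure (levy_measure \<alpha>) {2..}"
      by (simp add: measure_def emeasure_levy_measure_tail \<alpha>)
    also have "\<dots> = (\<integral>w. (1/2) * indicator {2..} w \<partial>levy_measure \<alpha>)" by simp
    also have "\<dots> \<le> Z (levy_measure \<alpha>)"
      unfolding Z_def
    proof (intro integral_mono intK_nu integrable_mult_right)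
      show "integrable (levy_measure \<alpha>) (indicat_real {2..})"
        by (rule integrable_real_indicator) (use f in simp_all)
    qed (use K0 Khalf in \<open>auto simp: indicator_def\<close>)
    finally show ?thesis .
  qed
  have "\<forall>\<^sub>F n in sequentially. 0 < real (Suc n) * Z (rescaled n)"
    using order_tendstoD(1)[OF Zlim Zpos] .
  then obtain n0 where n0: "\<And>n. n \<ge> n0 \<Longrightarrow> 0 < Z (rescaled n)"
    by (auto simp: eventually_sequentially zero_less_mult_iff)
  define tilt where "tilt = (\<lambda>\<eta>. density \<eta> (\<lambda>w. ennreal (K w / Z \<eta>)))"
  have tilt: "real_distribution (tilt \<eta>)" and tilt_int: "\<And>f :: real \<Rightarrow> complex. f \<in> borel_measurable borel \<Longrightarrow>
      integral\<^sup>L (tilt \<eta>) f = (\<integral>w. (K w / Z \<eta>) *\<^sub>R f w \<partial>\<eta>)"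
    and tilt_int_real: "\<And>f :: real \<Rightarrow> real. f \<in> borel_measurable borel \<Longrightarrow>
      integral\<^sup>L (tilt \<eta>) f = (\<integral>w. (K w / Z \<eta>) *\<^sub>R f w \<partial>\<eta>)"
    if \<eta>: "sets \<eta> = sets borel" "integrable \<eta> K" "0 < Z \<eta>" for \<eta>
  proof -
    have [measurable_cong]: "sets \<eta> = sets borel" by fact
    have "emeasure (tilt \<eta>) (space \<eta>) = (\<integral>\<^sup>+ w. ennreal (K w / Z \<eta>) \<partial>\<eta>)"
      unfolding tilt_def by (subst emeasure_density) (auto intro!: nn_integral_cong simp: indicator_def)
    also have "\<dots> = ennreal (\<integral>w. K w / Z \<eta> \<partial>\<eta>)"
      using \<eta> K0 by (intro nn_integral_eq_integral) auto
    also have "\<dots> = 1" using \<eta>(3) by (simp add: Z_def)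
    finally show "real_distribution (tilt \<eta>)"
      using \<eta>(1) by (auto intro!: prob_spaceI simp: real_distribution_def real_distribution_axioms_def
          tilt_def sets_eq_imp_space_eq[OF \<eta>(1)])
    show "integral\<^sup>L (tilt \<eta>) f = (\<integral>w. (K w / Z \<eta>) *\<^sub>R f w \<partial>\<eta>)" if "f \<in> borel_measurable borel"
        for f :: "real \<Rightarrow> complex"
      unfolding tilt_def using that K0 \<eta>(3) by (intro integral_density) auto
    show "integral\<^sup>L (tilt \<eta>) f = (\<integral>w. (K w / Z \<eta>) *\<^sub>R f w \<partial>\<eta>)" if "f \<in> borel_measurable borel"
        for f :: "real \<Rightarrow> real"
      unfolding tilt_def using that K0 \<eta>(3) by (intro integral_density) auto
  qed
  have sets_n: "sets (rescaled n) = sets borel" for n by (simp add: rescaled_def)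
  have char_tilt: "char (tilt \<eta>) r = J \<eta> r / complex_of_real (Z \<eta>)"
    if \<eta>: "sets \<eta> = sets borel" "integrable \<eta> K" "0 < Z \<eta>" for \<eta> r
  proof -
    have "char (tilt \<eta>) r = (\<integral>w. (K w / Z \<eta>) *\<^sub>R iexp (r * w) \<partial>\<eta>)"
      unfolding char_def by (rule tilt_int[OF \<eta>]) simp
    also have "\<dots> = (\<integral>w. (K w *\<^sub>R iexp (r * w)) / complex_of_real (Z \<eta>) \<partial>\<eta>)"
      by (intro Bochner_Integration.integral_cong) (auto simp: scaleR_conv_of_real)
    finally show ?thesis by (simp add: J_def)
  qed
  define Q where "Q = (\<lambda>n. tilt (rescaled (n + n0)))"
  have Q: "real_distribution (Q n)" for n
    unfolding Q_def by (intro tilt sets_n intK_n n0) simp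
  have nu: "real_distribution (tilt (levy_measure \<alpha>))"
    by (intro tilt intK_nu Zpos) simp
  have "weak_conv_m Q (tilt (levy_measure \<alpha>))"
  proof (rule levy_continuity[OF Q nu])
    fix r
    have "(\<lambda>n. (of_nat (Suc n) * J (rescaled n) r) / (complex_of_real (real (Suc n) * Z (rescaled n))))
        \<longlonglongrightarrow> J (levy_measure \<alpha>) r / complex_of_real (Z (levy_measure \<alpha>))"
      using Zpos by (intro tendsto_intros Jlim Zlim) simp
    then have "(\<lambda>n. J (rescaled n) r / complex_of_real (Z (rescaled n)))
        \<longlonglongrightarrow> J (levy_measure \<alpha>) r / complex_of_real (Z (levy_measure \<alpha>))"
      by (simp del: of_nat_Suc)
    from LIMSEQ_ignore_initial_segment[OF this, of n0]
    show "(\<lambda>n. char (Q n) r) \<longlonglongrightarrow> char (tilt (levy_measure \<alpha>)) r"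
      unfolding Q_def using n0 Zpos by (simp add: char_tilt sets_n intK_n intK_nu)
  qed
  note weak = this
  \<comment> \<open>The maximum makes the second factor bounded and continuous everywhere; on \<open>A\<close> it is \<open>K\<close>.\<close>
  define f where "f = (\<lambda>w. indicator A w * inverse (max (1/2) (K w)))"
  have [measurable]: "f \<in> borel_measurable borel" unfolding f_def by measurable
  have disc: "{w. \<not> isCont f w} \<subseteq> {-2, 2}"
  proof -
    have "isCont f w" if "w \<notin> frontier A" for w
      unfolding f_def using that Kcont
      by (intro continuous_intros) (auto simp: isCont_indicator)
    then show ?thesis using A by auto
  qed
  have null: "emeasure (tilt (levy_measure \<alpha>)) {w. \<not> isCont f w} = 0"
  proof -
    have "AE w in lborel. w \<noteq> -2 \<and> w \<noteq> (2::real)"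
      using AE_lborel_singleton[of "-2::real"] AE_lborel_singleton[of "2::real"] by eventually_elim auto
    then have "AE w in levy_measure \<alpha>. w \<noteq> -2 \<and> w \<noteq> 2"
      unfolding levy_measure_def by (subst AE_density) auto
    then have "AE w in tilt (levy_measure \<alpha>). w \<noteq> -2 \<and> w \<noteq> 2"
      unfolding tilt_def by (subst AE_density) auto
    then have "AE w in tilt (levy_measure \<alpha>). w \<notin> {-2, 2}" by eventually_elim auto
    then have "emeasure (tilt (levy_measure \<alpha>)) {-2, 2} = 0"
      by (subst (asm) AE_iff_measurable[where N="{-2, 2}"]) (auto simp: tilt_def)
    then show ?thesis using disc
      by (metis (no_types, lifting) emeasure_mono finite.emptyI finite.insertI finite_imp_closed
        borel_closed le_zero_eq sets_levy_measure sets_density tilt_def)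
  qed
  have "(\<lambda>n. integral\<^sup>L (Q n) f) \<longlonglongrightarrow> integral\<^sup>L (tilt (levy_measure \<alpha>)) f"
  proof (rule weak_conv_imp_bdd_ae_continuous_conv[OF Q nu weak null, where B=2])
    show "norm (f x) \<le> 2" for x
      by (auto simp: f_def indicator_def max_def inverse_eq_divide divide_simps)
  qed simp
  moreover have fint: "integral\<^sup>L (tilt \<eta>) f = measure \<eta> A / Z \<eta>"
    if \<eta>: "sets \<eta> = sets borel" "integrable \<eta> K" "0 < Z \<eta>" for \<eta>
  proof -
    have "integral\<^sup>L (tilt \<eta>) f = (\<integral>w. (K w / Z \<eta>) *\<^sub>R f w \<partial>\<eta>)"
      by (rule tilt_int_real[OF \<eta>]) simp
    also have "\<dots> = (\<integral>w. indicator A w / Z \<eta> \<partial>\<eta>)"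
    proof (intro Bochner_Integration.integral_cong refl)
      fix w
      show "(K w / Z \<eta>) *\<^sub>R f w = indicator A w / Z \<eta>"
        using Khalf[of w] A(2) by (auto simp: f_def indicator_def max_def)
    qed
    also have "\<dots> = measure \<eta> (A \<inter> space \<eta>) / Z \<eta>"
      by simp
    finally show ?thesis using sets_eq_imp_space_eq[OF \<eta>(1)] by simp
  qed
  ultimately have "(\<lambda>n. measure (rescaled (n + n0)) A / Z (rescaled (n + n0))) \<longlonglongrightarrow>
      measure (levy_measure \<alpha>) A / Z (levy_measure \<alpha>)"
    unfolding Q_def using n0 Zpos by (simp add: sets_n intK_n intK_nu)
  from tendsto_mult[OF this LIMSEQ_ignore_initial_segment[OF Zlim, of n0]]
  have "(\<lambda>n. measure (rescaled (n + n0)) A / Z (rescaled (n + n0)) *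
      (real (Suc (n + n0)) * Z (rescaled (n + n0))))
     \<longlonglongrightarrow> measure (levy_measure \<alpha>) A" using Zpos by simp
  moreover have "measure (rescaled (n + n0)) A / Z (rescaled (n + n0)) *
      (real (Suc (n + n0)) * Z (rescaled (n + n0))) =
      real (Suc (n + n0)) * measure (rescaled (n + n0)) A" for n
    using n0[of "n + n0"] by simp
  ultimately have "(\<lambda>n. real (Suc (n + n0)) * measure (rescaled (n + n0)) A) \<longlonglongrightarrow> measure (levy_measure \<alpha>) A"
    by simp
  then show ?thesis by (rule LIMSEQ_offset)
qed

lemma measure_rescaled:
  "A \<in> sets borel \<Longrightarrow> measure (rescaled n) A = measure \<mu> {w. w / real (Suc n) powr (1 / \<alpha>) \<in> A}"
  unfolding rescaled_def by (subst measure_distr) (auto simp: vimage_def)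

text \<open>The constant 1 is essential: it is what makes the transfer functions converge to the identity and
  not to a multiple of it.\<close>

lemma upper_tail: "((\<lambda>y. y powr \<alpha> * measure \<mu> {y<..}) \<longlongrightarrow> 1) at_top"
proof -
  have "measure (levy_measure \<alpha>) {2<..} = 2 powr - \<alpha>"
  proof -
    have "AE w in levy_measure \<alpha>. w \<noteq> 2"
      unfolding levy_measure_def using AE_lborel_singleton[of "2::real"] by (subst AE_density) auto
    then have "AE w in levy_measure \<alpha>. w \<in> {2<..} \<longleftrightarrow> w \<in> {2..}" by eventually_elim auto
    then have "emeasure (levy_measure \<alpha>) {2<..} = emeasure (levy_measure \<alpha>) {2..}"
      by (intro emeasure_eq_AE) auto
    then show ?thesis by (simp add: measure_def emeasure_levy_measure_tail \<alpha>)
  qed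
  moreover have "(\<lambda>n. real (Suc n) * measure (rescaled n) {2<..}) \<longlonglongrightarrow> measure (levy_measure \<alpha>) {2<..}"
    by (rule tendsto_rescaled_measure) (auto simp: frontier_def interior_open)
  moreover have "measure (rescaled n) {2<..} = measure \<mu> {2 * real (Suc n) powr (1 / \<alpha>)<..}" for n
    by (subst measure_rescaled) (auto intro!: arg_cong[where f="measure \<mu>"] simp: less_divide_eq)
  ultimately have "(\<lambda>n. real (Suc n) * measure \<mu> {2 * real (Suc n) powr (1 / \<alpha>)<..}) \<longlonglongrightarrow> 2 powr - \<alpha>"
    by simp
  then have "(\<lambda>n. real n * measure \<mu> {2 * real n powr (1 / \<alpha>)<..}) \<longlonglongrightarrow> 2 powr - \<alpha>"
    by (subst filterlim_sequentially_Suc[symmetric])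
  from regular_tail_from_sequence[OF \<alpha>(1) _ _ this, unfolded antimono_def] show ?thesis
    by (simp add: powr_minus finite_measure_mono subset_iff)
qed

text \<open>The negative half-line has Levy measure 0. By itself this does not exclude negative values of the
  stable variable, but it bounds the probability that some increment is far below 0.\<close>

lemma lower_tail: "((\<lambda>y. y powr \<alpha> * measure \<mu> {..<-y}) \<longlongrightarrow> 0) at_top"
proof -
  have "measure (levy_measure \<alpha>) {..<-2} = 0"
  proof -
    have "AE w in levy_measure \<alpha>. w \<notin> {..<-2}" using AE_levy_measure_pos by eventually_elim auto
    then have "emeasure (levy_measure \<alpha>) {..<-2} = 0"
      by (subst (asm) AE_iff_measurable[where N="{..<-2}"]) auto
    then show ?thesis by (simp add: measure_def)
  qed
  moreover have "(\<lambda>n. real (Suc n) * measure (rescaled n) {..<-2}) \<longlonglongrightarrow> measure (levy_measure \<alpha>) {..<-2}"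
    by (rule tendsto_rescaled_measure) (auto simp: frontier_def interior_open)
  moreover have "measure (rescaled n) {..<-2} = measure \<mu> {..<- (2 * real (Suc n) powr (1 / \<alpha>))}" for n
    by (subst measure_rescaled) (auto intro!: arg_cong[where f="measure \<mu>"] simp: divide_less_eq)
  ultimately have "(\<lambda>n. real (Suc n) * measure \<mu> {..<- (2 * real (Suc n) powr (1 / \<alpha>))}) \<longlonglongrightarrow> 0"
    by simp
  then have "(\<lambda>n. real n * measure \<mu> {..<- (2 * real n powr (1 / \<alpha>))}) \<longlonglongrightarrow> 0"
    by (subst filterlim_sequentially_Suc[symmetric])
  from regular_tail_from_sequence[OF \<alpha>(1) _ _ this, unfolded antimono_def] show ?thesis
    by (simp add: finite_measure_mono subset_iff)
qed

end

section \<open>The stable process: monotone paths and support of its law\<close>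

text \<open>The truncated moment is the integral of \<open>\<beta> * u powr (\<beta> - 1)\<close> times the tail at \<open>u\<close> over \<open>u \<le> \<delta>\<close>.\<close>

lemma (in sigma_finite_measure) truncated_moment_le:
  fixes X :: "'a \<Rightarrow> real"
  assumes [measurable]: "X \<in> borel_measurable M"
    and tail: "\<And>u. 0 < u \<Longrightarrow> emeasure M {\<omega>\<in>space M. u < X \<omega>} \<le> ennreal (C * u powr - \<alpha>)"
    and \<alpha>\<beta>: "0 < \<alpha>" "\<alpha> < \<beta>" and "0 < \<delta>" "0 \<le> C"
    and X0: "\<And>\<omega>. \<omega> \<in> space M \<Longrightarrow> 0 \<le> X \<omega>"
  shows "(\<integral>\<^sup>+ \<omega>. ennreal (min (X \<omega>) \<delta> powr \<beta>) \<partial>M) \<le> ennreal (C * \<beta> / (\<beta> - \<alpha>) * \<delta> powr (\<beta> - \<alpha>))"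
proof -
  interpret P: pair_sigma_finite lborel M ..
  have powr_int: "(\<integral>\<^sup>+ u. ennreal (\<beta> * u powr (\<beta> - 1)) * indicator {0..x} u \<partial>lborel) =
      ennreal (x powr \<beta>)" if "0 \<le> x" for x
  proof -
    have "((\<lambda>u. \<beta> * u powr (\<beta> - 1)) has_integral (\<beta> * (x powr (\<beta> - 1 + 1) / (\<beta> - 1 + 1)))) {0..x}"
      using \<alpha>\<beta> that by (intro has_integral_mult_right has_integral_powr_from_0) auto
    then have "((\<lambda>u. \<beta> * u powr (\<beta> - 1)) has_integral (x powr \<beta>)) {0..x}"
      using \<alpha>\<beta> by simp
    then show ?thesis using \<alpha>\<beta> by (intro nn_integral_has_integral_lebesgue') auto
  qed
  have "(\<integral>\<^sup>+ \<omega>. ennreal (min (X \<omega>) \<delta> powr \<beta>) \<partial>M) =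
     (\<integral>\<^sup>+ \<omega>. (\<integral>\<^sup>+ u. ennreal (\<beta> * u powr (\<beta> - 1)) * indicator {0..min (X \<omega>) \<delta>} u \<partial>lborel) \<partial>M)"
    using X0 \<open>0 < \<delta>\<close> by (intro nn_integral_cong) (simp add: powr_int)
  also have "\<dots> = (\<integral>\<^sup>+ \<omega>. (\<integral>\<^sup>+ u. ennreal (\<beta> * u powr (\<beta> - 1)) * indicator {0<..\<delta>} u *
      indicator {\<omega>\<in>space M. u < X \<omega>} \<omega> \<partial>lborel) \<partial>M)"
  proof (rule nn_integral_cong, rule nn_integral_cong_AE)
    fix \<omega> assume \<omega>: "\<omega> \<in> space M"
    have "AE u in lborel. u \<noteq> 0 \<and> u \<noteq> X \<omega>"
      using AE_lborel_singleton[of "0::real"] AE_lborel_singleton[of "X \<omega>"] by eventually_elim auto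
    then show "AE u in lborel. ennreal (\<beta> * u powr (\<beta> - 1)) * indicator {0..min (X \<omega>) \<delta>} u =
        ennreal (\<beta> * u powr (\<beta> - 1)) * indicator {0<..\<delta>} u * indicator {\<omega>\<in>space M. u < X \<omega>} \<omega>"
      by eventually_elim (use \<omega> in \<open>auto simp: indicator_def\<close>)
  qed
  also have "\<dots> = (\<integral>\<^sup>+ u. (\<integral>\<^sup>+ \<omega>. ennreal (\<beta> * u powr (\<beta> - 1)) * indicator {0<..\<delta>} u *
      indicator {\<omega>\<in>space M. u < X \<omega>} \<omega> \<partial>M) \<partial>lborel)"
    by (rule P.Fubini') measurable
  also have "\<dots> = (\<integral>\<^sup>+ u. ennreal (\<beta> * u powr (\<beta> - 1)) * indicator {0<..\<delta>} u *
      emeasure M {\<omega>\<in>space M. u < X \<omega>} \<partial>lborel)"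
    by (intro nn_integral_cong) (simp add: nn_integral_cmult)
  also have "\<dots> \<le> (\<integral>\<^sup>+ u. ennreal (C * \<beta> * u powr (\<beta> - \<alpha> - 1)) * indicator {0..\<delta>} u \<partial>lborel)"
  proof (intro nn_integral_mono)
    fix u :: real
    show "ennreal (\<beta> * u powr (\<beta> - 1)) * indicator {0<..\<delta>} u * emeasure M {\<omega>\<in>space M. u < X \<omega>}
       \<le> ennreal (C * \<beta> * u powr (\<beta> - \<alpha> - 1)) * indicator {0..\<delta>} u"
    proof (cases "u \<in> {0<..\<delta>}")
      case True
      have "ennreal (\<beta> * u powr (\<beta> - 1)) * emeasure M {\<omega>\<in>space M. u < X \<omega>}
          \<le> ennreal (\<beta> * u powr (\<beta> - 1)) * ennreal (C * u powr - \<alpha>)"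
        using True by (intro mult_left_mono tail) auto
      also have "\<dots> = ennreal (C * \<beta> * u powr (\<beta> - \<alpha> - 1))"
      proof -
        have "u powr (\<beta> - \<alpha> - 1) = u powr (\<beta> - 1) * u powr - \<alpha>"
          by (simp add: powr_add[symmetric] algebra_simps)
        then show ?thesis
          using \<alpha>\<beta> \<open>0 \<le> C\<close> by (subst ennreal_mult[symmetric])
              (auto simp: mult_ac intro!: arg_cong[where f=ennreal])
      qed
      finally show ?thesis using True by simp
    qed simp
  qed
  also have "\<dots> = ennreal (C * \<beta> * (\<delta> powr (\<beta> - \<alpha> - 1 + 1) / (\<beta> - \<alpha> - 1 + 1)))"
    using \<alpha>\<beta> \<open>0 \<le> C\<close> \<open>0 < \<delta>\<close>
    by (intro nn_integral_has_integral_lebesgue' has_integral_mult_right has_integral_powr_from_0) auto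
  finally show ?thesis by simp
qed

locale stable_process = prob_space N for N :: "'a measure" +
  fixes V :: "real \<Rightarrow> 'a \<Rightarrow> real" and \<alpha> :: real
  assumes \<alpha>: "0 < \<alpha>" "\<alpha> < 1"
    and stable: "stable_levy_process \<alpha> N V"
begin

lemma V_measurable [measurable]: "V x \<in> borel_measurable N"
  and V_0: "\<omega> \<in> space N \<Longrightarrow> V 0 \<omega> = 0"
  and right_continuous: "\<omega> \<in> space N \<Longrightarrow> continuous (at_right x) (\<lambda>y. V y \<omega>)"
  using stable unfolding stable_levy_process_def levy_process_def by auto

lemma increments_indep:
  "strict_mono_on {..n::nat} t \<Longrightarrow> indep_vars (\<lambda>_. borel) (\<lambda>k \<omega>. V (t (Suc k)) \<omega> - V (t k) \<omega>) {..<n}"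
  using stable unfolding stable_levy_process_def levy_process_def by auto

lemma char_increment:
  assumes "0 \<le> h"
  shows "char (distr N borel (\<lambda>\<omega>. V (x + h) \<omega> - V x \<omega>)) r = exp (h * stable_exponent \<alpha> r)"
  using stable assms unfolding stable_levy_process_def stable_exponent_eq[OF \<alpha>(1)]
  by (auto simp: mult_ac add.commute)

abbreviation law :: "real measure" where "law \<equiv> distr N borel (V 1)"

sublocale law: stable_law law \<alpha>
proof -
  interpret l: real_distribution law by (rule real_distribution_distr) simp
  have "law = distr N borel (\<lambda>\<omega>. V (0 + 1) \<omega> - V 0 \<omega>)"
    by (intro distr_cong) (auto simp: V_0)
  then show "stable_law law \<alpha>"
    using char_increment[of 1 0] \<alpha> by unfold_locales simp_all
qed

lemma increment_law:
  assumes "0 < h"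
  shows "distr N borel (\<lambda>\<omega>. V (x + h) \<omega> - V x \<omega>) = distr N borel (\<lambda>\<omega>. h powr (1 / \<alpha>) * V 1 \<omega>)"
proof (rule Levy_uniqueness)
  show "char (distr N borel (\<lambda>\<omega>. V (x + h) \<omega> - V x \<omega>)) = char (distr N borel (\<lambda>\<omega>. h powr (1 / \<alpha>) * V 1 \<omega>))"
  proof
    fix r
    have "char (distr N borel (\<lambda>\<omega>. h powr (1 / \<alpha>) * V 1 \<omega>)) r = char law (h powr (1 / \<alpha>) * r)"
      by (simp add: char_def integral_distr ac_simps)
    also have "\<dots> = exp (h * stable_exponent \<alpha> r)"
      using assms \<alpha> by (simp add: law.char_eq stable_exponent_scale powr_powr)
    finally show "char (distr N borel (\<lambda>\<omega>. V (x + h) \<omega> - V x \<omega>)) r =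
        char (distr N borel (\<lambda>\<omega>. h powr (1 / \<alpha>) * V 1 \<omega>)) r"
      using assms by (simp add: char_increment)
  qed
qed (auto intro!: real_distribution_distr)

lemma prob_increment:
  assumes "x < y" and [measurable]: "A \<in> sets borel"
  shows "prob {\<omega>\<in>space N. V y \<omega> - V x \<omega> \<in> A} = measure law {w. (y - x) powr (1 / \<alpha>) * w \<in> A}"
proof -
  have "prob {\<omega>\<in>space N. V y \<omega> - V x \<omega> \<in> A} = measure (distr N borel (\<lambda>\<omega>. V (x + (y - x)) \<omega> - V x \<omega>)) A"
    by (subst measure_distr) (auto intro!: arg_cong[where f=prob])
  also have "\<dots> = measure (distr N borel (\<lambda>\<omega>. (y - x) powr (1 / \<alpha>) * V 1 \<omega>)) A"
    using assms by (subst increment_law) auto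
  also have "\<dots> = measure law {w. (y - x) powr (1 / \<alpha>) * w \<in> A}"
    by (subst measure_distr measure_distr; (subst measure_distr)?) (auto intro!: arg_cong[where f=prob])
  finally show ?thesis .
qed

lemma abs_tail_bound: "\<exists>C>0. \<forall>u>0. measure law {w. u < \<bar>w\<bar>} \<le> C * u powr - \<alpha>"
proof -
  have "((\<lambda>y. y powr \<alpha> * measure law {y<..} + y powr \<alpha> * measure law {..<-y}) \<longlongrightarrow> 1 + 0) at_top"
    by (intro tendsto_add law.upper_tail law.lower_tail)
  then have "\<forall>\<^sub>F y in at_top. y powr \<alpha> * measure law {y<..} + y powr \<alpha> * measure law {..<-y} < 2"
    by (rule order_tendstoD) simp
  then obtain u0 where u0: "\<And>y. y \<ge> u0 \<Longrightarrow> y powr \<alpha> * measure law {y<..} + y powr \<alpha> * measure law {..<-y} < 2"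
    by (auto simp: eventually_at_top_linorder)
  define u1 where "u1 = max u0 1"
  have "measure law {w. u < \<bar>w\<bar>} \<le> (2 + u1 powr \<alpha>) * u powr - \<alpha>" if "u > 0" for u
  proof (cases "u \<ge> u1")
    case True
    have "measure law {w. u < \<bar>w\<bar>} \<le> measure law {u<..} + measure law {..<-u}"
      by (rule order_trans[OF law.finite_measure_mono measure_Un_le]) auto
    also have "\<dots> \<le> 2 * u powr - \<alpha>"
      using u0[of u] True that by (simp add: u1_def powr_minus field_simps)
    also have "\<dots> \<le> (2 + u1 powr \<alpha>) * u powr - \<alpha>" by (intro mult_right_mono) auto
    finally show ?thesis .
  next
    case False
    have "measure law {w. u < \<bar>w\<bar>} \<le> 1" by simp
    also have "1 \<le> u1 powr \<alpha> * u powr - \<alpha>"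
      using False that \<alpha> powr_mono2[of \<alpha> u u1] by (simp add: powr_minus field_simps)
    also have "\<dots> \<le> (2 + u1 powr \<alpha>) * u powr - \<alpha>" by (intro mult_right_mono) auto
    finally show ?thesis .
  qed
  then show ?thesis by (intro exI[of _ "2 + u1 powr \<alpha>"]) (auto simp: add_pos_nonneg)
qed

text \<open>The bound is linear in the length of the time interval, so summing it over a mesh gives a bound
  that does not depend on the mesh.\<close>

lemma truncated_increment_moment:
  assumes "\<alpha> < \<beta>"
  shows "\<exists>C\<ge>0. \<forall>x y \<delta>. x < y \<longrightarrow> 0 < \<delta> \<longrightarrow>
     (\<integral>\<^sup>+ \<omega>. ennreal (min \<bar>V y \<omega> - V x \<omega>\<bar> \<delta> powr \<beta>) \<partial>N) \<le> ennreal (C * (y - x) * \<delta> powr (\<beta> - \<alpha>))"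
proof -
  obtain C where C: "C > 0" "\<And>u. u > 0 \<Longrightarrow> measure law {w. u < \<bar>w\<bar>} \<le> C * u powr - \<alpha>"
    using abs_tail_bound by auto
  have "(\<integral>\<^sup>+ \<omega>. ennreal (min \<bar>V y \<omega> - V x \<omega>\<bar> \<delta> powr \<beta>) \<partial>N) \<le>
      ennreal (C * (y - x) * \<beta> / (\<beta> - \<alpha>) * \<delta> powr (\<beta> - \<alpha>))"
    if xy: "x < y" and "0 < \<delta>" for x y \<delta>
  proof (rule truncated_moment_le)
    fix u :: real assume u: "0 < u"
    have "{\<omega>\<in>space N. u < \<bar>V y \<omega> - V x \<omega>\<bar>} = {\<omega>\<in>space N. V y \<omega> - V x \<omega> \<in> {w. u < \<bar>w\<bar>}}" by simp
    also have "prob \<dots> = measure law {w. (y - x) powr (1 / \<alpha>) * w \<in> {w. u < \<bar>w\<bar>}}"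
      using xy by (intro prob_increment) auto
    also have "{w. (y - x) powr (1 / \<alpha>) * w \<in> {w. u < \<bar>w\<bar>}} = {w. u / (y - x) powr (1 / \<alpha>) < \<bar>w\<bar>}"
      using xy by (auto simp: abs_mult field_simps)
    also have "measure law \<dots> \<le> C * (u / (y - x) powr (1 / \<alpha>)) powr - \<alpha>"
      using u xy by (intro C) auto
    also have "\<dots> = C * (y - x) * u powr - \<alpha>"
      using u xy \<alpha> by (simp add: powr_divide powr_powr powr_minus field_simps)
    finally show "emeasure N {\<omega>\<in>space N. u < \<bar>V y \<omega> - V x \<omega>\<bar>} \<le> ennreal (C * (y - x) * u powr - \<alpha>)"
      by (simp add: emeasure_eq_measure ennreal_leI)
  qed (use assms \<alpha> that C(1) in auto)
  then show ?thesis
    using assms \<alpha> C(1) by (intro exI[of _ "C * \<beta> / (\<beta> - \<alpha>)"]) (auto simp: mult_ac)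
qed

text \<open>Write \<open>V 1\<close> as a sum of \<open>n\<close> increments. The probability that one of them lies below \<open>-\<delta>\<close> tends to 0 by
  \<open>lower_tail\<close>, and the expected sum of their absolute values truncated at \<open>\<delta>\<close> is at most of
  order \<open>\<delta> powr (1 - \<alpha>)\<close>. Letting \<open>n\<close> tend to infinity and then \<open>\<delta>\<close> to 0 leaves no room for values below
  any \<open>-\<eta>\<close>.\<close>

lemma V_1_nonneg: "AE \<omega> in N. 0 \<le> V 1 \<omega>"
proof -
  obtain C where C: "C \<ge> 0" "\<And>x y \<delta>. x < y \<Longrightarrow> 0 < \<delta> \<Longrightarrow>
     (\<integral>\<^sup>+ \<omega>. ennreal (min \<bar>V y \<omega> - V x \<omega>\<bar> \<delta> powr 1) \<partial>N) \<le> ennreal (C * (y - x) * \<delta> powr (1 - \<alpha>))"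
    using truncated_increment_moment[OF \<alpha>(2)] by auto
  have bound: "prob {\<omega>\<in>space N. V 1 \<omega> < - \<eta>} \<le> C * \<delta> powr (1 - \<alpha>) / \<eta>" if \<eta>: "\<eta> > 0" and \<delta>: "\<delta> > 0" for \<eta> \<delta>
  proof -
    \<comment> \<open>If none of the \<open>n\<close> increments falls below \<open>-\<delta>\<close>, then \<open>- V 1\<close> is at most the sum \<open>S n\<close> of
      their truncated absolute values.\<close>
    define jump where "jump = (\<lambda>n i. {\<omega>\<in>space N. V (real (Suc i) / real n) \<omega> -
        V (real i / real n) \<omega> \<in> {..<-\<delta>}})"
    define S where "S = (\<lambda>n \<omega>. \<Sum>i<n. min \<bar>V (real (Suc i) / real n) \<omega> - V (real i / real n) \<omega>\<bar> \<delta>)"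
    have le: "prob {\<omega>\<in>space N. V 1 \<omega> < - \<eta>} \<le>
        real n * measure law {..<- (\<delta> * real n powr (1 / \<alpha>))} + C * \<delta> powr (1 - \<alpha>) / \<eta>"
      if n: "n > 0" for n
    proof -
      have lt: "real i / real n < real (Suc i) / real n" for i using n
          by (simp add: divide_strict_right_mono)
      have [measurable]: "jump n i \<in> events" "S n \<in> borel_measurable N" for i
        unfolding jump_def S_def by measurable
      have "{\<omega>\<in>space N. V 1 \<omega> < - \<eta>} \<subseteq> (\<Union>i<n. jump n i) \<union> {\<omega>\<in>space N. \<eta> \<le> S n \<omega>}"
      proof
        fix \<omega> assume "\<omega> \<in> {\<omega>\<in>space N. V 1 \<omega> < - \<eta>}"
        then have \<omega>: "\<omega> \<in> space N" "V 1 \<omega> < - \<eta>" by auto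
        show "\<omega> \<in> (\<Union>i<n. jump n i) \<union> {\<omega>\<in>space N. \<eta> \<le> S n \<omega>}"
        proof (cases "\<exists>i<n. \<omega> \<in> jump n i")
          case False
          then have nj: "- \<delta> \<le> V (real (Suc i) / real n) \<omega> - V (real i / real n) \<omega>" if "i < n" for i
            using that \<omega> by (force simp: jump_def)
          have "(\<Sum>i<n. V (real (Suc i) / real n) \<omega> - V (real i / real n) \<omega>) = V 1 \<omega>"
            using sum_lessThan_telescope[of "\<lambda>i. V (real i / real n) \<omega>" n] n V_0[OF \<omega>(1)] by simp
          moreover have "- S n \<omega> \<le> (\<Sum>i<n. V (real (Suc i) / real n) \<omega> - V (real i / real n) \<omega>)"
            unfolding S_def sum_negf[symmetric] using nj \<delta> by (intro sum_mono) (force simp: min_def abs_if)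
          ultimately show ?thesis using \<omega> by auto
        qed auto
      qed
      then have "prob {\<omega>\<in>space N. V 1 \<omega> < - \<eta>} \<le> prob ((\<Union>i<n. jump n i) \<union> {\<omega>\<in>space N. \<eta> \<le> S n \<omega>})"
        by (intro finite_measure_mono) auto
      also have "\<dots> \<le> prob (\<Union>i<n. jump n i) + prob {\<omega>\<in>space N. \<eta> \<le> S n \<omega>}"
        by (intro measure_Un_le) auto
      also have "prob (\<Union>i<n. jump n i) \<le> (\<Sum>i<n. prob (jump n i))"
        by (intro finite_measure_subadditive_finite) auto
      also have "\<dots> = real n * measure law {..<- (\<delta> * real n powr (1 / \<alpha>))}"
      proof -
        have "prob (jump n i) = measure law {..<- (\<delta> * real n powr (1 / \<alpha>))}" for i
        proof -
          have "prob (jump n i) = measure law {w. (real (Suc i) / real n -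
              real i / real n) powr (1 / \<alpha>) * w \<in> {..<-\<delta>}}"
            unfolding jump_def by (rule prob_increment[OF lt]) simp
          also have "real (Suc i) / real n - real i / real n = 1 / real n"
              by (simp add: diff_divide_distrib[symmetric])
          also have "{w. (1 / real n) powr (1 / \<alpha>) * w \<in> {..<-\<delta>}} = {..<- (\<delta> * real n powr (1 / \<alpha>))}"
            using n by (auto simp: powr_divide field_simps)
          finally show ?thesis .
        qed
        then show ?thesis by simp
      qed
      also have "prob {\<omega>\<in>space N. \<eta> \<le> S n \<omega>} \<le> C * \<delta> powr (1 - \<alpha>) / \<eta>"
      proof -
        have "(\<integral>\<^sup>+ \<omega>. ennreal (S n \<omega>) \<partial>N) = (\<Sum>i<n. \<integral>\<^sup>+ \<omega>. ennreal (min \<bar>V (real (Suc i) / real n) \<omega> -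
            V (real i / real n) \<omega>\<bar> \<delta> powr 1) \<partial>N)"
          unfolding S_def using \<delta> by (subst nn_integral_sum[symmetric]) (auto simp: sum_ennreal)
        also have "\<dots> \<le> (\<Sum>i<n. ennreal (C * (real (Suc i) / real n - real i / real n) * \<delta> powr (1 - \<alpha>)))"
          by (intro sum_mono C(2) lt \<delta>)
        also have "\<dots> = (\<Sum>i<n. ennreal (C * (1 / real n) * \<delta> powr (1 - \<alpha>)))"
          by (simp add: diff_divide_distrib[symmetric])
        also have "\<dots> = ennreal (C * \<delta> powr (1 - \<alpha>))"
          using n C(1) by (subst sum_ennreal) auto
        finally have m: "(\<integral>\<^sup>+ \<omega>. ennreal (S n \<omega>) \<partial>N) \<le> ennreal (C * \<delta> powr (1 - \<alpha>))" .
        have "ennreal \<eta> * emeasure N {\<omega>\<in>space N. \<eta> \<le> S n \<omega>} =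
            (\<integral>\<^sup>+ \<omega>. ennreal \<eta> * indicator {\<omega>\<in>space N. \<eta> \<le> S n \<omega>} \<omega> \<partial>N)"
          by (simp add: nn_integral_cmult)
        also have "\<dots> \<le> (\<integral>\<^sup>+ \<omega>. ennreal (S n \<omega>) \<partial>N)"
          by (intro nn_integral_mono) (auto simp: indicator_def intro: ennreal_leI)
        finally have "ennreal (\<eta> * prob {\<omega>\<in>space N. \<eta> \<le> S n \<omega>}) \<le> ennreal (C * \<delta> powr (1 - \<alpha>))"
          using m \<eta> by (simp add: emeasure_eq_measure ennreal_mult)
        then have "\<eta> * prob {\<omega>\<in>space N. \<eta> \<le> S n \<omega>} \<le> C * \<delta> powr (1 - \<alpha>)"
          using C(1) by (subst (asm) ennreal_le_iff) auto
        then show ?thesis using \<eta> by (simp add: field_simps)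
      qed
      finally show ?thesis by simp
    qed
    have "filterlim (\<lambda>n. \<delta> * real n powr (1 / \<alpha>)) at_top sequentially"
      using \<delta> \<alpha> by real_asymp
    from filterlim_compose[OF law.lower_tail this]
    have "(\<lambda>n. (1 / \<delta> powr \<alpha>) * ((\<delta> * real n powr (1 / \<alpha>)) powr \<alpha> *
        measure law {..<- (\<delta> * real n powr (1 / \<alpha>))})) \<longlonglongrightarrow> (1 / \<delta> powr \<alpha>) * 0"
      by (intro tendsto_mult tendsto_const)
    moreover have "(1 / \<delta> powr \<alpha>) * ((\<delta> * real n powr (1 / \<alpha>)) powr \<alpha> * T) = real n * T" for n T
      using \<delta> \<alpha> by (simp add: powr_mult powr_powr)
    ultimately have "(\<lambda>n. real n * measure law {..<- (\<delta> * real n powr (1 / \<alpha>))}) \<longlonglongrightarrow> 0"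
      by simp
    from tendsto_add[OF this tendsto_const, of "C * \<delta> powr (1 - \<alpha>) / \<eta>"]
    have "(\<lambda>n. real n * measure law {..<- (\<delta> * real n powr (1 / \<alpha>))} + C * \<delta> powr (1 - \<alpha>) / \<eta>) \<longlonglongrightarrow>
        C * \<delta> powr (1 - \<alpha>) / \<eta>"
      by simp
    moreover have "\<forall>\<^sub>F n in sequentially. prob {\<omega>\<in>space N. V 1 \<omega> < - \<eta>} \<le>
        real n * measure law {..<- (\<delta> * real n powr (1 / \<alpha>))} + C * \<delta> powr (1 - \<alpha>) / \<eta>"
      using eventually_gt_at_top[of 0] by eventually_elim (rule le)
    ultimately show ?thesis
      by (rule tendsto_lowerbound) simp
  qed
  have zero: "prob {\<omega>\<in>space N. V 1 \<omega> < - \<eta>} = 0" if \<eta>: "\<eta> > 0" for \<eta>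
  proof -
    have "((\<lambda>\<delta>. C * \<delta> powr (1 - \<alpha>) / \<eta>) \<longlongrightarrow> C * 0 / \<eta>) (at_right 0)"
    proof (intro tendsto_divide tendsto_mult tendsto_const)
      show "((\<lambda>\<delta>. \<delta> powr (1 - \<alpha>)) \<longlongrightarrow> 0) (at_right 0)" using \<alpha> by real_asymp
    qed (use \<eta> in auto)
    then have "prob {\<omega>\<in>space N. V 1 \<omega> < - \<eta>} \<le> C * 0 / \<eta>"
      by (rule tendsto_lowerbound) (use bound[OF \<eta>] in \<open>auto simp: eventually_at_filter\<close>)
    then show ?thesis using measure_nonneg[of N "{\<omega>\<in>space N. V 1 \<omega> < - \<eta>}"] by simp
  qed
  have "AE \<omega> in N. \<forall>n. \<not> V 1 \<omega> < - (1 / real (Suc n))"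
    unfolding AE_all_countable
  proof
    fix n
    show "AE \<omega> in N. \<not> V 1 \<omega> < - (1 / real (Suc n))"
      by (subst AE_iff_measurable[OF _ refl]) (use zero[of "1 / real (Suc n)"] in
        \<open>auto simp: emeasure_eq_measure\<close>)
  qed
  then show ?thesis
  proof eventually_elim
    case (elim \<omega>)
    show ?case
    proof (rule ccontr)
      assume "\<not> 0 \<le> V 1 \<omega>"
      then obtain n where "inverse (real (Suc n)) < - V 1 \<omega>" using reals_Archimedean[of "- V 1 \<omega>"] by auto
      then show False using elim[rule_format, of n] by (simp add: inverse_eq_divide)
    qed
  qed
qed

lemma increment_nonneg:
  assumes "x < y"
  shows "AE \<omega> in N. V x \<omega> \<le> V y \<omega>"
proof -
  have "AE \<omega> in N. \<not> V 1 \<omega> < 0" using V_1_nonneg by eventually_elim auto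
  then have "prob {\<omega>\<in>space N. V 1 \<omega> < 0} = 0"
    by (subst (asm) AE_iff_measurable[where N="{\<omega>\<in>space N. V 1 \<omega> < 0}"]) (auto simp: emeasure_eq_measure)
  then have "measure law {..<0} = 0"
    by (subst measure_distr) (auto simp: vimage_def Int_def conj_commute)
  moreover have "{w. (y - x) powr (1 / \<alpha>) * w \<in> {..<0}} = {..<0}"
    using assms by (auto simp: mult_less_0_iff)
  ultimately have "prob {\<omega>\<in>space N. V y \<omega> - V x \<omega> \<in> {..<0}} = 0"
    by (subst prob_increment[OF assms]) auto
  then show ?thesis
    by (subst AE_iff_measurable[where N="{\<omega>\<in>space N. V y \<omega> - V x \<omega> \<in> {..<0}}"])
      (auto simp: emeasure_eq_measure not_le)
qed

text \<open>Increments between rational times are nonnegative outside a common null set; right-continuity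
  extends this to all times.\<close>

lemma paths_mono: "AE \<omega> in N. mono (\<lambda>x. V x \<omega>)"
proof -
  have "AE \<omega> in N. \<forall>p q :: rat. p < q \<longrightarrow> V (of_rat p) \<omega> \<le> V (of_rat q) \<omega>"
    unfolding AE_all_countable
    by (intro allI AE_impI increment_nonneg) (simp add: of_rat_less)
  then show ?thesis
    using AE_space
  proof eventually_elim
    case (elim \<omega>)
    note rational = elim(1)
    show ?case
    proof (rule monoI)
      fix x y :: real assume "x \<le> y"
      show "V x \<omega> \<le> V y \<omega>"
      proof (cases "x = y")
        case False
        then have "x < y" using \<open>x \<le> y\<close> by simp
        have "\<exists>p. \<forall>n. z < of_rat (p n) \<and> of_rat (p n) < z + 1 / real (Suc n)" for z :: real
          using of_rat_dense[of z "z + 1 / real (Suc _)"] by (intro choice) auto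
        then obtain p q where p: "\<And>n. x < of_rat (p n)" "\<And>n. of_rat (p n) < x + 1 / real (Suc n)"
          and q: "\<And>n. y < of_rat (q n)" "\<And>n. of_rat (q n) < y + 1 / real (Suc n)"
          by metis
        have lim: "(\<lambda>n. V (of_rat (r n)) \<omega>) \<longlonglongrightarrow> V z \<omega>"
          if r: "\<And>n. z < of_rat (r n)" "\<And>n. of_rat (r n) < z + 1 / real (Suc n)" for r z
        proof -
          have "(\<lambda>n. of_rat (r n)) \<longlonglongrightarrow> z"
          proof (rule tendsto_sandwich[where f="\<lambda>_. z"])
            show "(\<lambda>n. z + 1 / real (Suc n)) \<longlonglongrightarrow> z"
              using LIMSEQ_inverse_real_of_nat_add[of z] by (simp add: inverse_eq_divide)
          qed (use r in \<open>auto intro!: always_eventually less_imp_le\<close>)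
          then have "filterlim (\<lambda>n. of_rat (r n)) (at_right z) sequentially"
            using r by (auto simp: filterlim_at intro!: always_eventually)
          moreover have "((\<lambda>x. V x \<omega>) \<longlongrightarrow> V z \<omega>) (at_right z)"
            using right_continuous[OF elim(2), of z] by (simp add: continuous_within)
          ultimately show ?thesis by (rule filterlim_compose[rotated])
        qed
        show ?thesis
        proof (rule tendsto_le[OF _ lim[OF q] lim[OF p]])
          have "\<forall>\<^sub>F n in sequentially. 1 / real (Suc n) < y - x"
            using \<open>x < y\<close> by real_asymp
          then show "\<forall>\<^sub>F n in sequentially. V (of_rat (p n)) \<omega> \<le> V (of_rat (q n)) \<omega>"
          proof eventually_elim
            case (elim n)
            then have "of_rat (p n) < (of_rat (q n) :: real)" using p(2)[of n] q(1)[of n] by simp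
            then show ?case using rational by (auto simp: of_rat_less)
          qed
        qed simp
      qed simp
    qed
  qed
qed

lemma prob_two_increments:
  assumes "x < y" "y < z" and [measurable]: "A \<in> sets borel" "B \<in> sets borel"
  shows "prob {\<omega>\<in>space N. V y \<omega> - V x \<omega> \<in> A \<and> V z \<omega> - V y \<omega> \<in> B} =
    prob {\<omega>\<in>space N. V y \<omega> - V x \<omega> \<in> A} * prob {\<omega>\<in>space N. V z \<omega> - V y \<omega> \<in> B}"
proof -
  define t where "t = (\<lambda>k::nat. if k = 0 then x else if k = 1 then y else z)"
  have "strict_mono_on {..2} t"
    using assms(1,2) by (auto simp: strict_mono_on_def t_def)
  note ind = increments_indep[OF this]
  define C where "C = (\<lambda>k::nat. if k = 0 then A else B)"
  have "prob (\<Inter>k\<in>{..<2}. (\<lambda>\<omega>. V (t (Suc k)) \<omega> - V (t k) \<omega>) -` C k \<inter> space N) =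
    (\<Prod>k\<in>{..<2::nat}. prob ((\<lambda>\<omega>. V (t (Suc k)) \<omega> - V (t k) \<omega>) -` C k \<inter> space N))"
    by (rule indep_varsD[OF ind]) (auto simp: C_def lessThan_empty_iff)
  moreover have "{..<2::nat} = {0, 1}" by auto
  ultimately show ?thesis
    by (simp add: t_def C_def vimage_def Int_def conj_ac)
qed

definition tail :: "real \<Rightarrow> real" where
  "tail y = measure law {y<..}"

lemma tail_eq: "tail y = prob {\<omega>\<in>space N. y < V 1 \<omega>}"
  unfolding tail_def by (subst measure_distr) (auto intro!: arg_cong[where f=prob])

lemma tail_cdf: "tail y = 1 - cdf law y"
proof -
  have "{y<..} = space law - {..y}" by auto
  then show ?thesis unfolding tail_def cdf_def by (subst law.prob_compl[symmetric]) auto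
qed

lemma isCont_tail: "isCont tail y"
proof -
  have "isCont (\<lambda>y. 1 - cdf law y) y"
    using law.no_atoms by (intro continuous_intros) (simp add: law.isCont_cdf)
  then show ?thesis by (simp add: tail_cdf[abs_def])
qed

lemma tail_regular: "((\<lambda>y. y powr \<alpha> * tail y) \<longlongrightarrow> 1) at_top"
  unfolding tail_def by (rule law.upper_tail)

lemma tail_tendsto_0: "(tail \<longlongrightarrow> 0) at_top"
  using tendsto_diff[OF tendsto_const law.cdf_lim_at_top_prob, of 1] by (simp add: tail_cdf[abs_def])

lemma prob_law_lessThan: "measure law {..<y} = 1 - tail y"
proof -
  have "{..y} = {..<y} \<union> {y}" by auto
  then have "cdf law y = measure law {..<y} + measure law {y}"
    unfolding cdf_def by (simp only:) (rule law.finite_measure_Union, auto)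
  then show ?thesis by (simp add: tail_cdf law.no_atoms)
qed

lemma tail_0: "tail 0 = 1"
proof -
  have "AE \<omega> in N. \<not> V 1 \<omega> < 0" using V_1_nonneg by eventually_elim auto
  then have "prob {\<omega>\<in>space N. V 1 \<omega> < 0} = 0"
    by (subst (asm) AE_iff_measurable[where N="{\<omega>\<in>space N. V 1 \<omega> < 0}"]) (auto simp: emeasure_eq_measure)
  then have "measure law {..<0} = 0"
    by (subst measure_distr) (auto simp: vimage_def Int_def conj_commute)
  then show ?thesis using prob_law_lessThan[of 0] by simp
qed

text \<open>The sum of two independent increments over half the time stays below twice their common bound, while
  self-similarity shrinks each by more than 2. So the law charges intervals \<open>{..<k ^ n * y}\<close> for all \<open>n\<close>,
  with a factor \<open>k < 1\<close>.\<close>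

lemma law_charges_near_0:
  assumes "0 < \<eta>"
  shows "0 < measure law {..<\<eta>}"
proof -
  \<comment> \<open>Both halves of the unit time interval contribute \<open>(1/2) powr (1/\<alpha>)\<close> copies of the law, so a
    charged half-line \<open>{..<y}\<close> yields the charged half-line \<open>{..<k * y}\<close>; and \<open>k < 1\<close>.\<close>
  define k where "k = 2 * (1/2) powr (1 / \<alpha>)"
  have k: "0 < k" "k < 1"
  proof -
    have "(1/2::real) powr (1 / \<alpha>) < (1/2) powr 1" using \<alpha> by (intro powr_less_mono') auto
    then show "0 < k" "k < 1" by (auto simp: k_def)
  qed
  have step: "0 < measure law {..<k * y}" if "0 < measure law {..<y}" for y
  proof -
    have half: "prob {\<omega>\<in>space N. V (x + 1/2) \<omega> - V x \<omega> \<in> {..<k / 2 * y}} = measure law {..<y}" for x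
      by (subst prob_increment) (auto simp: k_def intro!: arg_cong[where f="measure law"])
    have "0 < measure law {..<y} * measure law {..<y}" using that by simp
    also have "\<dots> = prob {\<omega>\<in>space N. V (1/2) \<omega> - V 0 \<omega> \<in> {..<k / 2 * y}} *
        prob {\<omega>\<in>space N. V 1 \<omega> - V (1/2) \<omega> \<in> {..<k / 2 * y}}"
      using half[of 0] half[of "1/2"] by simp
    also have "\<dots> = prob {\<omega>\<in>space N. V (1/2) \<omega> - V 0 \<omega> \<in> {..<k / 2 * y} \<and>
        V 1 \<omega> - V (1/2) \<omega> \<in> {..<k / 2 * y}}"
      by (rule prob_two_increments[symmetric]) auto
    also have "\<dots> \<le> prob {\<omega>\<in>space N. V 1 \<omega> < k * y}"
      by (intro finite_measure_mono) (auto simp: V_0)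
    also have "\<dots> = measure law {..<k * y}"
      by (subst measure_distr) (auto intro!: arg_cong[where f=prob])
    finally show ?thesis .
  qed
  have "\<forall>\<^sub>F y in at_top. tail y < 1" by (rule order_tendstoD[OF tail_tendsto_0]) simp
  then obtain y where y: "tail y < 1" "y > 0"
    by (metis (no_types, lifting) eventually_at_top_linorder eventually_gt_at_top eventually_conj
      eventually_happens' trivial_limit_at_top_linorder)
  have "0 < measure law {..<k ^ n * y}" for n
  proof (induction n)
    case 0
    then show ?case using y by (simp add: prob_law_lessThan)
  next
    case (Suc n)
    then show ?case using step[of "k ^ n * y"] by (simp add: mult.assoc)
  qed
  moreover obtain n where "k ^ n < \<eta> / y"
    using real_arch_pow_inv[of "\<eta> / y" k] assms y k by auto
  then have "measure law {..<k ^ n * y} \<le> measure law {..<\<eta>}"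
    using y by (intro law.finite_measure_mono) (auto simp: field_simps)
  ultimately show ?thesis by (meson less_le_trans)
qed

text \<open>The law charges every interval in the half-line: the Levy measure makes one large increment over a
  short time fall in a prescribed interval with positive probability, and the independent remainder is
  small with positive probability.\<close>

lemma tail_strict_antimono:
  assumes "0 \<le> a" "a < b"
  shows "tail b < tail a"
proof -
  \<comment> \<open>An increment in \<open>{a'<..c}\<close> over the short time \<open>h\<close>, followed by one below \<open>b - c\<close> over the
    remaining time, leads into \<open>{a<..b}\<close>; moreover \<open>a'\<close> is positive even if \<open>a = 0\<close>.\<close>
  define a' where "a' = (2 * a + b) / 3"
  define c where "c = (a + 2 * b) / 3"
  have ac: "a < a'" "a' < c" "c < b" "0 < a'" using assms by (auto simp: a'_def c_def)
  have lim: "(\<lambda>n. real n * tail (y * real n powr (1 / \<alpha>))) \<longlonglongrightarrow> y powr - \<alpha>" if "y > 0" for y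
  proof -
    have "filterlim (\<lambda>n. y * real n powr (1 / \<alpha>)) at_top sequentially"
      using that \<alpha> by real_asymp
    from filterlim_compose[OF tail_regular this]
    have "(\<lambda>n. y powr - \<alpha> * ((y * real n powr (1 / \<alpha>)) powr \<alpha> * tail (y * real n powr (1 / \<alpha>)))) \<longlonglongrightarrow>
        y powr - \<alpha> * 1"
      by (intro tendsto_mult tendsto_const)
    moreover have "y powr - \<alpha> * ((y * real n powr (1 / \<alpha>)) powr \<alpha> * T) = real n * T" for n T
      using that \<alpha> by (simp add: powr_mult powr_powr powr_minus)
    ultimately show ?thesis by simp
  qed
  have "c powr - \<alpha> < a' powr - \<alpha>" using ac \<alpha> by (intro powr_less_mono2_neg) auto
  then have "\<forall>\<^sub>F n in sequentially. 0 < real n * tail (a' * real n powr (1 / \<alpha>)) - real n *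
      tail (c * real n powr (1 / \<alpha>))"
    using ac by (intro order_tendstoD(1)[OF tendsto_diff[OF lim lim]]) auto
  then obtain n where n: "n \<ge> 2" "0 < real n * tail (a' * real n powr (1 / \<alpha>)) - real n *
      tail (c * real n powr (1 / \<alpha>))"
    by (metis (mono_tags, lifting) eventually_at_top_linorder nle_le)
  then have n': "tail (c * real n powr (1 / \<alpha>)) < tail (a' * real n powr (1 / \<alpha>))"
    by (simp add: zero_less_mult_iff right_diff_distrib[symmetric])
  define h where "h = 1 / real n"
  have h: "0 < h" "h < 1" using n by (auto simp: h_def)
  have hp: "h powr (1/\<alpha>) = 1 / real n powr (1/\<alpha>)" using n by (simp add: h_def powr_divide)
  have "0 < tail (a' * real n powr (1 / \<alpha>)) - tail (c * real n powr (1 / \<alpha>))" using n' by simp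
  also have "\<dots> = measure law {a' * real n powr (1 / \<alpha>)<..c * real n powr (1 / \<alpha>)}"
    unfolding tail_cdf by (subst law.cdf_diff_eq[symmetric]) (use ac n in auto)
  also have "\<dots> = prob {\<omega>\<in>space N. V h \<omega> - V 0 \<omega> \<in> {a'<..c}}"
    using h n by (subst prob_increment) (auto simp: hp field_simps intro!: arg_cong[where f="measure law"])
  finally have p1: "0 < prob {\<omega>\<in>space N. V h \<omega> - V 0 \<omega> \<in> {a'<..c}}" .
  have "0 < measure law {..<b - c}" using ac by (intro law_charges_near_0) auto
  also have "\<dots> \<le> measure law {w. (1 - h) powr (1/\<alpha>) * w \<in> {..<b - c}}"
  proof (intro law.finite_measure_mono subsetI)
    fix w assume w: "w \<in> {..<b - c}"
    have "(1 - h) powr (1/\<alpha>) \<le> 1" using h \<alpha> by (intro powr_le1) auto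
    then have "(1 - h) powr (1/\<alpha>) * w \<le> max 0 w"
      by (cases "w \<ge> 0") (auto simp: mult_left_le_one_le mult_nonneg_nonpos)
    then show "w \<in> {w. (1 - h) powr (1/\<alpha>) * w \<in> {..<b - c}}" using w ac by auto
  qed auto
  also have "\<dots> = prob {\<omega>\<in>space N. V 1 \<omega> - V h \<omega> \<in> {..<b - c}}"
    using h by (subst prob_increment) auto
  finally have p2: "0 < prob {\<omega>\<in>space N. V 1 \<omega> - V h \<omega> \<in> {..<b - c}}" .
  have "0 < prob {\<omega>\<in>space N. V h \<omega> - V 0 \<omega> \<in> {a'<..c} \<and> V 1 \<omega> - V h \<omega> \<in> {..<b - c}}"
    using p1 p2 h by (subst prob_two_increments) auto
  also have "\<dots> \<le> prob {\<omega>\<in>space N. V 1 \<omega> \<in> {a<..b}}"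
  proof (rule finite_measure_mono_AE)
    show "AE \<omega> in N. \<omega> \<in> {\<omega>\<in>space N. V h \<omega> - V 0 \<omega> \<in> {a'<..c} \<and> V 1 \<omega> - V h \<omega> \<in> {..<b - c}} \<longrightarrow>
        \<omega> \<in> {\<omega>\<in>space N. V 1 \<omega> \<in> {a<..b}}"
      using increment_nonneg[OF h(2)] by eventually_elim (use ac in \<open>auto simp: V_0\<close>)
  qed measurable
  also have "\<dots> = measure law {a<..b}"
    by (subst measure_distr) (auto intro!: arg_cong[where f=prob])
  also have "\<dots> = tail a - tail b"
    unfolding tail_cdf by (subst law.cdf_diff_eq[symmetric]) (use assms in auto)
  finally show ?thesis by simp
qed

end

section \<open>Transferring tails: convergence of the rescaled transfer functions\<close>

text \<open>The tails \<open>F\<close> of the trap time and \<open>H\<close> of the stable variable enter only through monotonicity,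
    continuity
  and regular variation, so the transfer functions are studied for abstract \<open>F\<close> and \<open>H\<close>.\<close>

locale tail_transfer =
  fixes F H :: "real \<Rightarrow> real" and \<alpha> :: real
  assumes \<alpha>: "0 < \<alpha>" "\<alpha> < 1"
    and F_antimono: "\<And>s t. s \<le> t \<Longrightarrow> F t \<le> F s"
    and F_right_cont: "\<And>t. continuous (at_right t) F"
    and F_0: "F 0 = 1" and F_pos: "\<And>t. 0 < F t"
    and F_regular: "\<And>a. 0 < a \<Longrightarrow> ((\<lambda>t. F (a * t) / F t) \<longlongrightarrow> a powr - \<alpha>) at_top"
    and F_tendsto_0: "(F \<longlongrightarrow> 0) at_top"
    and H_cont: "\<And>y. isCont H y"
    and H_0: "H 0 = 1"
    and H_strict: "\<And>x y. 0 \<le> x \<Longrightarrow> x < y \<Longrightarrow> H y < H x"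
    and H_tendsto_0: "(H \<longlongrightarrow> 0) at_top"
    and H_regular: "((\<lambda>y. y powr \<alpha> * H y) \<longlongrightarrow> 1) at_top"
begin

definition G :: "real \<Rightarrow> real" where
  "G x = (THE y. 0 \<le> y \<and> H y = F x)"

definition q :: "real \<Rightarrow> real" where
  "q \<epsilon> = Inf {t. 0 \<le> t \<and> F t \<le> \<epsilon>}"

definition g :: "real \<Rightarrow> real \<Rightarrow> real" where
  "g \<epsilon> x = inverse (q \<epsilon>) * right_cont_inverse G (\<epsilon> powr (- 1 / \<alpha>) * x)"

lemma H_antimono: "0 \<le> x \<Longrightarrow> x \<le> y \<Longrightarrow> H y \<le> H x"
  using H_strict[of x y] by (cases "x = y") auto

lemma H_pos: "0 < H y" if "0 \<le> y"
proof -
  have "0 \<le> H (y + 1)"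
  proof (rule tendsto_upperbound[OF H_tendsto_0])
    show "\<forall>\<^sub>F z in at_top. H z \<le> H (y + 1)"
      using eventually_ge_at_top[of "y + 1"] by eventually_elim (use that in \<open>auto intro: H_antimono\<close>)
  qed simp
  then show ?thesis using H_strict[of y "y + 1"] that by simp
qed

lemma G_eq: "0 \<le> x \<Longrightarrow> 0 \<le> G x \<and> H (G x) = F x"
proof -
  assume "0 \<le> x"
  have "\<forall>\<^sub>F y in at_top. H y < F x" by (rule order_tendstoD(2)[OF H_tendsto_0 F_pos])
  then obtain y0 where y0: "\<And>y. y \<ge> y0 \<Longrightarrow> H y < F x" by (auto simp: eventually_at_top_linorder)
  have "\<exists>y\<ge>0. y \<le> max y0 0 \<and> H y = F x"
    using y0[of "max y0 0"] F_antimono[OF \<open>0 \<le> x\<close>] H_cont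
    by (intro IVT2) (auto simp: F_0 H_0)
  then obtain y where y: "0 \<le> y" "H y = F x" by auto
  have "\<exists>!y. 0 \<le> y \<and> H y = F x"
  proof (rule ex1I[of _ y])
    fix z assume "0 \<le> z \<and> H z = F x"
    then show "z = y" using y H_strict[of y z] H_strict[of z y] by (cases y z rule: linorder_cases) auto
  qed (use y in auto)
  then show ?thesis unfolding G_def by (rule theI')
qed

lemma less_G_iff: "0 \<le> x \<Longrightarrow> 0 \<le> y \<Longrightarrow> y < G x \<longleftrightarrow> F x < H y"
  using G_eq[of x] H_strict[of y "G x"] H_antimono[of "G x" y] by (metis not_less)

text \<open>Hence the infimum in \<open>right_cont_inverse\<close> is never that of the empty set.\<close>

lemma G_set_nonempty: "\<exists>x\<ge>0. y < G x"
proof -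
  have "\<forall>\<^sub>F x in at_top. F x < H (max 0 y)" by (rule order_tendstoD(2)[OF F_tendsto_0 H_pos]) simp
  then obtain x0 where x0: "\<And>x. x \<ge> x0 \<Longrightarrow> F x < H (max 0 y)" by (auto simp: eventually_at_top_linorder)
  have "max 0 y < G (max 0 x0)" using x0[of "max 0 x0"] by (subst less_G_iff) auto
  then show ?thesis by (intro exI[of _ "max 0 x0"]) auto
qed

lemma G_inverse_mono: "mono (right_cont_inverse G)"
  unfolding right_cont_inverse_def
  using G_set_nonempty by (intro monoI cInf_superset_mono) (auto intro!: bdd_belowI[of _ 0])

lemma G_inverse_nonneg: "0 \<le> right_cont_inverse G y"
  unfolding right_cont_inverse_def using G_set_nonempty[of y] by (intro cInf_greatest) auto

lemma G_inverse_less_iff: "right_cont_inverse G y < t \<longleftrightarrow> (\<exists>x\<ge>0. x < t \<and> y < G x)"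
  unfolding right_cont_inverse_def using G_set_nonempty[of y]
  by (subst cInf_less_iff) (auto intro!: bdd_belowI[of _ 0])

lemma G_inverse_le: "0 \<le> t \<Longrightarrow> 0 \<le> y \<Longrightarrow> F t < H y \<Longrightarrow> right_cont_inverse G y \<le> t"
  unfolding right_cont_inverse_def by (intro cInf_lower) (auto simp: less_G_iff intro!: bdd_belowI[of _ 0])

lemma G_inverse_ge: "0 \<le> y \<Longrightarrow> H y \<le> F t \<Longrightarrow> t \<le> right_cont_inverse G y"
  unfolding right_cont_inverse_def
proof (rule cInf_greatest)
  fix x assume y: "0 \<le> y" "H y \<le> F t" and "x \<in> {x. 0 \<le> x \<and> y < G x}"
  then have "0 \<le> x" "F x < H y" by (auto simp: less_G_iff)
  then show "t \<le> x" using F_antimono[of x t] y by (cases "x \<le> t") auto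
qed (use G_set_nonempty[of y] in auto)

lemma F_at_less_G_inverse: "0 \<le> t \<Longrightarrow> 0 \<le> y \<Longrightarrow> t < right_cont_inverse G y \<Longrightarrow> H y \<le> F t"
  using G_inverse_le[of t y] by (meson leD leI)

lemma q_set_nonempty: "0 < \<epsilon> \<Longrightarrow> {t. 0 \<le> t \<and> F t \<le> \<epsilon>} \<noteq> {}"
proof -
  assume "0 < \<epsilon>"
  then have "\<forall>\<^sub>F x in at_top. F x < \<epsilon>" by (rule order_tendstoD[OF F_tendsto_0])
  then obtain x0 where "\<And>x. x \<ge> x0 \<Longrightarrow> F x < \<epsilon>" by (auto simp: eventually_at_top_linorder)
  then have "F (max 0 x0) \<le> \<epsilon>" by (auto intro: less_imp_le)
  then show ?thesis by (auto intro!: exI[of _ "max 0 x0"])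
qed

lemma F_less_q: "0 \<le> t \<Longrightarrow> t < q \<epsilon> \<Longrightarrow> \<epsilon> < F t"
proof (rule ccontr)
  assume t: "0 \<le> t" "t < q \<epsilon>" "\<not> \<epsilon> < F t"
  then have "q \<epsilon> \<le> t" unfolding q_def by (intro cInf_lower) (auto intro!: bdd_belowI[of _ 0])
  then show False using t by simp
qed

text \<open>The infimum that defines the quantile is attained, by right-continuity.\<close>

lemma F_q: assumes "0 < \<epsilon>" shows "F (q \<epsilon>) \<le> \<epsilon>"
proof (rule tendsto_upperbound)
  show "(F \<longlongrightarrow> F (q \<epsilon>)) (at_right (q \<epsilon>))" using F_right_cont by (simp add: continuous_within)
  have "F t \<le> \<epsilon>" if t: "q \<epsilon> < t" for t
  proof -
    have "bdd_below {t. 0 \<le> t \<and> F t \<le> \<epsilon>}" by (auto intro!: bdd_belowI[of _ 0])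
    then obtain s where "s < t" "F s \<le> \<epsilon>"
      using t cInf_less_iff[OF q_set_nonempty[OF assms], of t] unfolding q_def by auto
    then show ?thesis using F_antimono[of s t] by simp
  qed
  then show "\<forall>\<^sub>F t in at_right (q \<epsilon>). F t \<le> \<epsilon>" by (auto simp: eventually_at_filter)
qed simp

lemma q_pos: assumes "0 < \<epsilon>" "\<epsilon> < 1" shows "0 < q \<epsilon>"
proof -
  have "0 \<le> q \<epsilon>" unfolding q_def using q_set_nonempty[OF assms(1)] by (intro cInf_greatest) auto
  moreover have "q \<epsilon> \<noteq> 0" using F_q[OF assms(1)] assms(2) F_0 by auto
  ultimately show ?thesis by simp
qed

lemma q_at_top: "filterlim q at_top (at_right 0)"
  unfolding filterlim_at_top
proof
  fix K
  have "\<forall>\<^sub>F \<epsilon> in at_right 0. \<epsilon> < F K \<and> 0 < \<epsilon>"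
    using F_pos[of K] by (auto simp: eventually_at_right_field)
  then show "\<forall>\<^sub>F \<epsilon> in at_right 0. K \<le> q \<epsilon>"
  proof eventually_elim
    case (elim \<epsilon>)
    then show ?case using F_q[of \<epsilon>] F_antimono[of "q \<epsilon>" K] by (cases "q \<epsilon> \<le> K") auto
  qed
qed

lemma small_eps: "\<forall>\<^sub>F \<epsilon> in at_right (0::real). 0 < \<epsilon> \<and> \<epsilon> < 1"
  by (auto simp: eventually_at_right_field intro!: exI[of _ 1])

text \<open>At the scale \<open>\<epsilon> powr (- 1 / \<alpha>)\<close> the tail of the stable variable is of order \<open>\<epsilon>\<close>.\<close>

lemma H_scaled:
  assumes "0 < x"
  shows "((\<lambda>\<epsilon>. H (\<epsilon> powr (- 1 / \<alpha>) * x) / \<epsilon>) \<longlongrightarrow> x powr - \<alpha>) (at_right 0)"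
proof -
  have "filterlim (\<lambda>\<epsilon>. \<epsilon> powr (- 1 / \<alpha>) * x) at_top (at_right 0)"
    using assms \<alpha> by real_asymp
  from tendsto_mult[OF tendsto_const[of "x powr - \<alpha>"] filterlim_compose[OF H_regular this]]
  have "((\<lambda>\<epsilon>. x powr - \<alpha> * ((\<epsilon> powr (- 1 / \<alpha>) * x) powr \<alpha> * H (\<epsilon> powr (- 1 / \<alpha>) * x))) \<longlongrightarrow>
      x powr - \<alpha>) (at_right 0)"
    by simp
  then show ?thesis
  proof (rule Lim_transform_eventually)
    show "\<forall>\<^sub>F \<epsilon> in at_right 0. x powr - \<alpha> * ((\<epsilon> powr (- 1 / \<alpha>) * x) powr \<alpha> * H (\<epsilon> powr (- 1 / \<alpha>) * x)) =
        H (\<epsilon> powr (- 1 / \<alpha>) * x) / \<epsilon>"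
      using small_eps
    proof eventually_elim
      case (elim \<epsilon>)
      have "(\<epsilon> powr (- 1 / \<alpha>) * x) powr \<alpha> = x powr \<alpha> / \<epsilon>"
        using elim \<alpha> assms powr_powr[of \<epsilon> "- 1 / \<alpha>" \<alpha>]
        by (simp only: powr_mult) (simp add: powr_minus divide_inverse)
      then show ?case using assms by (simp only:) (simp add: powr_minus field_simps)
    qed
  qed
qed

text \<open>The probability \<open>H (\<epsilon> powr (- 1 / \<alpha>) * x)\<close> is asymptotic to \<open>\<epsilon> * x powr - \<alpha>\<close>. Regular variation of \<open>F\<close>
  locates the quantile for it between \<open>x * \<sigma>\<^sup>2 * q \<epsilon>\<close> and \<open>x * \<theta> * q \<epsilon>\<close>
      for any \<open>\<sigma> < 1 < \<theta>\<close>. As \<open>F\<close> may jump at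
  the quantile \<open>q \<epsilon>\<close>, the lower bound compares with \<open>\<sigma> * q \<epsilon>\<close>, where \<open>F\<close> still exceeds \<open>\<epsilon>\<close>.\<close>

lemma g_tendsto:
  assumes "0 \<le> x"
  shows "((\<lambda>\<epsilon>. g \<epsilon> x) \<longlongrightarrow> x) (at_right 0)"
proof (cases "x = 0")
  case True
  have "((\<lambda>\<epsilon>. inverse (q \<epsilon>) * right_cont_inverse G 0) \<longlongrightarrow> 0 * right_cont_inverse G 0) (at_right 0)"
    by (intro tendsto_mult tendsto_const filterlim_compose[OF tendsto_inverse_0_at_top q_at_top]
      tendsto_inverse_0_at_top q_at_top)
  then show ?thesis using True by (simp add: g_def)
next
  case False
  then have x: "0 < x" using assms by simp
  note Hs = H_scaled[OF x]
  have upper: "\<forall>\<^sub>F \<epsilon> in at_right 0. g \<epsilon> x \<le> x * \<theta>" if \<theta>: "1 < \<theta>" for \<theta>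
  proof -
    have xt: "0 < x * \<theta>" using x \<theta> by simp
    have "((\<lambda>\<epsilon>. H (\<epsilon> powr (- 1 / \<alpha>) * x) / \<epsilon> - F ((x * \<theta>) * q \<epsilon>) / F (q \<epsilon>)) \<longlongrightarrow>
        x powr - \<alpha> - (x * \<theta>) powr - \<alpha>) (at_right 0)"
      by (intro tendsto_diff Hs filterlim_compose[OF F_regular[OF xt] q_at_top])
    moreover have "0 < x powr - \<alpha> - (x * \<theta>) powr - \<alpha>"
      using x \<theta> \<alpha> powr_less_mono2_neg[of "-\<alpha>" x "x * \<theta>"] by simp
    ultimately have "\<forall>\<^sub>F \<epsilon> in at_right 0. 0 < H (\<epsilon> powr (- 1 / \<alpha>) * x) / \<epsilon> - F ((x * \<theta>) * q \<epsilon>) / F (q \<epsilon>)"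
      by (rule order_tendstoD)
    with small_eps show ?thesis
    proof eventually_elim
      case (elim \<epsilon>)
      have qp: "0 < q \<epsilon>" using elim by (intro q_pos) auto
      have "F ((x * \<theta>) * q \<epsilon>) < H (\<epsilon> powr (- 1 / \<alpha>) * x) / \<epsilon> * F (q \<epsilon>)"
        using elim F_pos[of "q \<epsilon>"] by (simp add: field_simps)
      also have "\<dots> \<le> H (\<epsilon> powr (- 1 / \<alpha>) * x) / \<epsilon> * \<epsilon>"
        using elim x H_pos[of "\<epsilon> powr (- 1 / \<alpha>) * x"] by (intro mult_left_mono F_q) auto
      finally have "F ((x * \<theta>) * q \<epsilon>) < H (\<epsilon> powr (- 1 / \<alpha>) * x)" using elim by simp
      then have "right_cont_inverse G (\<epsilon> powr (- 1 / \<alpha>) * x) \<le> (x * \<theta>) * q \<epsilon>"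
        using x xt qp by (intro G_inverse_le) auto
      then show ?case using qp by (simp add: g_def field_simps)
    qed
  qed
  have lower: "\<forall>\<^sub>F \<epsilon> in at_right 0. x * \<sigma>\<^sup>2 \<le> g \<epsilon> x" if \<sigma>: "0 < \<sigma>" "\<sigma> < 1" for \<sigma>
  proof -
    have xt: "0 < x * \<sigma>" using x \<sigma> by simp
    have qs: "filterlim (\<lambda>\<epsilon>. \<sigma> * q \<epsilon>) at_top (at_right 0)"
      by (intro filterlim_tendsto_pos_mult_at_top[OF tendsto_const] \<sigma> q_at_top)
    have "((\<lambda>\<epsilon>. F ((x * \<sigma>) * (\<sigma> * q \<epsilon>)) / F (\<sigma> * q \<epsilon>) - H (\<epsilon> powr (- 1 / \<alpha>) * x) / \<epsilon>) \<longlongrightarrow>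
        (x * \<sigma>) powr - \<alpha> - x powr - \<alpha>) (at_right 0)"
      by (intro tendsto_diff Hs filterlim_compose[OF F_regular[OF xt] qs])
    moreover have "0 < (x * \<sigma>) powr - \<alpha> - x powr - \<alpha>"
      using x \<sigma> \<alpha> powr_less_mono2_neg[of "-\<alpha>" "x * \<sigma>" x] by simp
    ultimately have "\<forall>\<^sub>F \<epsilon> in at_right 0. 0 <
        F ((x * \<sigma>) * (\<sigma> * q \<epsilon>)) / F (\<sigma> * q \<epsilon>) - H (\<epsilon> powr (- 1 / \<alpha>) * x) / \<epsilon>"
      by (rule order_tendstoD)
    with small_eps show ?thesis
    proof eventually_elim
      case (elim \<epsilon>)
      have qp: "0 < q \<epsilon>" using elim by (intro q_pos) auto
      have "H (\<epsilon> powr (- 1 / \<alpha>) * x) = H (\<epsilon> powr (- 1 / \<alpha>) * x) / \<epsilon> * \<epsilon>" using elim by simp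
      also have "\<dots> \<le> H (\<epsilon> powr (- 1 / \<alpha>) * x) / \<epsilon> * F (\<sigma> * q \<epsilon>)"
        using elim x H_pos[of "\<epsilon> powr (- 1 / \<alpha>) * x"] qp \<sigma>
            by (intro mult_left_mono less_imp_le[OF F_less_q]) auto
      also have "\<dots> \<le> F ((x * \<sigma>) * (\<sigma> * q \<epsilon>))"
        using elim F_pos[of "\<sigma> * q \<epsilon>"] by (simp add: field_simps)
      finally have "(x * \<sigma>) * (\<sigma> * q \<epsilon>) \<le> right_cont_inverse G (\<epsilon> powr (- 1 / \<alpha>) * x)"
        using x by (intro G_inverse_ge) auto
      then show ?case using qp by (simp add: g_def field_simps power2_eq_square)
    qed
  qed
  show ?thesis
  proof (rule order_tendstoI)
    fix a assume "a < x"
    then obtain \<rho> where \<rho>: "max 0 (a / x) < \<rho>" "\<rho> < 1"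
      using dense[of "max 0 (a / x)" 1] x by auto
    then have "a < x * (sqrt \<rho>)\<^sup>2" using x by (simp add: field_simps)
    moreover have "\<forall>\<^sub>F \<epsilon> in at_right 0. x * (sqrt \<rho>)\<^sup>2 \<le> g \<epsilon> x"
      using \<rho> by (intro lower) auto
    ultimately show "\<forall>\<^sub>F \<epsilon> in at_right 0. a < g \<epsilon> x"
      by (auto elim!: eventually_mono)
  next
    fix b assume "x < b"
    then obtain \<theta> where \<theta>: "1 < \<theta>" "\<theta> < b / x"
      using dense[of 1 "b / x"] x by auto
    then have "x * \<theta> < b" using x by (simp add: field_simps)
    then show "\<forall>\<^sub>F \<epsilon> in at_right 0. g \<epsilon> x < b"
      using upper[OF \<theta>(1)] by (auto elim!: eventually_mono)
  qed
qed

lemma g_mono: "0 < \<epsilon> \<Longrightarrow> \<epsilon> < 1 \<Longrightarrow> x \<le> y \<Longrightarrow> g \<epsilon> x \<le> g \<epsilon> y"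
  unfolding g_def using q_pos[of \<epsilon>] by (intro mult_left_mono monoD[OF G_inverse_mono]) auto

lemma g_nonneg: "0 < \<epsilon> \<Longrightarrow> \<epsilon> < 1 \<Longrightarrow> 0 \<le> g \<epsilon> x"
  unfolding g_def using q_pos[of \<epsilon>] G_inverse_nonneg by (intro mult_nonneg_nonneg) auto

text \<open>One half of Potter's bounds. For a monotone function it follows by iterating the bound on
  \<open>F (2 * t) / F t\<close>; the factor 2 pays for rounding the ratio \<open>s / t\<close> up to a power of 2.\<close>

lemma F_lower_potter:
  assumes "\<alpha> < \<gamma>"
  obtains t0 where "0 < t0" "\<And>s t. t0 \<le> t \<Longrightarrow> t \<le> s \<Longrightarrow> (2 * s / t) powr - \<gamma> * F t \<le> F s"
proof -
  have "2 powr - \<gamma> < (2::real) powr - \<alpha>" using assms by simp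
  from order_tendstoD(1)[OF F_regular[of 2] this]
  have "\<forall>\<^sub>F t in at_top. 2 powr - \<gamma> < F (2 * t) / F t" by simp
  then obtain t1 where t1: "\<And>t. t \<ge> t1 \<Longrightarrow> 2 powr - \<gamma> < F (2 * t) / F t"
      by (auto simp: eventually_at_top_linorder)
  define t0 where "t0 = max t1 1"
  have dbl: "2 powr - \<gamma> * F t \<le> F (2 * t)" if "t \<ge> t0" for t
    using t1[of t] that F_pos[of t] by (simp add: t0_def field_simps)
  have iter: "(2 ^ n) powr - \<gamma> * F t \<le> F (2 ^ n * t)" if t: "t \<ge> t0" for n t
  proof (induction n)
    case (Suc n)
    have "t0 \<le> 2 ^ n * t"
      using t mult_mono[of 1 "2 ^ n" t0 t] by (simp add: t0_def)
    have "(2 ^ Suc n) powr - \<gamma> * F t = 2 powr - \<gamma> * ((2 ^ n) powr - \<gamma> * F t)"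
      by (simp add: powr_mult)
    also have "\<dots> \<le> 2 powr - \<gamma> * F (2 ^ n * t)" by (intro mult_left_mono Suc) auto
    also have "\<dots> \<le> F (2 ^ Suc n * t)" using dbl[OF \<open>t0 \<le> 2 ^ n * t\<close>] by (simp add: mult.assoc)
    finally show ?case .
  qed simp
  show thesis
  proof (rule that)
    show "0 < t0" by (simp add: t0_def)
    fix s t assume st: "t0 \<le> t" "t \<le> s"
    have t: "0 < t" using st by (simp add: t0_def)
    define n where "n = (LEAST n. s / t < 2 ^ n)"
    have ex: "\<exists>n. s / t < 2 ^ n" by (rule real_arch_pow) simp
    have n1: "s / t < 2 ^ n" unfolding n_def by (rule LeastI_ex[OF ex])
    have "n \<noteq> 0" using n1 st t by (intro notI) (simp add: field_simps)
    then obtain m where m: "n = Suc m" by (cases n) auto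
    have "\<not> s / t < 2 ^ m" using not_less_Least[of m "\<lambda>n. s / t < 2 ^ n"] m by (simp add: n_def)
    then have n2: "2 ^ n \<le> 2 * s / t" by (simp add: m not_less)
    have "(2 * s / t) powr - \<gamma> * F t \<le> (2 ^ n) powr - \<gamma> * F t"
      using n2 assms \<alpha> F_pos[of t] by (intro mult_right_mono powr_mono2') auto
    also have "\<dots> \<le> F (2 ^ n * t)" by (rule iter[OF st(1)])
    also have "\<dots> \<le> F s" using n1 t by (intro F_antimono) (simp add: field_simps)
    finally show "(2 * s / t) powr - \<gamma> * F t \<le> F s" .
  qed
qed

text \<open>Small arguments of \<open>g \<epsilon>\<close> correspond to probabilities far above \<open>\<epsilon>\<close>, so the claim compares quantiles of
  \<open>F\<close> at different levels, which \<open>F_lower_potter\<close> does with any loss in the exponent. For arguments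
  below \<open>\<epsilon> powr (1 / \<alpha>)\<close>, where no tail asymptotics are available, monotonicity suffices; this produces
  the second summand.\<close>

lemma g_power_bound:
  assumes \<beta>: "\<alpha> < \<beta>" "\<beta> < 1"
  shows "\<exists>C\<ge>0. \<forall>\<^sub>F \<epsilon> in at_right 0. \<forall>x. 0 \<le> x \<and> x \<le> 1 \<longrightarrow> g \<epsilon> x \<le> C * (x powr \<beta> + \<epsilon> powr (\<beta> / \<alpha>))"
proof -
  define \<gamma> where "\<gamma> = \<alpha> / \<beta>"
  have \<gamma>: "\<alpha> < \<gamma>" "0 < \<gamma>" and \<gamma>\<beta>: "1 / \<gamma> = \<beta> / \<alpha>" using \<beta> \<alpha> by (auto simp: \<gamma>_def field_simps)
  obtain t0 where t0: "0 < t0" and potter: "\<And>s t. t0 \<le> t \<Longrightarrow> t \<le> s \<Longrightarrow> (2 * s / t) powr - \<gamma> * F t \<le> F s"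
    using F_lower_potter[OF \<gamma>(1)] by metis
  \<comment> \<open>A lower bound for the tail is a lower bound for large quantiles: if the tail is at least \<open>p\<close> at
    \<open>t\<close> and at most \<open>\<epsilon>\<close> at \<open>s\<close>, then \<open>s\<close> exceeds \<open>t\<close> by a power of \<open>p / \<epsilon>\<close>.\<close>
  have invert: "1 / s \<le> 2 / t * (p / \<epsilon>) powr - (\<beta> / \<alpha>)"
    if "t0 \<le> t" "t \<le> s" "p \<le> F t" "F s \<le> \<epsilon>" "0 < p" "0 < \<epsilon>" for s t p \<epsilon>
  proof -
    have pos: "0 < t" "0 < s" using that t0 by auto
    have "(2 * s / t) powr - \<gamma> * p \<le> (2 * s / t) powr - \<gamma> * F t" using that by (intro mult_left_mono) auto
    also have "\<dots> \<le> \<epsilon>" using potter[of t s] that by simp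
    finally have "p / \<epsilon> \<le> (2 * s / t) powr \<gamma>" using that pos by (simp add: powr_minus field_simps)
    then have "(p / \<epsilon>) powr (1 / \<gamma>) \<le> ((2 * s / t) powr \<gamma>) powr (1 / \<gamma>)"
      using that \<gamma> by (intro powr_mono2) auto
    also have "\<dots> = 2 * s / t" using pos \<gamma> by (simp add: powr_powr)
    finally have "(p / \<epsilon>) powr (\<beta> / \<alpha>) \<le> 2 * s / t" by (simp add: \<gamma>\<beta>)
    moreover have "0 < (p / \<epsilon>) powr (\<beta> / \<alpha>)" using that by simp
    ultimately show ?thesis using pos by (simp add: powr_minus field_simps)
  qed
  obtain c where c: "0 < c" "\<And>y. 1 \<le> y \<Longrightarrow> c * y powr - \<alpha> \<le> H y"
  proof -
    have "\<forall>\<^sub>F y in at_top. 1 / 2 < y powr \<alpha> * H y" by (rule order_tendstoD[OF H_regular]) simp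
    then obtain y1 where y1: "\<And>y. y \<ge> y1 \<Longrightarrow> 1 / 2 < y powr \<alpha> * H y"
        by (auto simp: eventually_at_top_linorder)
    define y2 where "y2 = max y1 1"
    define c where "c = min (1 / 2) (H y2)"
    have "c * y powr - \<alpha> \<le> H y" if y: "1 \<le> y" for y
    proof (cases "y \<ge> y2")
      case True
      have "c * y powr - \<alpha> \<le> 1 / 2 * y powr - \<alpha>" by (intro mult_right_mono) (auto simp: c_def)
      also have "\<dots> \<le> H y" using y1[of y] True y by (simp add: y2_def powr_minus field_simps)
      finally show ?thesis .
    next
      case False
      have "y powr - \<alpha> \<le> 1" using powr_mono[of "- \<alpha>" 0 y] y \<alpha> by simp
      then have "c * y powr - \<alpha> \<le> H y2 * 1"
        using less_imp_le[OF H_pos[of y2]] by (intro mult_mono) (auto simp: c_def y2_def)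
      also have "\<dots> \<le> H y" using False y H_antimono[of y y2] by simp
      finally show ?thesis .
    qed
    moreover have "0 < c" using H_pos[of y2] by (simp add: c_def y2_def)
    ultimately show ?thesis using that by blast
  qed
  define C1 where "C1 = 2 / t0 * F t0 powr - (\<beta> / \<alpha>)"
  define K where "K = 4 * c powr - (\<beta> / \<alpha>) + 2 * t0 * C1"
  have C1: "0 \<le> C1" using t0 by (simp add: C1_def)
  have K: "0 \<le> K" using C1 t0 by (simp add: K_def)
  have ev: "\<forall>\<^sub>F \<epsilon> in at_right 0. (0 < \<epsilon> \<and> \<epsilon> < 1) \<and> t0 \<le> q \<epsilon> \<and> g \<epsilon> 1 < 2"
  proof (intro eventually_conj)
    show "\<forall>\<^sub>F \<epsilon> in at_right 0. t0 \<le> q \<epsilon>" using q_at_top by (auto simp: filterlim_at_top)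
    show "\<forall>\<^sub>F \<epsilon> in at_right 0. g \<epsilon> 1 < 2" by (rule order_tendstoD[OF g_tendsto]) auto
  qed (use small_eps in \<open>auto elim: eventually_mono\<close>)
  show ?thesis
  proof (intro exI[of _ "2 * K"] conjI)
    show "\<forall>\<^sub>F \<epsilon> in at_right 0. \<forall>x. 0 \<le> x \<and> x \<le> 1 \<longrightarrow> g \<epsilon> x \<le> 2 * K * (x powr \<beta> + \<epsilon> powr (\<beta> / \<alpha>))"
      using ev
    proof eventually_elim
      case (elim \<epsilon>)
      then have \<epsilon>: "0 < \<epsilon>" "\<epsilon> < 1" "t0 \<le> q \<epsilon>" "g \<epsilon> 1 < 2" by auto
      have qp: "0 < q \<epsilon>" using \<epsilon> by (intro q_pos) auto
      have "1 / q \<epsilon> \<le> 2 / t0 * (F t0 / \<epsilon>) powr - (\<beta> / \<alpha>)"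
        using \<epsilon> F_pos[of t0] by (intro invert F_q) auto
      also have "\<dots> = C1 * \<epsilon> powr (\<beta> / \<alpha>)"
        using \<epsilon> F_pos[of t0] by (simp add: C1_def powr_divide powr_minus field_simps)
      finally have qinv: "1 / q \<epsilon> \<le> C1 * \<epsilon> powr (\<beta> / \<alpha>)" .
      have main: "g \<epsilon> x \<le> K * (x powr \<beta> + \<epsilon> powr (\<beta> / \<alpha>))" if x: "\<epsilon> powr (1 / \<alpha>) \<le> x" "x \<le> 1" for x
      proof -
        have x0: "0 < x" using x(1) \<epsilon>(1) less_le_trans[of 0 "\<epsilon> powr (1 / \<alpha>)" x] by simp
        define y where "y = \<epsilon> powr (- 1 / \<alpha>) * x"
        have "\<epsilon> powr (- 1 / \<alpha>) * \<epsilon> powr (1 / \<alpha>) \<le> y" unfolding y_def using x by (intro mult_left_mono) auto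
        then have y1: "1 \<le> y" using \<epsilon> by (simp add: powr_add[symmetric])
        define p where "p = c * \<epsilon> * x powr - \<alpha>"
        have "p = c * y powr - \<alpha>" using \<epsilon> x0 \<alpha> by (simp add: p_def y_def powr_mult powr_powr)
        then have pH: "p \<le> H y" using c(2)[OF y1] by simp
        have p0: "0 < p" using c x0 \<epsilon> by (simp add: p_def)
        define Q where "Q = right_cont_inverse G y"
        have gQ: "g \<epsilon> x = Q / q \<epsilon>" by (simp add: g_def Q_def y_def divide_inverse)
        have Q0: "0 \<le> Q" unfolding Q_def by (rule G_inverse_nonneg)
        \<comment> \<open>Half the quantile \<open>Q\<close> is a point at which the tail still exceeds \<open>p\<close>. The bound on the
          tail applies if this point lies between \<open>t0\<close> and the quantile \<open>q \<epsilon>\<close>; below \<open>t0\<close> the quantile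
          \<open>Q\<close> is bounded, and beyond \<open>q \<epsilon>\<close> the argument \<open>x\<close> is bounded away from 0.\<close>
        consider "Q / 2 < t0" | "t0 \<le> Q / 2" "Q / 2 \<le> q \<epsilon>" | "t0 \<le> Q / 2" "q \<epsilon> < Q / 2" by linarith
        then show ?thesis
        proof cases
          case 1
          have "g \<epsilon> x \<le> (2 * t0) * (1 / q \<epsilon>)" unfolding gQ using 1 qp by (simp add: divide_right_mono)
          also have "\<dots> \<le> (2 * t0) * (C1 * \<epsilon> powr (\<beta> / \<alpha>))" using t0 qinv by (intro mult_left_mono) auto
          also have "\<dots> \<le> K * (x powr \<beta> + \<epsilon> powr (\<beta> / \<alpha>))"
            using t0 C1 K by (auto simp: K_def mult.assoc distrib_right distrib_left intro!:
                add_nonneg_nonneg)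
          finally show ?thesis .
        next
          case 2
          have "p \<le> F (Q / 2)"
            using pH F_at_less_G_inverse[of "Q / 2" y] 2 t0 y1 by (simp add: Q_def)
          then have "1 / q \<epsilon> \<le> 2 / (Q / 2) * (p / \<epsilon>) powr - (\<beta> / \<alpha>)"
            using 2 \<epsilon> p0 by (intro invert F_q) auto
          also have "(p / \<epsilon>) powr - (\<beta> / \<alpha>) = c powr - (\<beta> / \<alpha>) * x powr \<beta>"
            using \<epsilon> c x0 \<alpha> by (simp add: p_def powr_mult powr_powr)
          finally have "Q * (1 / q \<epsilon>) \<le> Q * (2 / (Q / 2) * (c powr - (\<beta> / \<alpha>) * x powr \<beta>))"
            using Q0 by (rule mult_left_mono)
          also have "\<dots> = 4 * c powr - (\<beta> / \<alpha>) * x powr \<beta>" using 2 t0 by simp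
          also have "\<dots> \<le> K * (x powr \<beta> + \<epsilon> powr (\<beta> / \<alpha>))"
            using t0 C1 K by (auto simp: K_def distrib_right distrib_left intro!: add_nonneg_nonneg)
          finally show ?thesis by (simp add: gQ)
        next
          case 3
          have "p \<le> F (Q / 2)"
            using pH F_at_less_G_inverse[of "Q / 2" y] 3 t0 y1 by (simp add: Q_def)
          also have "\<dots> \<le> F (q \<epsilon>)" using 3 by (intro F_antimono) auto
          also have "\<dots> \<le> \<epsilon>" using \<epsilon> by (intro F_q)
          finally have "c \<le> x powr \<alpha>" using \<epsilon> x0 by (simp add: p_def powr_minus field_simps)
          then have "c powr (\<beta> / \<alpha>) \<le> (x powr \<alpha>) powr (\<beta> / \<alpha>)"
            using c \<alpha> \<beta> by (intro powr_mono2) auto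
          also have "\<dots> = x powr \<beta>" using \<alpha> by (simp add: powr_powr)
          finally have "1 \<le> c powr - (\<beta> / \<alpha>) * x powr \<beta>" using c by (simp add: powr_minus field_simps)
          moreover have "g \<epsilon> x \<le> 2" using g_mono[of \<epsilon> x 1] \<epsilon> x by simp
          ultimately have "g \<epsilon> x \<le> 4 * c powr - (\<beta> / \<alpha>) * x powr \<beta>" by simp
          also have "\<dots> \<le> K * (x powr \<beta> + \<epsilon> powr (\<beta> / \<alpha>))"
            using t0 C1 K by (auto simp: K_def distrib_right distrib_left intro!: add_nonneg_nonneg)
          finally show ?thesis .
        qed
      qed
      show ?case
      proof (intro allI impI)
        fix x :: real assume x: "0 \<le> x \<and> x \<le> 1"
        show "g \<epsilon> x \<le> 2 * K * (x powr \<beta> + \<epsilon> powr (\<beta> / \<alpha>))"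
        proof (cases "\<epsilon> powr (1 / \<alpha>) \<le> x")
          case True
          have "K * (x powr \<beta> + \<epsilon> powr (\<beta> / \<alpha>)) \<le> 2 * K * (x powr \<beta> + \<epsilon> powr (\<beta> / \<alpha>))"
            using K by (intro mult_right_mono) auto
          then show ?thesis using main[OF True] x by linarith
        next
          case False
          have e1: "\<epsilon> powr (1 / \<alpha>) \<le> 1" using \<epsilon> \<alpha> by (intro powr_le1) auto
          have "g \<epsilon> x \<le> g \<epsilon> (\<epsilon> powr (1 / \<alpha>))" using False \<epsilon> by (intro g_mono) auto
          also have "\<dots> \<le> K * ((\<epsilon> powr (1 / \<alpha>)) powr \<beta> + \<epsilon> powr (\<beta> / \<alpha>))" by (rule main[OF order_refl e1])
          also have "\<dots> = 2 * K * \<epsilon> powr (\<beta> / \<alpha>)" by (simp add: powr_powr)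
          also have "\<dots> \<le> 2 * K * (x powr \<beta> + \<epsilon> powr (\<beta> / \<alpha>))" using K by (intro mult_left_mono) auto
          finally show ?thesis .
        qed
      qed
    qed
  qed (use K in simp)
qed

end

section \<open>Small increments of the paths are negligible\<close>

text \<open>After division by \<open>u + v\<close> this is \<open>t \<le> t powr \<beta>\<close> on the unit interval.\<close>

lemma powr_subadditive:
  fixes u v :: real
  assumes "0 \<le> u" "0 \<le> v" "0 < \<beta>" "\<beta> \<le> 1"
  shows "(u + v) powr \<beta> \<le> u powr \<beta> + v powr \<beta>"
proof (cases "u + v = 0")
  case False
  then have s: "0 < u + v" using assms by simp
  have le: "t \<le> t powr \<beta>" if "0 \<le> t" "t \<le> 1" for t :: real
    using powr_mono'[of \<beta> 1 t] that assms by simp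
  have "1 = u / (u + v) + v / (u + v)" using s by (simp add: add_divide_distrib[symmetric])
  also have "\<dots> \<le> (u / (u + v)) powr \<beta> + (v / (u + v)) powr \<beta>"
    using assms s by (intro add_mono le) auto
  also have "\<dots> = (u powr \<beta> + v powr \<beta>) / (u + v) powr \<beta>"
    using assms s by (simp add: powr_divide add_divide_distrib)
  finally show ?thesis using s by (simp add: field_simps)
qed (use assms in simp)

lemma truncated_powr_subadditive:
  fixes x y :: real
  assumes "0 \<le> x" "0 \<le> y" "0 < \<delta>" "0 < \<beta>" "\<beta> \<le> 1"
  shows "min (x + y) \<delta> powr \<beta> \<le> min x \<delta> powr \<beta> + min y \<delta> powr \<beta>"
proof -
  have "min (x + y) \<delta> powr \<beta> \<le> (min x \<delta> + min y \<delta>) powr \<beta>"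
    using assms by (intro powr_mono2) (auto simp: min_def)
  also have "\<dots> \<le> min x \<delta> powr \<beta> + min y \<delta> powr \<beta>"
    using assms by (intro powr_subadditive) auto
  finally show ?thesis .
qed

lemma subadditive_increment_le_sum:
  fixes F :: "int \<Rightarrow> real" and \<phi> :: "real \<Rightarrow> real"
  assumes "mono F" and "\<phi> 0 = 0" and sub: "\<And>x y. 0 \<le> x \<Longrightarrow> 0 \<le> y \<Longrightarrow> \<phi> (x + y) \<le> \<phi> x + \<phi> y"
    and "p \<le> q"
  shows "\<phi> (F q - F p) \<le> (\<Sum>j\<in>{p..<q}. \<phi> (F (j + 1) - F j))"
  using \<open>p \<le> q\<close>
proof (induction q rule: int_ge_induct)
  case base
  then show ?case using assms(2) by simp
next
  case (step q)
  have "\<phi> (F (q + 1) - F p) = \<phi> ((F q - F p) + (F (q + 1) - F q))" by simp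
  also have "\<dots> \<le> \<phi> (F q - F p) + \<phi> (F (q + 1) - F q)"
    using step.hyps monoD[OF assms(1)] by (intro sub) auto
  also have "\<dots> \<le> (\<Sum>j\<in>{p..<q}. \<phi> (F (j + 1) - F j)) + \<phi> (F (q + 1) - F q)"
    using step.IH by simp
  also have "\<dots> = (\<Sum>j\<in>insert q {p..<q}. \<phi> (F (j + 1) - F j))" by simp
  also have "insert q {p..<q} = {p..<q + 1}" using step.hyps by auto
  finally show ?case .
qed

text \<open>The map \<open>k\<close> selects the points of the coarse mesh among those of the fine one.\<close>

lemma subadditive_coarse_le_fine:
  fixes F :: "int \<Rightarrow> real" and \<phi> :: "real \<Rightarrow> real" and k :: "int \<Rightarrow> int"
  assumes "mono F" and "\<phi> 0 = 0" and sub: "\<And>x y. 0 \<le> x \<Longrightarrow> 0 \<le> y \<Longrightarrow> \<phi> (x + y) \<le> \<phi> x + \<phi> y"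
    and "mono k" and "a \<le> b"
  shows "(\<Sum>i\<in>{a..<b}. \<phi> (F (k (i + 1)) - F (k i))) \<le> (\<Sum>j\<in>{k a..<k b}. \<phi> (F (j + 1) - F j))"
  using \<open>a \<le> b\<close>
proof (induction b rule: int_ge_induct)
  case (step b)
  have k: "k a \<le> k b" "k b \<le> k (b + 1)" using step.hyps monoD[OF \<open>mono k\<close>] by auto
  have "{a..<b + 1} = insert b {a..<b}" using step.hyps by auto
  then have "(\<Sum>i\<in>{a..<b + 1}. \<phi> (F (k (i + 1)) - F (k i))) =
      (\<Sum>i\<in>{a..<b}. \<phi> (F (k (i + 1)) - F (k i))) + \<phi> (F (k (b + 1)) - F (k b))" by simp
  also have "\<dots> \<le> (\<Sum>j\<in>{k a..<k b}. \<phi> (F (j + 1) - F j)) + (\<Sum>j\<in>{k b..<k (b + 1)}. \<phi> (F (j + 1) - F j))"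
    by (intro add_mono step.IH subadditive_increment_le_sum assms k)
  also have "\<dots> = (\<Sum>j\<in>{k a..<k (b + 1)}. \<phi> (F (j + 1) - F j))"
    using k by (subst sum.union_disjoint[symmetric]) (auto simp: ivl_disj_un)
  finally show ?case .
qed simp

text \<open>With the absolute value the moment bound for increments applies to each term before the null set
  of paths that are not monotone is discarded.\<close>

definition dyadic_sum :: "real \<Rightarrow> real \<Rightarrow> nat \<Rightarrow> (real \<Rightarrow> real) \<Rightarrow> nat \<Rightarrow> real" where
  "dyadic_sum \<beta> \<delta> K v n =
     (\<Sum>j\<in>{- (int K * 2 ^ n)..<int K * 2 ^ n}. min \<bar>v ((of_int j + 1) / 2 ^ n) - v
         (of_int j / 2 ^ n)\<bar> \<delta> powr \<beta>)"

lemma mono_dyadic_sum_eq: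
  assumes "mono v"
  shows "dyadic_sum \<beta> \<delta> K v n =
     (\<Sum>j\<in>{- (int K * 2 ^ n)..<int K * 2 ^ n}. min
         (v ((of_int j + 1) / 2 ^ n) - v (of_int j / 2 ^ n)) \<delta> powr \<beta>)"
  unfolding dyadic_sum_def
  using monoD[OF assms] by (intro sum.cong refl) (simp add: divide_right_mono)

lemma incseq_dyadic_sum:
  assumes v: "mono v" and "0 < \<delta>" "0 < \<beta>" "\<beta> \<le> 1"
  shows "incseq (dyadic_sum \<beta> \<delta> K v)"
proof (rule incseq_SucI)
  fix n
  define F where "F = (\<lambda>j::int. v (of_int j / 2 ^ Suc n))"
  have "mono F" unfolding F_def using v by (intro monoI monoD[OF v]) (simp add: divide_right_mono)
  have "dyadic_sum \<beta> \<delta> K v n = (\<Sum>i\<in>{- (int K * 2 ^ n)..<int K * 2 ^ n}. min (F (2 * (i + 1)) -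
      F (2 * i)) \<delta> powr \<beta>)"
  proof -
    have "F (2 * (i + 1)) = v ((of_int i + 1) / 2 ^ n)" "F (2 * i) = v (of_int i / 2 ^ n)" for i
      unfolding F_def by (rule arg_cong[where f=v], simp add: field_simps)+
    then show ?thesis unfolding mono_dyadic_sum_eq[OF v] by simp
  qed
  also have "\<dots> \<le> (\<Sum>j\<in>{2 * - (int K * 2 ^ n)..<2 * (int K * 2 ^ n)}. min (F (j + 1) - F j) \<delta> powr \<beta>)"
    using assms \<open>mono F\<close>
    by (intro subadditive_coarse_le_fine[where k="\<lambda>i. 2 * i" and \<phi>="\<lambda>x. min x \<delta> powr \<beta>"]
      truncated_powr_subadditive) (auto simp: mono_def)
  also have "\<dots> = dyadic_sum \<beta> \<delta> K v (Suc n)"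
    unfolding mono_dyadic_sum_eq[OF v] F_def by (intro sum.cong) (auto simp: mult_ac)
  finally show "dyadic_sum \<beta> \<delta> K v n \<le> dyadic_sum \<beta> \<delta> K v (Suc n)" .
qed

lemma right_cont_tendsto:
  fixes v :: "real \<Rightarrow> real"
  assumes "continuous (at_right x) v" "\<And>n. x \<le> y n" "y \<longlonglongrightarrow> x"
  shows "(\<lambda>n. v (y n)) \<longlonglongrightarrow> v x"
proof -
  have "at x within {x..} = at_right x"
    unfolding at_within_def by (intro arg_cong2[where f=inf] arg_cong[where f=principal] refl) auto
  then have "continuous (at x within {x..}) v" using assms(1) by (simp add: continuous_within)
  then show ?thesis
    using assms(2,3) unfolding continuous_within_sequentially by (auto simp: comp_def)
qed

text \<open>The increments of \<open>v\<close> over a mesh are limits of increments between dyadic points, for which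
  subadditivity gives the bound.\<close>

lemma mesh_sum_le_dyadic:
  assumes v: "mono v" and rc: "\<And>x. continuous (at_right x) v" and \<delta>\<beta>: "0 < \<delta>" "0 < \<beta>" "\<beta> \<le> 1"
    and S: "\<And>n. dyadic_sum \<beta> \<delta> K v n \<le> S"
    and \<epsilon>: "0 < \<epsilon>" and ab: "a \<le> b" "- real K \<le> \<epsilon> * of_int a" "\<epsilon> * of_int b \<le> real K"
  shows "(\<Sum>i\<in>{a..<b}. min (v (\<epsilon> * (of_int i + 1)) - v (\<epsilon> * of_int i)) \<delta> powr \<beta>) \<le> S"
proof -
  \<comment> \<open>Rounding up approximates the mesh points by dyadic ones from the right, the side on which the
    path is continuous.\<close>
  define k where "k = (\<lambda>(n::nat) (i::int). \<lceil>2 ^ n * (\<epsilon> * of_int i)\<rceil>)"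
  define d where "d = (\<lambda>n i. of_int (k n i) / (2::real) ^ n)"
  have d: "\<epsilon> * of_int i \<le> d n i" "d n i \<le> \<epsilon> * of_int i + (1/2) ^ n" for n i
  proof -
    have "2 ^ n * (\<epsilon> * of_int i) \<le> of_int (k n i)" "of_int (k n i) \<le> 2 ^ n * (\<epsilon> * of_int i) + 1"
      unfolding k_def by linarith+
    then show "\<epsilon> * of_int i \<le> d n i" "d n i \<le> \<epsilon> * of_int i + (1/2) ^ n"
      by (simp_all add: d_def field_simps power_one_over)
  qed
  have lim: "(\<lambda>n. v (d n i)) \<longlonglongrightarrow> v (\<epsilon> * of_int i)" for i
  proof (rule right_cont_tendsto[OF rc])
    show "(\<lambda>n. d n i) \<longlonglongrightarrow> \<epsilon> * of_int i"
    proof (rule tendsto_sandwich[where f="\<lambda>_. \<epsilon> * of_int i"])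
      show "(\<lambda>n. \<epsilon> * of_int i + (1/2) ^ n) \<longlonglongrightarrow> \<epsilon> * of_int i"
        using tendsto_add[OF tendsto_const LIMSEQ_realpow_zero[of "1/2"]] by simp
    qed (use d in auto)
  qed (rule d)
  have "(\<lambda>n. \<Sum>i\<in>{a..<b}. min (v (d n (i + 1)) - v (d n i)) \<delta> powr \<beta>) \<longlonglongrightarrow>
     (\<Sum>i\<in>{a..<b}. min (v (\<epsilon> * of_int (i + 1)) - v (\<epsilon> * of_int i)) \<delta> powr \<beta>)"
  proof -
    have "d n i \<le> d n (i + 1)" for n i
      unfolding d_def k_def using \<epsilon> by (intro divide_right_mono) (auto intro!: ceiling_mono)
    then have "0 \<le> v (d n (i + 1)) - v (d n i)" for n i
      using monoD[OF v] by simp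
    then show ?thesis
      using \<delta>\<beta> by (intro tendsto_sum tendsto_powr' tendsto_min tendsto_diff lim tendsto_const)
        (auto intro!: always_eventually)
  qed
  moreover have "(\<Sum>i\<in>{a..<b}. min (v (d n (i + 1)) - v (d n i)) \<delta> powr \<beta>) \<le> S" for n
  proof -
    define F where "F = (\<lambda>j::int. v (of_int j / 2 ^ n))"
    have "mono F" unfolding F_def using v by (intro monoI monoD[OF v]) (simp add: divide_right_mono)
    have "mono (k n)" unfolding k_def using \<epsilon> by (intro monoI ceiling_mono) simp
    have "(\<Sum>i\<in>{a..<b}. min (v (d n (i + 1)) - v (d n i)) \<delta> powr \<beta>) =
        (\<Sum>i\<in>{a..<b}. min (F (k n (i + 1)) - F (k n i)) \<delta> powr \<beta>)"
      by (simp add: F_def d_def)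
    also have "\<dots> \<le> (\<Sum>j\<in>{k n a..<k n b}. min (F (j + 1) - F j) \<delta> powr \<beta>)"
      using \<delta>\<beta> by (intro subadditive_coarse_le_fine[where \<phi>="\<lambda>x. min x \<delta> powr \<beta>"]
          truncated_powr_subadditive \<open>mono F\<close> \<open>mono (k n)\<close> ab) auto
    also have "\<dots> \<le> (\<Sum>j\<in>{- (int K * 2 ^ n)..<int K * 2 ^ n}. min (F (j + 1) - F j) \<delta> powr \<beta>)"
    proof (rule sum_mono2)
      have "2 ^ n * - real K \<le> 2 ^ n * (\<epsilon> * of_int a)" "2 ^ n * (\<epsilon> * of_int b) \<le> 2 ^ n * real K"
        using ab by (intro mult_left_mono; simp)+
      then have "- (int K * 2 ^ n) \<le> k n a" "k n b \<le> int K * 2 ^ n"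
        unfolding k_def by (simp_all add: le_ceiling_iff ceiling_le_iff mult.commute)
      then show "{k n a..<k n b} \<subseteq> {- (int K * 2 ^ n)..<int K * 2 ^ n}" by auto
    qed auto
    also have "\<dots> = dyadic_sum \<beta> \<delta> K v n"
      unfolding mono_dyadic_sum_eq[OF v] F_def by simp
    also have "\<dots> \<le> S" by (rule S)
    finally show ?thesis .
  qed
  ultimately have "(\<Sum>i\<in>{a..<b}. min (v (\<epsilon> * of_int (i + 1)) - v (\<epsilon> * of_int i)) \<delta> powr \<beta>) \<le> S"
    by (intro tendsto_upperbound) (auto intro!: always_eventually)
  then show ?thesis by simp
qed

text \<open>An increment above \<open>\<delta>\<close> contributes \<open>\<delta> powr \<beta>\<close> to the sum, so the condition controls both the
    number of such
  increments and the \<open>\<beta>\<close>-th powers of the others, uniformly over all meshes.\<close>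

definition negligible_small_increments :: "real \<Rightarrow> (real \<Rightarrow> real) \<Rightarrow> bool" where
  "negligible_small_increments \<beta> v \<longleftrightarrow> (\<forall>K::nat. \<forall>\<eta>>0. \<exists>\<delta>. 0 < \<delta> \<and> \<delta> \<le> 1 \<and>
     (\<forall>\<epsilon>>0. \<forall>a b. a \<le> b \<longrightarrow> - real K \<le> \<epsilon> * of_int a \<longrightarrow> \<epsilon> * of_int b \<le> real K \<longrightarrow>
       (\<Sum>i\<in>{a..<b}. min (v (\<epsilon> * (of_int i + 1)) - v (\<epsilon> * of_int i)) \<delta> powr \<beta>) \<le> \<eta>))"

context stable_process
begin

text \<open>The supremum over the dyadic sums is a monotone limit, so its expectation is at most of order
  \<open>\<delta> powr (\<beta> - \<alpha>)\<close>. It decreases with \<open>\<delta>\<close>, and the infimum over \<open>\<delta> = 1 / (m + 1)\<close> has expectation 0.\<close>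

lemma paths_negligible_small_increments:
  assumes \<beta>: "\<alpha> < \<beta>" "\<beta> \<le> 1"
  shows "AE \<omega> in N. negligible_small_increments \<beta> (\<lambda>x. V x \<omega>)"
proof -
  have \<beta>0: "0 < \<beta>" using \<beta> \<alpha> by simp
  obtain C where C: "C \<ge> 0" "\<And>x y \<delta>. x < y \<Longrightarrow> 0 < \<delta> \<Longrightarrow>
     (\<integral>\<^sup>+ \<omega>. ennreal (min \<bar>V y \<omega> - V x \<omega>\<bar> \<delta> powr \<beta>) \<partial>N) \<le> ennreal (C * (y - x) * \<delta> powr (\<beta> - \<alpha>))"
    using truncated_increment_moment[OF \<beta>(1)] by auto
  define D where "D = (\<lambda>\<delta> K n \<omega>. dyadic_sum \<beta> \<delta> K (\<lambda>x. V x \<omega>) n)"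
  have [measurable]: "D \<delta> K n \<in> borel_measurable N" for \<delta> K n
    unfolding D_def dyadic_sum_def by measurable
  have ED: "(\<integral>\<^sup>+ \<omega>. ennreal (D \<delta> K n \<omega>) \<partial>N) \<le> ennreal (2 * real K * C * \<delta> powr (\<beta> - \<alpha>))" if "0 < \<delta>"
      for \<delta> K n
  proof -
    have "(\<integral>\<^sup>+ \<omega>. ennreal (D \<delta> K n \<omega>) \<partial>N) =
      (\<Sum>j\<in>{- (int K * 2 ^ n)..<int K * 2 ^ n}. \<integral>\<^sup>+ \<omega>. ennreal
          (min \<bar>V ((of_int j + 1) / 2 ^ n) \<omega> - V (of_int j / 2 ^ n) \<omega>\<bar> \<delta> powr \<beta>) \<partial>N)"
      unfolding D_def dyadic_sum_def by (subst nn_integral_sum[symmetric]) (auto simp: sum_ennreal)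
    also have "\<dots> \<le> (\<Sum>j\<in>{- (int K * 2 ^ n)..<int K * 2 ^ n}. ennreal (C *
        ((of_int j + 1) / 2 ^ n - of_int j / 2 ^ n) * \<delta> powr (\<beta> - \<alpha>)))"
      using that by (intro sum_mono C(2)) (simp_all add: divide_strict_right_mono)
    also have "\<dots> = (\<Sum>j\<in>{- (int K * 2 ^ n)..<int K * 2 ^ n}. ennreal (C * (1 / 2 ^ n) * \<delta> powr (\<beta> - \<alpha>)))"
      by (simp add: diff_divide_distrib[symmetric])
    also have "\<dots> = ennreal (2 * real K * C * \<delta> powr (\<beta> - \<alpha>))"
      using C(1) by (subst sum_ennreal) auto
    finally show ?thesis .
  qed
  define S where "S = (\<lambda>\<delta> K \<omega>. SUP n. ennreal (D \<delta> K n \<omega>))"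
  have [measurable]: "S \<delta> K \<in> borel_measurable N" for \<delta> K
    unfolding S_def by measurable
  have ES: "(\<integral>\<^sup>+ \<omega>. S \<delta> K \<omega> \<partial>N) \<le> ennreal (2 * real K * C * \<delta> powr (\<beta> - \<alpha>))" if "0 < \<delta>" for \<delta> K
  proof -
    have "(\<integral>\<^sup>+ \<omega>. S \<delta> K \<omega> \<partial>N) = (SUP n. \<integral>\<^sup>+ \<omega>. ennreal (D \<delta> K n \<omega>) \<partial>N)"
      unfolding S_def
    proof (rule nn_integral_monotone_convergence_SUP_AE)
      fix n
      show "AE \<omega> in N. ennreal (D \<delta> K n \<omega>) \<le> ennreal (D \<delta> K (Suc n) \<omega>)"
        using paths_mono
        by eventually_elim (use incseq_dyadic_sum[OF _ that \<beta>0 \<beta>(2)] in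
          \<open>auto simp: D_def incseq_Suc_iff intro!: ennreal_leI\<close>)
    qed measurable
    also have "\<dots> \<le> ennreal (2 * real K * C * \<delta> powr (\<beta> - \<alpha>))" by (intro SUP_least ED that)
    finally show ?thesis .
  qed
  have inf0: "AE \<omega> in N. (INF m. S (1 / real (Suc m)) K \<omega>) = 0" for K
  proof -
    have "(\<integral>\<^sup>+ \<omega>. (INF m. S (1 / real (Suc m)) K \<omega>) \<partial>N) \<le>
        ennreal (2 * real K * C * (1 / real (Suc m)) powr (\<beta> - \<alpha>))" for m
      by (rule order_trans[OF nn_integral_mono ES]) (auto intro: INF_lower)
    moreover have "(\<lambda>m. ennreal (2 * real K * C * (1 / real (Suc m)) powr (\<beta> - \<alpha>))) \<longlonglongrightarrow>
        ennreal (2 * real K * C * 0)"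
    proof (intro tendsto_ennrealI tendsto_mult tendsto_const)
      show "(\<lambda>m. (1 / real (Suc m)) powr (\<beta> - \<alpha>)) \<longlonglongrightarrow> 0" using \<beta> by real_asymp
    qed
    ultimately have "(\<integral>\<^sup>+ \<omega>. (INF m. S (1 / real (Suc m)) K \<omega>) \<partial>N) \<le> ennreal (2 * real K * C * 0)"
      by (intro tendsto_lowerbound) (auto intro!: always_eventually)
    then have "(\<integral>\<^sup>+ \<omega>. (INF m. S (1 / real (Suc m)) K \<omega>) \<partial>N) = 0" by simp
    then show ?thesis by (subst (asm) nn_integral_0_iff_AE) auto
  qed
  have "AE \<omega> in N. \<forall>K. (INF m. S (1 / real (Suc m)) K \<omega>) = 0"
    unfolding AE_all_countable using inf0 by blast
  then show ?thesis
    using paths_mono AE_space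
  proof eventually_elim
    case (elim \<omega>)
    show ?case
      unfolding negligible_small_increments_def
    proof (intro allI impI)
      fix K :: nat and \<eta> :: real assume \<eta>: "0 < \<eta>"
      have "(INF m. S (1 / real (Suc m)) K \<omega>) < ennreal \<eta>" using elim(1) \<eta> by simp
      then obtain m where m: "S (1 / real (Suc m)) K \<omega> < ennreal \<eta>" by (auto simp: INF_less_iff)
      have D_le: "D (1 / real (Suc m)) K n \<omega> \<le> \<eta>" for n
      proof -
        have "ennreal (D (1 / real (Suc m)) K n \<omega>) \<le> S (1 / real (Suc m)) K \<omega>"
          unfolding S_def by (rule SUP_upper) simp
        then have "ennreal (D (1 / real (Suc m)) K n \<omega>) \<le> ennreal \<eta>" using m by simp
        then show ?thesis using \<eta> by (subst (asm) ennreal_le_iff) auto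
      qed
      show "\<exists>\<delta>>0. \<delta> \<le> 1 \<and> (\<forall>\<epsilon>>0. \<forall>a b. a \<le> b \<longrightarrow> - real K \<le> \<epsilon> * of_int a \<longrightarrow> \<epsilon> * of_int b \<le> real K \<longrightarrow>
        (\<Sum>i\<in>{a..<b}. min (V (\<epsilon> * (of_int i + 1)) \<omega> - V (\<epsilon> * of_int i) \<omega>) \<delta> powr \<beta>) \<le> \<eta>)"
      proof (intro exI[of _ "1 / real (Suc m)"] conjI allI impI)
        fix \<epsilon> :: real and a b :: int
        assume "0 < \<epsilon>" "a \<le> b" "- real K \<le> \<epsilon> * of_int a" "\<epsilon> * of_int b \<le> real K"
        then show "(\<Sum>i\<in>{a..<b}. min (V (\<epsilon> * (of_int i + 1)) \<omega> -
            V (\<epsilon> * of_int i) \<omega>) (1 / real (Suc m)) powr \<beta>) \<le> \<eta>"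
          using elim(2,3) \<beta>0 \<beta> D_le right_continuous[OF elim(3)]
          by (intro mesh_sum_le_dyadic[where v="\<lambda>x. V x \<omega>" and K=K]) (auto simp: D_def)
      qed auto
    qed
  qed
qed

end

section \<open>Deterministic convergence of mesh approximations\<close>

lemma integral_point_mass_sum:
  fixes f :: "real \<Rightarrow> real"
  assumes [measurable]: "f \<in> borel_measurable borel" and w: "\<And>i. 0 \<le> w i"
    and A: "finite A" "\<And>i. i \<notin> A \<Longrightarrow> f (y i) = 0"
  shows "(\<integral>x. f x \<partial>point_mass_sum w y) = (\<Sum>i\<in>A. w i * f (y i))"
proof -
  have "(\<integral>x. f x \<partial>point_mass_sum w y) = (\<integral>i. f (y i) \<partial>density (count_space UNIV) (\<lambda>i. ennreal (w i)))"
    unfolding point_mass_sum_def by (rule integral_distr) auto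
  also have "\<dots> = (\<integral>i. w i * f (y i) \<partial>count_space UNIV)"
    using w by (subst integral_density) auto
  also have "\<dots> = (\<Sum>i | i \<in> UNIV \<and> w i * f (y i) \<noteq> 0. w i * f (y i))"
    by (rule lebesgue_integral_count_space_finite_support) (rule finite_subset[OF _ A(1)], use A(2) in auto)
  also have "\<dots> = (\<Sum>i\<in>A. w i * f (y i))"
    using A by (intro sum.mono_neutral_left) auto
  finally show ?thesis .
qed

lemma measure_point_mass_sum_singleton:
  assumes "inj y" "\<And>i. 0 \<le> w i"
  shows "measure (point_mass_sum w y) {y i} = w i"
    and "z \<notin> range y \<Longrightarrow> measure (point_mass_sum w y) {z} = 0"
proof -
  have eq: "emeasure (point_mass_sum w y) {z} =
      emeasure (density (count_space UNIV) (\<lambda>i. ennreal (w i))) (y -` {z})" for z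
    unfolding point_mass_sum_def by (subst emeasure_distr) auto
  have "y -` {y i} = {i}" using assms(1) by (auto dest: injD)
  then have "emeasure (point_mass_sum w y) {y i} =
      (\<integral>\<^sup>+ j. ennreal (w j) * indicator {i} j \<partial>count_space UNIV)"
    unfolding eq by (subst emeasure_density) auto
  also have "\<dots> = ennreal (w i)" by (simp add: nn_integral_indicator_singleton' flip: one_ennreal_def)
  finally show "measure (point_mass_sum w y) {y i} = w i" using assms(2) by (simp add: measure_def)
  show "measure (point_mass_sum w y) {z} = 0" if "z \<notin> range y"
  proof -
    have "y -` {z} = {}" using that by auto
    then show ?thesis using eq[of z] by (simp add: measure_def)
  qed
qed

text \<open>A fixed path \<open>v\<close> and the properties of the transfer functions on which the convergence rests. The
  condition \<open>1 < \<kappa>\<close> makes the error \<open>\<epsilon> powr \<kappa>\<close> negligible after summation over the order of \<open>1 / \<epsilon>\<close> cells.\<close>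

locale mesh_approximation =
  fixes v :: "real \<Rightarrow> real" and g :: "real \<Rightarrow> real \<Rightarrow> real" and \<beta> \<kappa> :: real
  assumes v_mono: "mono v" and v_right_cont: "\<And>x. continuous (at_right x) v"
    and \<beta>: "0 < \<beta>" "\<beta> \<le> 1" and \<kappa>: "1 < \<kappa>"
    and small: "negligible_small_increments \<beta> v"
    and g_mono: "\<And>\<epsilon> x y. 0 < \<epsilon> \<Longrightarrow> \<epsilon> < 1 \<Longrightarrow> x \<le> y \<Longrightarrow> g \<epsilon> x \<le> g \<epsilon> y"
    and g_nonneg: "\<And>\<epsilon> x. 0 < \<epsilon> \<Longrightarrow> \<epsilon> < 1 \<Longrightarrow> 0 \<le> g \<epsilon> x"
    and g_tendsto: "\<And>x. 0 \<le> x \<Longrightarrow> ((\<lambda>\<epsilon>. g \<epsilon> x) \<longlongrightarrow> x) (at_right 0)"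
    and g_bound: "\<exists>C\<ge>0. \<forall>\<^sub>F \<epsilon> in at_right 0. \<forall>x. 0 \<le> x \<and> x \<le> 1 \<longrightarrow> g \<epsilon> x \<le> C * (x powr \<beta> + \<epsilon> powr \<kappa>)"
begin

definition incr :: "real \<Rightarrow> int \<Rightarrow> real" where
  "incr \<epsilon> i = v (\<epsilon> * (of_int i + 1)) - v (\<epsilon> * of_int i)"

definition \<rho> :: "real measure" where "\<rho> = interval_measure v"

definition \<rho>e :: "real \<Rightarrow> real measure" where
  "\<rho>e \<epsilon> = point_mass_sum (\<lambda>i. g \<epsilon> (incr \<epsilon> i)) (\<lambda>i. \<epsilon> * of_int i)"

lemma eps_small: "\<forall>\<^sub>F \<epsilon> in at_right (0::real). 0 < \<epsilon> \<and> \<epsilon> < r" if "0 < r" for r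
  using that by (auto simp: eventually_at_right_field)

lemma incr_nonneg: "0 < \<epsilon> \<Longrightarrow> 0 \<le> incr \<epsilon> i"
  unfolding incr_def using monoD[OF v_mono, of "\<epsilon> * of_int i" "\<epsilon> * (of_int i + 1)"] by simp

lemma sets_\<rho> [simp, measurable_cong]: "sets \<rho> = sets borel" and space_\<rho> [simp]: "space \<rho> = UNIV"
  by (simp_all add: \<rho>_def)

lemma emeasure_Ioc: "a \<le> b \<Longrightarrow> emeasure \<rho> {a<..b} = ennreal (v b - v a)"
  unfolding \<rho>_def using monoD[OF v_mono] v_right_cont by (intro emeasure_interval_measure_Ioc)

lemma measure_Ioc: "a \<le> b \<Longrightarrow> measure \<rho> {a<..b} = v b - v a"
  using emeasure_Ioc[of a b] monoD[OF v_mono, of a b] by (simp add: measure_def)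

lemma measure_mono_bounded:
  assumes "A \<subseteq> B" "B \<subseteq> {a<..b}" "A \<in> sets borel" "B \<in> sets borel" "a \<le> b"
  shows "measure \<rho> A \<le> measure \<rho> B"
proof (rule measure_mono_fmeasurable)
  have "emeasure \<rho> B \<le> emeasure \<rho> {a<..b}" using assms by (intro emeasure_mono) auto
  also have "\<dots> < \<infinity>" using assms by (simp add: emeasure_Ioc)
  finally show "B \<in> fmeasurable \<rho>" using assms by (auto intro: fmeasurableI)
qed (use assms in auto)

text \<open>Pointwise convergence of monotone functions to a continuous one is locally uniform: it suffices to
  control a finite grid.\<close>

lemma g_uniform:
  assumes "0 < \<eta>"
  shows "\<forall>\<^sub>F \<epsilon> in at_right 0. \<forall>x. 0 \<le> x \<and> x \<le> W \<longrightarrow> \<bar>g \<epsilon> x - x\<bar> \<le> \<eta>"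
proof -
  define h where "h = \<eta> / 2"
  define n where "n = nat \<lceil>W / h\<rceil> + 1"
  have h: "0 < h" using assms by (simp add: h_def)
  have "\<forall>\<^sub>F \<epsilon> in at_right 0. \<forall>j\<in>{..n}. \<bar>g \<epsilon> (real j * h) - real j * h\<bar> < h"
  proof (rule eventually_ball_finite, simp, rule ballI)
    fix j
    have "((\<lambda>\<epsilon>. g \<epsilon> (real j * h)) \<longlongrightarrow> real j * h) (at_right 0)" using h by (intro g_tendsto) simp
    from tendstoD[OF this h] show "\<forall>\<^sub>F \<epsilon> in at_right 0. \<bar>g \<epsilon> (real j * h) - real j * h\<bar> < h"
      by (simp add: dist_real_def)
  qed
  with eps_small[of 1, simplified] show ?thesis
  proof eventually_elim
    case (elim \<epsilon>)
    show ?case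
    proof (intro allI impI)
      fix x assume x: "0 \<le> x \<and> x \<le> W"
      define j where "j = nat \<lfloor>x / h\<rfloor>"
      have "0 \<le> x / h" using x h by simp
      then have "real j \<le> x / h" "x / h < real j + 1" by (simp_all add: j_def)
      then have j: "real j * h \<le> x" "x \<le> real (Suc j) * h" using h by (auto simp: field_simps)
      have "x / h \<le> W / h" using x h by (intro divide_right_mono) auto
      then have "Suc j \<le> n" unfolding n_def j_def using \<open>0 \<le> x / h\<close> by linarith
      then have "\<bar>g \<epsilon> (real j * h) - real j * h\<bar> < h" "\<bar>g \<epsilon> (real (Suc j) * h) - real (Suc j) * h\<bar> < h"
        using bspec[OF elim(2), of j] bspec[OF elim(2), of "Suc j"] by simp_all
      moreover have "g \<epsilon> (real j * h) \<le> g \<epsilon> x" "g \<epsilon> x \<le> g \<epsilon> (real (Suc j) * h)"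
        using elim(1) j by (auto intro!: g_mono)
      ultimately show "\<bar>g \<epsilon> x - x\<bar> \<le> \<eta>"
        using j by (simp add: h_def abs_if field_simps split: if_splits)
    qed
  qed
qed

text \<open>The indices \<open>i\<close> for which the cell \<open>{\<epsilon> * i<..\<epsilon> * (i + 1)}\<close> of the mesh lies in \<open>{- K..K}\<close>.\<close>

definition cells :: "real \<Rightarrow> nat \<Rightarrow> int set" where
  "cells \<epsilon> K = {\<lceil>- real K / \<epsilon>\<rceil>..<\<lfloor>real K / \<epsilon>\<rfloor>}"

lemma cells_bounds:
  assumes "0 < \<epsilon>"
  shows "\<lceil>- real K / \<epsilon>\<rceil> \<le> \<lfloor>real K / \<epsilon>\<rfloor>" "- real K \<le> \<epsilon> * of_int \<lceil>- real K / \<epsilon>\<rceil>"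
      "\<epsilon> * of_int \<lfloor>real K / \<epsilon>\<rfloor> \<le> real K"
    "real (card (cells \<epsilon> K)) \<le> 2 * real K / \<epsilon>"
    "i \<in> cells \<epsilon> K \<longleftrightarrow> - real K \<le> \<epsilon> * of_int i \<and> \<epsilon> * (of_int i + 1) \<le> real K"
proof -
  have nn: "0 \<le> real K / \<epsilon>" using assms by simp
  then have "\<lceil>- real K / \<epsilon>\<rceil> \<le> 0" "0 \<le> \<lfloor>real K / \<epsilon>\<rfloor>" by (simp_all add: ceiling_le_iff)
  then show le: "\<lceil>- real K / \<epsilon>\<rceil> \<le> \<lfloor>real K / \<epsilon>\<rfloor>" by linarith
  have c: "- real K / \<epsilon> \<le> of_int \<lceil>- real K / \<epsilon>\<rceil>" and f: "of_int \<lfloor>real K / \<epsilon>\<rfloor> \<le> real K / \<epsilon>" by linarith+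
  then show "- real K \<le> \<epsilon> * of_int \<lceil>- real K / \<epsilon>\<rceil>" "\<epsilon> * of_int \<lfloor>real K / \<epsilon>\<rfloor> \<le> real K"
    using mult_left_mono[OF c, of \<epsilon>] mult_left_mono[OF f, of \<epsilon>] assms by simp_all
  have "real (card (cells \<epsilon> K)) = of_int (\<lfloor>real K / \<epsilon>\<rfloor> - \<lceil>- real K / \<epsilon>\<rceil>)"
    using le by (simp add: cells_def)
  also have "\<dots> \<le> real K / \<epsilon> - (- real K / \<epsilon>)" unfolding of_int_diff by (rule diff_mono[OF f c])
  finally show "real (card (cells \<epsilon> K)) \<le> 2 * real K / \<epsilon>" by simp
  have "i < \<lfloor>real K / \<epsilon>\<rfloor> \<longleftrightarrow> i + 1 \<le> \<lfloor>real K / \<epsilon>\<rfloor>" by linarith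
  also have "\<dots> \<longleftrightarrow> of_int i + 1 \<le> real K / \<epsilon>" by (simp add: le_floor_iff)
  finally show "i \<in> cells \<epsilon> K \<longleftrightarrow> - real K \<le> \<epsilon> * of_int i \<and> \<epsilon> * (of_int i + 1) \<le> real K"
    using assms by (simp add: cells_def ceiling_le_iff field_simps)
qed

lemma sum_incr_le:
  assumes "0 < \<epsilon>"
  shows "(\<Sum>i\<in>cells \<epsilon> K. incr \<epsilon> i) \<le> v (real K) - v (- real K)"
proof -
  have tel: "(\<Sum>i\<in>{a..<b}. incr \<epsilon> i) = v (\<epsilon> * of_int b) - v (\<epsilon> * of_int a)" if "a \<le> b" for a b :: int
    using that
  proof (induction b rule: int_ge_induct)
    case (step b)
    have "{a..<b + 1} = insert b {a..<b}" using step.hyps by auto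
    then show ?case using step.IH by (simp add: incr_def)
  qed simp
  show ?thesis
    unfolding cells_def tel[OF cells_bounds(1)[OF assms]]
    using monoD[OF v_mono cells_bounds(2)[OF assms, of K]]
        monoD[OF v_mono cells_bounds(3)[OF assms, of K]] by simp
qed

lemma sum_error_tendsto_0:
  "((\<lambda>\<epsilon>. \<Sum>i\<in>cells \<epsilon> K. \<bar>g \<epsilon> (incr \<epsilon> i) - incr \<epsilon> i\<bar>) \<longlongrightarrow> 0) (at_right 0)"
proof (rule tendstoI)
  fix e :: real assume e: "0 < e"
  obtain C where C: "C \<ge> 0" and bound: "\<forall>\<^sub>F \<epsilon> in at_right 0. \<forall>x. 0 \<le> x \<and> x \<le> 1 \<longrightarrow> g \<epsilon> x \<le>
      C * (x powr \<beta> + \<epsilon> powr \<kappa>)"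
    using g_bound by auto
  define W where "W = v (real K) - v (- real K)"
  have W: "0 \<le> W" using monoD[OF v_mono, of "- real K" "real K"] by (simp add: W_def)
  define \<eta> where "\<eta> = e / (4 * (C + 1))"
  have \<eta>: "0 < \<eta>" using e C by (simp add: \<eta>_def)
  obtain \<delta> where \<delta>: "0 < \<delta>" "\<delta> \<le> 1" and small_\<delta>:
      "\<And>\<epsilon> a b. 0 < \<epsilon> \<Longrightarrow> a \<le> b \<Longrightarrow> - real K \<le> \<epsilon> * of_int a \<Longrightarrow> \<epsilon> * of_int b \<le> real K \<Longrightarrow>
       (\<Sum>i\<in>{a..<b}. min (v (\<epsilon> * (of_int i + 1)) - v (\<epsilon> * of_int i)) \<delta> powr \<beta>) \<le> \<eta>"
    using small[unfolded negligible_small_increments_def, rule_format, OF \<eta>, of K] by blast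
  define \<zeta> where "\<zeta> = e * \<delta> / (4 * (W + 1))"
  have \<zeta>: "0 < \<zeta>" using e W \<delta> by (simp add: \<zeta>_def)
  have "((\<lambda>\<epsilon>. 2 * real K * C * \<epsilon> powr (\<kappa> - 1)) \<longlongrightarrow> 2 * real K * C * 0) (at_right 0)"
  proof (intro tendsto_mult tendsto_const)
    show "((\<lambda>\<epsilon>. \<epsilon> powr (\<kappa> - 1)) \<longlongrightarrow> 0) (at_right 0)" using \<kappa> by real_asymp
  qed
  then have "\<forall>\<^sub>F \<epsilon> in at_right 0. 2 * real K * C * \<epsilon> powr (\<kappa> - 1) < e / 4"
    using e by (intro order_tendstoD) auto
  with eps_small[of 1, simplified] g_uniform[OF \<zeta>, of W] bound
  show "\<forall>\<^sub>F \<epsilon> in at_right 0. dist (\<Sum>i\<in>cells \<epsilon> K. \<bar>g \<epsilon> (incr \<epsilon> i) - incr \<epsilon> i\<bar>) 0 < e"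
  proof eventually_elim
    case (elim \<epsilon>)
    then have \<epsilon>: "0 < \<epsilon>" "\<epsilon> < 1" by auto
    \<comment> \<open>The first term serves the increments above \<open>\<delta>\<close>, where \<open>g \<epsilon>\<close> is uniformly close to the identity;
      the other two serve those below \<open>\<delta>\<close>.\<close>
    have "\<bar>g \<epsilon> (incr \<epsilon> i) - incr \<epsilon> i\<bar> \<le> \<zeta> / \<delta> * incr \<epsilon> i + (C + 1) * min (incr \<epsilon> i) \<delta> powr \<beta> + C * \<epsilon> powr \<kappa>"
      if i: "i \<in> cells \<epsilon> K" for i
    proof -
      have i0: "0 \<le> incr \<epsilon> i" by (rule incr_nonneg[OF \<epsilon>(1)])
      have "- real K \<le> \<epsilon> * of_int i" "\<epsilon> * (of_int i + 1) \<le> real K"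
        using i cells_bounds(5)[OF \<epsilon>(1)] by auto
      then have iW: "incr \<epsilon> i \<le> W"
        unfolding incr_def W_def using monoD[OF v_mono] by (simp add: diff_mono)
      show ?thesis
      proof (cases "incr \<epsilon> i \<le> \<delta>")
        case False
        have "\<bar>g \<epsilon> (incr \<epsilon> i) - incr \<epsilon> i\<bar> \<le> \<zeta>" using elim(2) i0 iW by auto
        also have "\<dots> \<le> \<zeta> / \<delta> * incr \<epsilon> i" using False \<delta> \<zeta> by (simp add: field_simps)
        also have "\<dots> \<le> \<zeta> / \<delta> * incr \<epsilon> i + (C + 1) * min (incr \<epsilon> i) \<delta> powr \<beta> + C * \<epsilon> powr \<kappa>"
          using C by simp
        finally show ?thesis .
      next
        case True
        then have i1: "incr \<epsilon> i \<le> 1" using \<delta> by simp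
        have "incr \<epsilon> i powr 1 \<le> incr \<epsilon> i powr \<beta>" using \<beta> i0 i1 by (intro powr_mono') auto
        then have p: "incr \<epsilon> i \<le> incr \<epsilon> i powr \<beta>" using i0 by simp
        have "\<bar>g \<epsilon> (incr \<epsilon> i) - incr \<epsilon> i\<bar> \<le> g \<epsilon> (incr \<epsilon> i) + incr \<epsilon> i"
          using g_nonneg[OF \<epsilon>] i0 by (simp add: abs_le_iff)
        also have "\<dots> \<le> C * (incr \<epsilon> i powr \<beta> + \<epsilon> powr \<kappa>) + incr \<epsilon> i powr \<beta>"
          using elim(3) i0 i1 p by (intro add_mono) auto
        also have "\<dots> = (C + 1) * min (incr \<epsilon> i) \<delta> powr \<beta> + C * \<epsilon> powr \<kappa>"
          using True by (simp add: algebra_simps)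
        also have "\<dots> \<le> \<zeta> / \<delta> * incr \<epsilon> i + (C + 1) * min (incr \<epsilon> i) \<delta> powr \<beta> + C * \<epsilon> powr \<kappa>"
          using i0 \<zeta> \<delta> by simp
        finally show ?thesis .
      qed
    qed
    then have "(\<Sum>i\<in>cells \<epsilon> K. \<bar>g \<epsilon> (incr \<epsilon> i) - incr \<epsilon> i\<bar>) \<le>
        (\<Sum>i\<in>cells \<epsilon> K. \<zeta> / \<delta> * incr \<epsilon> i + (C + 1) * min (incr \<epsilon> i) \<delta> powr \<beta> + C * \<epsilon> powr \<kappa>)"
      by (rule sum_mono)
    also have "\<dots> = \<zeta> / \<delta> * (\<Sum>i\<in>cells \<epsilon> K. incr \<epsilon> i) + (C + 1) * (\<Sum>i\<in>cells \<epsilon> K. min (incr \<epsilon> i) \<delta> powr \<beta>) +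
        real (card (cells \<epsilon> K)) * (C * \<epsilon> powr \<kappa>)"
      by (simp add: sum.distrib sum_distrib_left)
    also have "\<dots> \<le> \<zeta> / \<delta> * W + (C + 1) * \<eta> + (2 * real K / \<epsilon>) * (C * \<epsilon> powr \<kappa>)"
    proof (intro add_mono mult_left_mono mult_right_mono)
      show "(\<Sum>i\<in>cells \<epsilon> K. incr \<epsilon> i) \<le> W" unfolding W_def by (rule sum_incr_le[OF \<epsilon>(1)])
      show "(\<Sum>i\<in>cells \<epsilon> K. min (incr \<epsilon> i) \<delta> powr \<beta>) \<le> \<eta>"
        unfolding cells_def incr_def by (intro small_\<delta> cells_bounds \<epsilon>)
      show "real (card (cells \<epsilon> K)) \<le> 2 * real K / \<epsilon>" by (rule cells_bounds(4)[OF \<epsilon>(1)])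
    qed (use \<zeta> \<delta> C in auto)
    also have "(2 * real K / \<epsilon>) * (C * \<epsilon> powr \<kappa>) = 2 * real K * C * \<epsilon> powr (\<kappa> - 1)"
      using \<epsilon> by (simp add: powr_diff)
    also have "\<zeta> / \<delta> * W = e / 4 * (W / (W + 1))"
      using W \<delta> by (simp add: \<zeta>_def)
    also have "\<dots> \<le> e / 4 * 1"
      using W e by (intro mult_left_mono) auto
    also have "(C + 1) * \<eta> = e / 4" using C by (simp add: \<eta>_def field_simps)
    finally have "(\<Sum>i\<in>cells \<epsilon> K. \<bar>g \<epsilon> (incr \<epsilon> i) - incr \<epsilon> i\<bar>) < e"
      using elim(4) e by simp
    then show ?case by (simp add: dist_real_def sum_nonneg)
  qed
qed

lemma vague: "vague_convergence \<rho>e \<rho>"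
  unfolding vague_convergence_def
proof (intro allI impI)
  fix f :: "real \<Rightarrow> real"
  assume f: "continuous_on UNIV f \<and> bounded {x. f x \<noteq> 0}"
  then have [measurable]: "f \<in> borel_measurable borel" by (intro borel_measurable_continuous_onI) auto
  obtain R where R: "\<And>x. f x \<noteq> 0 \<Longrightarrow> \<bar>x\<bar> \<le> R" using f by (auto simp: bounded_iff)
  obtain K :: nat where K: "R + 1 \<le> real K"
    using real_arch_simple by blast
  define W where "W = v (real K) - v (- real K)"
  have W: "0 \<le> W" using monoD[OF v_mono, of "- real K" "real K"] by (simp add: W_def)
  have fc: "continuous_on {- real K..real K} f" using f continuous_on_subset by blast
  obtain B where B: "\<And>x. \<bar>f x\<bar> \<le> B" "0 \<le> B"
  proof -
    have "bounded (f ` {- real K..real K})" by (intro compact_imp_bounded compact_continuous_image fc) simp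
    then obtain b where b: "\<And>x. x \<in> {- real K..real K} \<Longrightarrow> \<bar>f x\<bar> \<le> b" unfolding bounded_iff
        by (metis imageI real_norm_def)
    have "\<bar>f x\<bar> \<le> max b 0" for x
      using b[of x] R[of x] K by (cases "f x = 0") (force simp: abs_le_iff)+
    then show thesis using that[of "max b 0"] by simp
  qed
  have unif: "uniformly_continuous_on {- real K..real K} f"
    by (rule compact_uniformly_continuous[OF fc]) simp
  have int_Ioc: "integrable \<rho> (indicat_real {a<..b})" for a b
  proof (rule integrable_real_indicator)
    show "emeasure \<rho> {a<..b} < \<infinity>" by (cases "a \<le> b") (auto simp: emeasure_Ioc)
  qed simp
  have intf: "integrable \<rho> f"
  proof (rule Bochner_Integration.integrable_bound)
    show "integrable \<rho> (\<lambda>x. B * indicat_real {- real K<..real K} x)" using int_Ioc by simp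
    have "norm (f x) \<le> norm (B * indicat_real {- real K<..real K} x)" for x
      using B R[of x] K by (cases "f x = 0") (auto simp: indicator_def)
    then show "AE x in \<rho>. norm (f x) \<le> norm (B * indicat_real {- real K<..real K} x)" by simp
  qed simp
  show "((\<lambda>\<epsilon>. \<integral>x. f x \<partial>\<rho>e \<epsilon>) \<longlongrightarrow> (\<integral>x. f x \<partial>\<rho>)) (at_right 0)"
  proof (rule tendstoI)
    fix e :: real assume e: "0 < e"
    define \<eta> where "\<eta> = e / (2 * (W + 1))"
    have \<eta>: "0 < \<eta>" using e W by (simp add: \<eta>_def)
    obtain d where d: "0 < d" "\<And>x y. x \<in> {- real K..real K} \<Longrightarrow> y \<in> {- real K..real K} \<Longrightarrow> \<bar>x - y\<bar> < d \<Longrightarrow>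
        \<bar>f x - f y\<bar> < \<eta>"
      using unif \<eta> unfolding uniformly_continuous_on_def dist_real_def by (metis abs_minus_commute)
    have "\<forall>\<^sub>F \<epsilon> in at_right 0. dist (\<Sum>i\<in>cells \<epsilon> K. \<bar>g \<epsilon> (incr \<epsilon> i) - incr \<epsilon> i\<bar>) 0 < e / (2 * (B + 1))"
      using e B by (intro tendstoD[OF sum_error_tendsto_0]) simp
    moreover have "0 < min 1 d" using d(1) by simp
    ultimately have "\<forall>\<^sub>F \<epsilon> in at_right 0. (0 < \<epsilon> \<and> \<epsilon> < min 1 d) \<and>
        dist (\<Sum>i\<in>cells \<epsilon> K. \<bar>g \<epsilon> (incr \<epsilon> i) - incr \<epsilon> i\<bar>) 0 < e / (2 * (B + 1))"
      using eventually_conj[OF eps_small] by blast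
    then show "\<forall>\<^sub>F \<epsilon> in at_right 0. dist (\<integral>x. f x \<partial>\<rho>e \<epsilon>) (\<integral>x. f x \<partial>\<rho>) < e"
    proof eventually_elim
      case (elim \<epsilon>)
      then have \<epsilon>: "0 < \<epsilon>" "\<epsilon> < 1" "\<epsilon> < d"
        and err: "(\<Sum>i\<in>cells \<epsilon> K. \<bar>g \<epsilon> (incr \<epsilon> i) - incr \<epsilon> i\<bar>) < e / (2 * (B + 1))"
        by (auto simp: dist_real_def abs_less_iff)
      have fin: "finite (cells \<epsilon> K)" by (simp add: cells_def)
      note in_cells = cells_bounds(5)[OF \<epsilon>(1), of _ K]
      have "f (\<epsilon> * of_int i) = 0" if "i \<notin> cells \<epsilon> K" for i
      proof (rule ccontr)
        assume "f (\<epsilon> * of_int i) \<noteq> 0"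
        then have "\<bar>\<epsilon> * of_int i\<bar> \<le> R" by (rule R)
        then have "i \<in> cells \<epsilon> K" unfolding in_cells using \<epsilon> K by (auto simp: abs_le_iff algebra_simps)
        then show False using that by simp
      qed
      then have I1: "(\<integral>x. f x \<partial>\<rho>e \<epsilon>) = (\<Sum>i\<in>cells \<epsilon> K. g \<epsilon> (incr \<epsilon> i) * f (\<epsilon> * of_int i))"
        unfolding \<rho>e_def using \<epsilon> fin by (intro integral_point_mass_sum g_nonneg) auto
      define c where "c = (\<lambda>i::int. {\<epsilon> * of_int i<..\<epsilon> * (of_int i + 1)})"
      \<comment> \<open>The step function that takes on each cell the value of \<open>f\<close> at its left end.\<close>
      define s where "s = (\<lambda>x. \<Sum>i\<in>cells \<epsilon> K. f (\<epsilon> * of_int i) * indicat_real (c i) x)"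
      have ints: "integrable \<rho> s" unfolding s_def c_def
        by (intro Bochner_Integration.integrable_sum integrable_mult_right int_Ioc)
      have I2: "(\<integral>x. s x \<partial>\<rho>) = (\<Sum>i\<in>cells \<epsilon> K. f (\<epsilon> * of_int i) * incr \<epsilon> i)"
      proof -
        have "(\<integral>x. s x \<partial>\<rho>) = (\<Sum>i\<in>cells \<epsilon> K. \<integral>x. f (\<epsilon> * of_int i) * indicat_real (c i) x \<partial>\<rho>)"
          unfolding s_def c_def by (intro Bochner_Integration.integral_sum integrable_mult_right int_Ioc)
        also have "\<dots> = (\<Sum>i\<in>cells \<epsilon> K. f (\<epsilon> * of_int i) * incr \<epsilon> i)"
          using \<epsilon> by (intro sum.cong refl) (simp add: c_def measure_Ioc incr_def)
        finally show ?thesis .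
      qed
      have cell_unique: "i = j" if "x \<in> c i" "x \<in> c j" for x i j
      proof -
        have "\<epsilon> * of_int i < \<epsilon> * (of_int j + 1)" "\<epsilon> * of_int j < \<epsilon> * (of_int i + 1)"
          using that by (auto simp: c_def)
        then have "of_int i < (of_int j + 1 :: real)" "of_int j < (of_int i + 1 :: real)"
          using \<epsilon> by (simp_all add: mult_less_cancel_left_pos)
        then show ?thesis by linarith
      qed
      have approx: "\<bar>f x - s x\<bar> \<le> \<eta> * indicat_real {- real K<..real K} x" for x
      proof (cases "\<exists>i\<in>cells \<epsilon> K. x \<in> c i")
        case True
        then obtain i where i: "i \<in> cells \<epsilon> K" "x \<in> c i" by auto
        have "s x = (\<Sum>j\<in>{i}. f (\<epsilon> * of_int j) * indicat_real (c j) x)"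
          unfolding s_def using i fin cell_unique by (intro sum.mono_neutral_right)
              (auto simp: indicator_def)
        then have "s x = f (\<epsilon> * of_int i)" using i by simp
        moreover have x: "\<epsilon> * of_int i < x" "x \<le> \<epsilon> * of_int i + \<epsilon>" using i(2)
            by (auto simp: c_def algebra_simps)
        moreover have "- real K \<le> \<epsilon> * of_int i" "\<epsilon> * of_int i + \<epsilon> \<le> real K" using i(1) in_cells
            by (auto simp: algebra_simps)
        ultimately show ?thesis
          using d(2)[of x "\<epsilon> * of_int i"] \<epsilon> by (auto simp: indicator_def)
      next
        case False
        then have "s x = 0" unfolding s_def by (intro sum.neutral) (auto simp: indicator_def)
        moreover have "f x = 0"
        proof (rule ccontr)
          assume "f x \<noteq> 0"
          then have xR: "\<bar>x\<bar> \<le> R" by (rule R)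
          define i where "i = \<lceil>x / \<epsilon>\<rceil> - 1"
          have "of_int i < x / \<epsilon>" "x / \<epsilon> \<le> of_int i + 1" unfolding i_def by linarith+
          then have xi: "\<epsilon> * of_int i < x" "x \<le> \<epsilon> * (of_int i + 1)" using \<epsilon> by (simp_all add: field_simps)
          then have "x \<in> c i" by (simp add: c_def)
          moreover have "i \<in> cells \<epsilon> K" unfolding in_cells using xi xR \<epsilon> K
              by (auto simp: abs_le_iff algebra_simps)
          ultimately show False using False by auto
        qed
        ultimately show ?thesis using \<eta> by simp
      qed
      have "\<bar>(\<integral>x. f x \<partial>\<rho>) - (\<integral>x. s x \<partial>\<rho>)\<bar> \<le> \<eta> * W"
      proof -
        have "\<bar>(\<integral>x. f x \<partial>\<rho>) - (\<integral>x. s x \<partial>\<rho>)\<bar> = norm (\<integral>x. f x - s x \<partial>\<rho>)" using intf ints by simp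
        also have "\<dots> \<le> (\<integral>x. norm (f x - s x) \<partial>\<rho>)" by (rule integral_norm_bound)
        also have "\<dots> \<le> (\<integral>x. \<eta> * indicat_real {- real K<..real K} x \<partial>\<rho>)"
          using approx intf ints int_Ioc by (intro integral_mono integrable_norm integrable_mult_right) auto
        also have "\<dots> = \<eta> * W" by (simp add: measure_Ioc W_def)
        finally show ?thesis .
      qed
      moreover have "\<bar>(\<integral>x. f x \<partial>\<rho>e \<epsilon>) - (\<integral>x. s x \<partial>\<rho>)\<bar> \<le> B * (e / (2 * (B + 1)))"
      proof -
        have "\<bar>(\<integral>x. f x \<partial>\<rho>e \<epsilon>) - (\<integral>x. s x \<partial>\<rho>)\<bar> =
            \<bar>\<Sum>i\<in>cells \<epsilon> K. f (\<epsilon> * of_int i) * (g \<epsilon> (incr \<epsilon> i) - incr \<epsilon> i)\<bar>"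
          unfolding I1 I2 by (simp add: sum_subtractf[symmetric] algebra_simps)
        also have "\<dots> \<le> (\<Sum>i\<in>cells \<epsilon> K. \<bar>f (\<epsilon> * of_int i) * (g \<epsilon> (incr \<epsilon> i) - incr \<epsilon> i)\<bar>)" by (rule sum_abs)
        also have "\<dots> \<le> (\<Sum>i\<in>cells \<epsilon> K. B * \<bar>g \<epsilon> (incr \<epsilon> i) - incr \<epsilon> i\<bar>)"
          unfolding abs_mult using B by (intro sum_mono mult_right_mono) auto
        also have "\<dots> \<le> B * (e / (2 * (B + 1)))"
          unfolding sum_distrib_left[symmetric] using err B by (intro mult_left_mono) auto
        finally show ?thesis .
      qed
      moreover have "\<eta> * W < \<eta> * (W + 1)" using \<eta> by simp
      moreover have "\<eta> * (W + 1) = e / 2" using W by (simp add: \<eta>_def field_simps)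
      moreover have "B * (e / (2 * (B + 1))) \<le> (B + 1) * (e / (2 * (B + 1)))"
        using B e by (intro mult_right_mono) simp_all
      moreover have "(B + 1) * (e / (2 * (B + 1))) = e / 2" using B by (simp add: field_simps)
      ultimately show ?case unfolding dist_real_def by linarith
    qed
  qed
qed

definition jump :: "real \<Rightarrow> real" where "jump y = measure \<rho> {y}"

lemma jump_nonneg: "0 \<le> jump y" by (simp add: jump_def)

text \<open>The measure of a small interval around \<open>y\<close> is close to the atom at \<open>y\<close>, so nothing else close to
    \<open>y\<close> has
  much mass.\<close>

lemma increments_near_point:
  assumes "0 < \<eta>"
  obtains r where "0 < r"
    "\<forall>a b. y - r < a \<and> a \<le> b \<and> b < y + r \<longrightarrow>
       (if a < y \<and> y \<le> b then jump y \<le> v b - v a \<and> v b - v a < jump y + \<eta> else v b - v a < \<eta>)"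
    "\<forall>x. \<bar>x - y\<bar> < r \<and> x \<noteq> y \<longrightarrow> jump x < \<eta>"
proof -
  define A where "A = (\<lambda>n. {y - 1 / real (Suc n)<..y + 1 / real (Suc n)})"
  have "(\<lambda>n. measure \<rho> (A n)) \<longlonglongrightarrow> measure \<rho> (\<Inter>n. A n)"
  proof (rule Lim_measure_decseq)
    show "decseq A"
    proof (rule decseq_SucI)
      fix n
      have "1 / real (Suc (Suc n)) \<le> 1 / real (Suc n)" by (intro divide_left_mono) auto
      then show "A (Suc n) \<subseteq> A n" unfolding A_def
          by (intro subsetI) (simp only: greaterThanAtMost_iff, linarith)
    qed
    show "emeasure \<rho> (A n) \<noteq> \<infinity>" for n unfolding A_def by (subst emeasure_Ioc) (auto simp: field_simps)
  qed (auto simp: A_def)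
  moreover have "(\<Inter>n. A n) = {y}"
  proof
    show "(\<Inter>n. A n) \<subseteq> {y}"
    proof
      fix x assume x: "x \<in> (\<Inter>n. A n)"
      show "x \<in> {y}"
      proof (rule ccontr)
        assume "x \<notin> {y}"
        then have "0 < \<bar>x - y\<bar>" by simp
        then obtain n where "1 / real (Suc n) < \<bar>x - y\<bar>" by (metis nat_approx_posE)
        moreover have "x \<in> A n" using x by auto
        ultimately show False by (auto simp: A_def abs_if split: if_splits)
      qed
    qed
  qed (auto simp: A_def)
  ultimately have "(\<lambda>n. measure \<rho> (A n)) \<longlonglongrightarrow> jump y" by (simp add: jump_def)
  then have "\<forall>\<^sub>F n in sequentially. measure \<rho> (A n) < jump y + \<eta>"
    using assms by (intro order_tendstoD) auto
  then obtain n where n: "measure \<rho> (A n) < jump y + \<eta>" by (auto simp: eventually_sequentially)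
  define r where "r = 1 / real (Suc n)"
  have r: "0 < r" by (simp add: r_def)
  have An: "A n = {y - r<..y + r}" by (simp add: A_def r_def)
  have bound: "measure \<rho> B < jump y + \<eta>" if "B \<subseteq> A n" "B \<in> sets borel" for B
    using measure_mono_bounded[OF that(1) _ that(2), of "y - r" "y + r"] An r n by simp
  have fin: "B \<in> fmeasurable \<rho>" if "B \<subseteq> A n" "B \<in> sets borel" for B
    by (rule fmeasurableI2[OF _ that(1)]) (use that r in \<open>auto simp: An emeasure_Ioc intro!: fmeasurableI\<close>)
  have away: "measure \<rho> B < \<eta>" if B: "B \<subseteq> A n" "B \<in> sets borel" "y \<notin> B" for B
  proof -
    have "measure \<rho> (B \<union> {y}) = measure \<rho> B + jump y"
      unfolding jump_def using B r by (intro measure_Un_AE fin) (auto simp: An)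
    moreover have "measure \<rho> (B \<union> {y}) < jump y + \<eta>" using B r by (intro bound) (auto simp: An)
    ultimately show ?thesis by simp
  qed
  show thesis
  proof (rule that[OF r]; intro allI impI)
    fix a b assume ab: "y - r < a \<and> a \<le> b \<and> b < y + r"
    show "if a < y \<and> y \<le> b then jump y \<le> v b - v a \<and> v b - v a < jump y + \<eta> else v b - v a < \<eta>"
    proof (cases "a < y \<and> y \<le> b")
      case True
      have "jump y \<le> measure \<rho> {a<..b}"
        unfolding jump_def using ab True by (intro measure_mono_bounded[of _ _ a b]) auto
      moreover have "measure \<rho> {a<..b} < jump y + \<eta>" using ab by (intro bound) (auto simp: An)
      ultimately show ?thesis using ab True by (simp add: measure_Ioc)
    next
      case False
      then have "measure \<rho> {a<..b} < \<eta>" using ab by (intro away) (auto simp: An)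
      then show ?thesis using ab False by (auto simp: measure_Ioc)
    qed
  next
    fix x assume "\<bar>x - y\<bar> < r \<and> x \<noteq> y"
    then show "jump x < \<eta>" unfolding jump_def by (intro away) (auto simp: An abs_if split: if_splits)
  qed
qed

text \<open>The same picture for the approximations: only the cell that contains \<open>y\<close> has a weight above \<open>\<eta>\<close>,
    if any,
  and that weight is close to the atom at \<open>y\<close>.\<close>

lemma weights_near_point:
  assumes \<eta>: "0 < \<eta>"
  obtains r where "0 < r" "\<forall>x. \<bar>x - y\<bar> < r \<and> x \<noteq> y \<longrightarrow> jump x < \<eta>"
    "\<forall>\<^sub>F \<epsilon> in at_right 0. \<forall>i. \<bar>\<epsilon> * of_int i - y\<bar> < r \<longrightarrow>
      (if \<epsilon> * of_int i < y \<and> y \<le> \<epsilon> * (of_int i + 1) then \<bar>g \<epsilon> (incr \<epsilon> i) - jump y\<bar> < \<eta> else g \<epsilon>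
          (incr \<epsilon> i) < \<eta>)"
proof -
  obtain s where s: "0 < s"
    "\<forall>a b. y - s < a \<and> a \<le> b \<and> b < y + s \<longrightarrow>
       (if a < y \<and> y \<le> b then jump y \<le> v b - v a \<and> v b - v a < jump y + \<eta> / 2 else v b - v a < \<eta> / 2)"
    "\<forall>x. \<bar>x - y\<bar> < s \<and> x \<noteq> y \<longrightarrow> jump x < \<eta> / 2"
    by (rule increments_near_point[OF half_gt_zero[OF \<eta>], of y])
  have close: "\<forall>\<^sub>F \<epsilon> in at_right 0. \<bar>g \<epsilon> x - x\<bar> < \<eta> / 2" if "0 \<le> x" for x
    using tendstoD[OF g_tendsto[OF that], of "\<eta> / 2"] \<eta> by (simp add: dist_real_def)
  have c1: "\<forall>\<^sub>F \<epsilon> in at_right 0. \<bar>g \<epsilon> (jump y) - jump y\<bar> < \<eta> / 2"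
    and c2: "\<forall>\<^sub>F \<epsilon> in at_right 0. \<bar>g \<epsilon> (jump y + \<eta> / 2) - (jump y + \<eta> / 2)\<bar> < \<eta> / 2"
    and c3: "\<forall>\<^sub>F \<epsilon> in at_right 0. \<bar>g \<epsilon> (\<eta> / 2) - \<eta> / 2\<bar> < \<eta> / 2"
    by (rule close, use \<eta> jump_nonneg[of y] in simp)+
  from eps_small[OF zero_less_one] eps_small[OF half_gt_zero[OF s(1)]] c1 c2 c3
  have "\<forall>\<^sub>F \<epsilon> in at_right 0. \<forall>i. \<bar>\<epsilon> * of_int i - y\<bar> < s / 2 \<longrightarrow>
      (if \<epsilon> * of_int i < y \<and> y \<le> \<epsilon> * (of_int i + 1) then \<bar>g \<epsilon> (incr \<epsilon> i) - jump y\<bar> < \<eta> else g \<epsilon>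
          (incr \<epsilon> i) < \<eta>)"
  proof eventually_elim
    case (elim \<epsilon>)
    then have \<epsilon>: "0 < \<epsilon>" "\<epsilon> < 1" "\<epsilon> < s / 2" by auto
    show ?case
    proof (intro allI impI)
      fix i assume i: "\<bar>\<epsilon> * of_int i - y\<bar> < s / 2"
      define a b where "a = \<epsilon> * of_int i" and "b = \<epsilon> * (of_int i + 1)"
      have "b = a + \<epsilon>" by (simp add: a_def b_def algebra_simps)
      then have ab: "y - s < a" "a \<le> b" "b < y + s"
        using i \<epsilon> unfolding a_def[symmetric] by linarith+
      have inc: "incr \<epsilon> i = v b - v a" by (simp add: incr_def a_def b_def)
      show "if \<epsilon> * of_int i < y \<and> y \<le> \<epsilon> * (of_int i + 1) then \<bar>g \<epsilon> (incr \<epsilon> i) - jump y\<bar> <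
          \<eta> else g \<epsilon> (incr \<epsilon> i) < \<eta>"
      proof (cases "a < y \<and> y \<le> b")
        case True
        then have "jump y \<le> incr \<epsilon> i" "incr \<epsilon> i \<le> jump y + \<eta> / 2" using s(2)[rule_format, of a b] ab inc
            by auto
        then have "g \<epsilon> (jump y) \<le> g \<epsilon> (incr \<epsilon> i)" "g \<epsilon> (incr \<epsilon> i) \<le> g \<epsilon> (jump y + \<eta> / 2)"
          using \<epsilon> by (auto intro!: g_mono)
        then have "\<bar>g \<epsilon> (incr \<epsilon> i) - jump y\<bar> < \<eta>" using elim(3,4) by linarith
        then show ?thesis using True by (simp add: a_def b_def)
      next
        case False
        then have "incr \<epsilon> i \<le> \<eta> / 2" using s(2)[rule_format, of a b] ab inc by (auto split: if_splits)
        then have "g \<epsilon> (incr \<epsilon> i) \<le> g \<epsilon> (\<eta> / 2)" using \<epsilon> by (auto intro!: g_mono)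
        then have "g \<epsilon> (incr \<epsilon> i) < \<eta>" using elim(5) by linarith
        then show ?thesis using False by (auto simp: a_def b_def)
      qed
    qed
  qed
  moreover have "\<forall>x. \<bar>x - y\<bar> < s / 2 \<and> x \<noteq> y \<longrightarrow> jump x < \<eta>"
  proof (intro allI impI)
    fix x assume x: "\<bar>x - y\<bar> < s / 2 \<and> x \<noteq> y"
    then have "jump x < \<eta> / 2" using s(1) s(3)[rule_format, of x] by simp
    then show "jump x < \<eta>" using \<eta> by simp
  qed
  ultimately show thesis
    using s(1) by (intro that[of "s / 2"]) simp_all
qed

lemma atom_set_\<rho>: "atom_set \<rho> = {(y, jump y) | y. 0 < jump y}"
  by (simp add: atom_set_def jump_def)

lemma atom_set_\<rho>e:
  assumes "0 < \<epsilon>" "\<epsilon> < 1"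
  shows "atom_set (\<rho>e \<epsilon>) = {(\<epsilon> * of_int i, g \<epsilon> (incr \<epsilon> i)) | i. 0 < g \<epsilon> (incr \<epsilon> i)}"
proof -
  have inj: "inj (\<lambda>i::int. \<epsilon> * of_int i)" using assms by (auto simp: inj_def)
  have m: "measure (\<rho>e \<epsilon>) {\<epsilon> * of_int i} = g \<epsilon> (incr \<epsilon> i)"
    "z \<notin> range (\<lambda>i::int. \<epsilon> * of_int i) \<Longrightarrow> measure (\<rho>e \<epsilon>) {z} = 0" for i z
    unfolding \<rho>e_def
    by (rule measure_point_mass_sum_singleton[OF inj], rule g_nonneg[OF assms], assumption?)+
  show ?thesis
  proof (intro set_eqI iffI)
    fix p assume "p \<in> atom_set (\<rho>e \<epsilon>)"
    then obtain y where y: "p = (y, measure (\<rho>e \<epsilon>) {y})" "0 < measure (\<rho>e \<epsilon>) {y}"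
        by (auto simp: atom_set_def)
    have "y \<in> range (\<lambda>i. \<epsilon> * of_int i)"
    proof (rule ccontr)
      assume "y \<notin> range (\<lambda>i. \<epsilon> * of_int i)"
      from m(2)[OF this] show False using y(2) by simp
    qed
    then obtain i where "y = \<epsilon> * of_int i" by blast
    then have "p = (\<epsilon> * of_int i, g \<epsilon> (incr \<epsilon> i))" "0 < g \<epsilon> (incr \<epsilon> i)" using y m(1)[of i] by simp_all
    then show "p \<in> {(\<epsilon> * of_int i, g \<epsilon> (incr \<epsilon> i)) | i. 0 < g \<epsilon> (incr \<epsilon> i)}" by blast
  next
    fix p assume "p \<in> {(\<epsilon> * of_int i, g \<epsilon> (incr \<epsilon> i)) | i. 0 < g \<epsilon> (incr \<epsilon> i)}"
    then obtain i where "p = (\<epsilon> * of_int i, g \<epsilon> (incr \<epsilon> i))" "0 < g \<epsilon> (incr \<epsilon> i)" by blast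
    then show "p \<in> atom_set (\<rho>e \<epsilon>)"
      unfolding atom_set_def by (intro CollectI exI[of _ "\<epsilon> * of_int i"]) (simp add: m(1)[of i])
  qed
qed

lemma point_process: "point_process_convergence \<rho>e \<rho>"
  unfolding point_process_convergence_def
proof (intro allI impI)
  fix U :: "(real \<times> real) set"
  assume "open U \<and> compact (closure U) \<and> closure U \<subseteq> UNIV \<times> {0<..} \<and> frontier U \<inter> atom_set \<rho> = {}"
  then have U: "open U" "compact (closure U)" "closure U \<subseteq> UNIV \<times> {0<..}" "frontier U \<inter> atom_set \<rho> = {}"
      by auto
  define A where "A = atom_set \<rho> \<inter> U"
  define pt where "pt = (\<lambda>\<epsilon> i. (\<epsilon> * of_int i, g \<epsilon> (incr \<epsilon> i)))"
  define cell where "cell = (\<lambda>(\<epsilon>::real) (i::int). {\<epsilon> * of_int i<..\<epsilon> * (of_int i + 1)})"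
  \<comment> \<open>A neighbourhood of a point of the closure contains no atom but that point, and for
    small \<open>\<epsilon>\<close> only weights of cells that contain an atom counted in \<open>U\<close>. A limit point that is not an
    atom has a neighbourhood that eventually contains no weight at all.\<close>
  have nbhd: "\<exists>W. open W \<and> z \<in> W \<and> W \<inter> atom_set \<rho> \<subseteq> {z} \<and>
      (\<forall>\<^sub>F \<epsilon> in at_right 0. \<forall>i. pt \<epsilon> i \<in> W \<longrightarrow> (\<exists>p\<in>A. fst p \<in> cell \<epsilon> i))" if z: "z \<in> closure U" for z
  proof -
    obtain y w where yw: "z = (y, w)" by (cases z)
    have w: "0 < w" using U(3) z yw by auto
    define \<eta> where "\<eta> = (if w = jump y then w / 2 else min (w / 2) (\<bar>w - jump y\<bar> / 2))"
    have \<eta>: "0 < \<eta>" "\<eta> \<le> w / 2" using w by (auto simp: \<eta>_def)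
    have eq: "w = jump y" if "\<bar>w - jump y\<bar> < 2 * \<eta>"
    proof (rule ccontr)
      assume "w \<noteq> jump y"
      then have "2 * \<eta> \<le> \<bar>w - jump y\<bar>" by (simp add: \<eta>_def min_def)
      then show False using that by simp
    qed
    obtain r where r: "0 < r" "\<forall>x. \<bar>x - y\<bar> < r \<and> x \<noteq> y \<longrightarrow> jump x < \<eta>"
      and ev: "\<forall>\<^sub>F \<epsilon> in at_right 0. \<forall>i. \<bar>\<epsilon> * of_int i - y\<bar> < r \<longrightarrow>
      (if \<epsilon> * of_int i < y \<and> y \<le> \<epsilon> * (of_int i + 1) then \<bar>g \<epsilon> (incr \<epsilon> i) - jump y\<bar> < \<eta> else g \<epsilon>
          (incr \<epsilon> i) < \<eta>)"
      by (rule weights_near_point[OF \<eta>(1), of y])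
    define W where "W = {y - r<..<y + r} \<times> {w - \<eta><..<w + \<eta>}"
    have "open W" unfolding W_def by (intro open_Times open_greaterThanLessThan)
    moreover have "z \<in> W" using r \<eta> by (simp add: W_def yw)
    moreover have "W \<inter> atom_set \<rho> \<subseteq> {z}"
    proof
      fix p assume "p \<in> W \<inter> atom_set \<rho>"
      then obtain x where x: "p = (x, jump x)" "y - r < x" "x < y + r" "w - \<eta> < jump x" "jump x < w + \<eta>"
        by (auto simp: atom_set_\<rho> W_def)
      have "x = y"
      proof (rule ccontr)
        assume "x \<noteq> y"
        then have "jump x < \<eta>" using x by (intro r(2)[rule_format]) (auto simp: abs_less_iff)
        then show False using x \<eta> by simp
      qed
      then have "w = jump y" using x \<eta>(1) by (intro eq) auto
      then show "p \<in> {z}" using x \<open>x = y\<close> yw by simp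
    qed
    moreover have "\<forall>\<^sub>F \<epsilon> in at_right 0. \<forall>i. pt \<epsilon> i \<in> W \<longrightarrow> (\<exists>p\<in>A. fst p \<in> cell \<epsilon> i)"
      using ev
    proof eventually_elim
      case (elim \<epsilon>)
      show ?case
      proof (intro allI impI)
        fix i assume "pt \<epsilon> i \<in> W"
        then have i: "\<bar>\<epsilon> * of_int i - y\<bar> < r" "w - \<eta> < g \<epsilon> (incr \<epsilon> i)" "g \<epsilon> (incr \<epsilon> i) < w + \<eta>"
          by (auto simp: pt_def W_def abs_less_iff)
        have c: "y \<in> cell \<epsilon> i \<and> \<bar>g \<epsilon> (incr \<epsilon> i) - jump y\<bar> < \<eta>"
          using elim[rule_format, OF i(1)] i(2) \<eta>(2) by (auto simp: cell_def split: if_splits)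
        then have "w = jump y" using i(2,3) by (intro eq) (simp add: abs_less_iff)
        then have "z \<in> atom_set \<rho>" using yw w by (auto simp: atom_set_\<rho>)
        moreover have "z \<in> U"
          using z U(1,4) calculation by (auto simp: frontier_def interior_open)
        ultimately show "\<exists>p\<in>A. fst p \<in> cell \<epsilon> i" using c yw by (intro bexI[of _ z]) (auto simp: A_def)
      qed
    qed
    ultimately show ?thesis by blast
  qed
  from nbhd have "\<exists>W. \<forall>z\<in>closure U. open (W z) \<and> z \<in> W z \<and> W z \<inter> atom_set \<rho> \<subseteq> {z} \<and>
      (\<forall>\<^sub>F \<epsilon> in at_right 0. \<forall>i. pt \<epsilon> i \<in> W z \<longrightarrow> (\<exists>p\<in>A. fst p \<in> cell \<epsilon> i))"
    by (intro bchoice) blast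
  then obtain W where W: "\<And>z. z \<in> closure U \<Longrightarrow> open (W z) \<and> z \<in> W z \<and> W z \<inter> atom_set \<rho> \<subseteq> {z} \<and>
      (\<forall>\<^sub>F \<epsilon> in at_right 0. \<forall>i. pt \<epsilon> i \<in> W z \<longrightarrow> (\<exists>p\<in>A. fst p \<in> cell \<epsilon> i))"
    by blast
  have "closure U \<subseteq> (\<Union>z\<in>closure U. W z)" using W by blast
  then obtain Z where Z: "Z \<subseteq> closure U" "finite Z" "closure U \<subseteq> (\<Union>z\<in>Z. W z)"
    by (rule compactE_image[OF U(2), of "closure U" W, rotated]) (use W in auto)
  have "A \<subseteq> Z"
  proof
    fix p assume p: "p \<in> A"
    then have "p \<in> closure U" using closure_subset by (auto simp: A_def)
    then obtain z where z: "z \<in> Z" "p \<in> W z" using Z by auto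
    then have "p = z" using W[of z] Z(1) p by (auto simp: A_def)
    then show "p \<in> Z" using z by simp
  qed
  then have finA: "finite A" using Z(2) finite_subset by blast
  have surj: "\<forall>\<^sub>F \<epsilon> in at_right 0. \<forall>i. pt \<epsilon> i \<in> U \<longrightarrow> (\<exists>p\<in>A. fst p \<in> cell \<epsilon> i)"
  proof -
    have "\<forall>\<^sub>F \<epsilon> in at_right 0. \<forall>z\<in>Z. \<forall>i. pt \<epsilon> i \<in> W z \<longrightarrow> (\<exists>p\<in>A. fst p \<in> cell \<epsilon> i)"
      using W Z(1) by (intro eventually_ball_finite Z(2)) blast
    then show ?thesis
    proof eventually_elim
      case (elim \<epsilon>)
      then show ?case using Z(3) closure_subset[of U] by blast
    qed
  qed
  have into: "\<forall>\<^sub>F \<epsilon> in at_right 0. \<forall>p\<in>A. \<forall>i. fst p \<in> cell \<epsilon> i \<longrightarrow> pt \<epsilon> i \<in> U"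
  proof (intro eventually_ball_finite finA ballI)
    fix p assume p: "p \<in> A"
    then obtain y where y: "p = (y, jump y)" "0 < jump y" "p \<in> U" by (auto simp: A_def atom_set_\<rho>)
    obtain e where e: "0 < e" "ball p e \<subseteq> U" using U(1) y(3) openE by blast
    obtain r where r: "0 < r" "\<forall>x. \<bar>x - y\<bar> < r \<and> x \<noteq> y \<longrightarrow> jump x < e / 2"
      and ev: "\<forall>\<^sub>F \<epsilon> in at_right 0. \<forall>i. \<bar>\<epsilon> * of_int i - y\<bar> < r \<longrightarrow>
      (if \<epsilon> * of_int i < y \<and> y \<le> \<epsilon> * (of_int i + 1) then \<bar>g \<epsilon> (incr \<epsilon> i) - jump y\<bar> < e / 2 else g \<epsilon>
          (incr \<epsilon> i) < e / 2)"
      by (rule weights_near_point[OF half_gt_zero[OF e(1)], of y])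
    have "0 < min r (e / 2)" using r e by simp
    from eps_small[OF this] ev
    show "\<forall>\<^sub>F \<epsilon> in at_right 0. \<forall>i. fst p \<in> cell \<epsilon> i \<longrightarrow> pt \<epsilon> i \<in> U"
    proof eventually_elim
      case (elim \<epsilon>)
      show ?case
      proof (intro allI impI)
        fix i assume "fst p \<in> cell \<epsilon> i"
        then have i: "\<epsilon> * of_int i < y" "y \<le> \<epsilon> * (of_int i + 1)" by (auto simp: cell_def y)
        then have d1: "\<bar>\<epsilon> * of_int i - y\<bar> \<le> \<epsilon>" by (simp add: algebra_simps)
        then have d2: "\<bar>g \<epsilon> (incr \<epsilon> i) - jump y\<bar> < e / 2"
          using elim(2)[rule_format, of i] elim(1) i by simp
        have "dist p (pt \<epsilon> i) \<le> \<bar>\<epsilon> * of_int i - y\<bar> + \<bar>g \<epsilon> (incr \<epsilon> i) - jump y\<bar>"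
          unfolding y(1) pt_def dist_Pair_Pair dist_real_def
          by (rule order_trans[OF sqrt_sum_squares_le_sum_abs]) (simp add: abs_minus_commute)
        also have "\<dots> < e" using d1 d2 elim(1) by auto
        finally show "pt \<epsilon> i \<in> U" using e(2) by auto
      qed
    qed
  qed
  have sep: "\<forall>\<^sub>F \<epsilon> in at_right 0. \<forall>p\<in>A. \<forall>p'\<in>A. p \<noteq> p' \<longrightarrow> \<epsilon> < \<bar>fst p - fst p'\<bar>"
  proof (intro eventually_ball_finite finA ballI)
    fix p p' assume p: "p \<in> A" "p' \<in> A"
    show "\<forall>\<^sub>F \<epsilon> in at_right 0. p \<noteq> p' \<longrightarrow> \<epsilon> < \<bar>fst p - fst p'\<bar>"
    proof (cases "p = p'")
      case False
      then have "0 < \<bar>fst p - fst p'\<bar>" using p by (auto simp: A_def atom_set_\<rho>)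
      from eps_small[OF this] show ?thesis by eventually_elim auto
    qed simp
  qed
  show "\<forall>\<^sub>F \<epsilon> in at_right 0. card (atom_set (\<rho>e \<epsilon>) \<inter> U) = card (atom_set \<rho> \<inter> U)"
    using eps_small[of 1, simplified] surj into sep
  proof eventually_elim
    case (elim \<epsilon>)
    then have \<epsilon>: "0 < \<epsilon>" "\<epsilon> < 1" by auto
    have in_cell: "y \<in> cell \<epsilon> i \<longleftrightarrow> i = \<lceil>y / \<epsilon>\<rceil> - 1" for y i
    proof -
      have "y \<in> cell \<epsilon> i \<longleftrightarrow> of_int i < y / \<epsilon> \<and> y / \<epsilon> \<le> of_int i + 1"
        using \<epsilon> by (auto simp: cell_def field_simps)
      also have "\<dots> \<longleftrightarrow> \<lceil>y / \<epsilon>\<rceil> = i + 1" by (subst ceiling_eq_iff) auto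
      finally show ?thesis by auto
    qed
    \<comment> \<open>An atom of the limit is matched with the weight of the cell that contains it.\<close>
    define h where "h = (\<lambda>p::real \<times> real. pt \<epsilon> (\<lceil>fst p / \<epsilon>\<rceil> - 1))"
    have ptinj: "pt \<epsilon> i = pt \<epsilon> j \<longleftrightarrow> i = j" for i j using \<epsilon> by (auto simp: pt_def)
    have atoms: "atom_set (\<rho>e \<epsilon>) \<inter> U = {pt \<epsilon> i | i. pt \<epsilon> i \<in> U}"
    proof -
      have "0 < g \<epsilon> (incr \<epsilon> i)" if "pt \<epsilon> i \<in> U" for i
        using U(3) closure_subset[of U] that by (auto simp: pt_def)
      then show ?thesis unfolding atom_set_\<rho>e[OF \<epsilon>] pt_def by auto
    qed
    have "bij_betw h A (atom_set (\<rho>e \<epsilon>) \<inter> U)"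
    proof (rule bij_betwI')
      fix p p' assume p: "p \<in> A" "p' \<in> A"
      show "h p = h p' \<longleftrightarrow> p = p'"
      proof
        assume "h p = h p'"
        then have "\<lceil>fst p / \<epsilon>\<rceil> = \<lceil>fst p' / \<epsilon>\<rceil>" by (simp add: h_def ptinj)
        then have "\<bar>fst p / \<epsilon> - fst p' / \<epsilon>\<bar> < 1" by linarith
        then have "\<bar>fst p - fst p'\<bar> < \<epsilon>" using \<epsilon> by (simp add: diff_divide_distrib[symmetric] abs_divide)
        then show "p = p'" using elim(4) p by force
      qed simp
    next
      fix p assume p: "p \<in> A"
      then have "pt \<epsilon> (\<lceil>fst p / \<epsilon>\<rceil> - 1) \<in> U" using elim(3) in_cell by blast
      then show "h p \<in> atom_set (\<rho>e \<epsilon>) \<inter> U" unfolding atoms h_def by blast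
    next
      fix x assume "x \<in> atom_set (\<rho>e \<epsilon>) \<inter> U"
      then obtain i where i: "x = pt \<epsilon> i" "pt \<epsilon> i \<in> U" unfolding atoms by auto
      then obtain p where "p \<in> A" "fst p \<in> cell \<epsilon> i" using elim(2) by blast
      then show "\<exists>p\<in>A. x = h p" using i by (intro bexI[of _ p]) (auto simp: h_def in_cell)
    qed
    then show ?case using bij_betw_same_card A_def by metis
  qed
qed

end

section \<open>Coupling the trap times with the stable process\<close>

text \<open>The hypotheses on the trap time and on the process; the two live on separate probability spaces and
  are coupled only through their laws.\<close>

locale coupled_trap_times = stable_process N V \<alpha> + M: prob_space M
  for N :: "'a measure" and V :: "real \<Rightarrow> 'a \<Rightarrow> real" and \<alpha> :: real and M :: "'b measure" +
  fixes \<tau>0 :: "'b \<Rightarrow> real" and L :: "real \<Rightarrow> real"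
  assumes \<tau>0_measurable [measurable]: "\<tau>0 \<in> borel_measurable M"
    and \<tau>0_pos: "\<P>(\<omega> in M. \<tau>0 \<omega> > 0) = 1"
    and \<tau>0_tail: "\<And>t. t > 0 \<Longrightarrow> \<P>(\<omega> in M. \<tau>0 \<omega> > t) = L t / t powr \<alpha>"
    and L_nonzero: "\<And>t. t > 0 \<Longrightarrow> L t \<noteq> 0"
    and L_slow: "slowly_varying_at_infinity L"
begin

definition F :: "real \<Rightarrow> real" where "F t = \<P>(\<omega> in M. \<tau>0 \<omega> > t)"

lemma F_cdf: "F t = 1 - cdf (distr M borel \<tau>0) t"
proof -
  have "cdf (distr M borel \<tau>0) t = M.prob {\<omega>\<in>space M. \<tau>0 \<omega> \<le> t}"
    unfolding cdf_def by (subst measure_distr) (auto intro!: arg_cong[where f=M.prob])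
  moreover have "M.prob {\<omega>\<in>space M. \<not> \<tau>0 \<omega> \<le> t} = 1 - M.prob {\<omega>\<in>space M. \<tau>0 \<omega> \<le> t}"
    by (rule M.prob_neg) measurable
  ultimately show ?thesis by (simp add: F_def not_le)
qed

sublocale T: tail_transfer F tail \<alpha>
proof -
  interpret D: real_distribution "distr M borel \<tau>0" by (rule M.real_distribution_distr) simp
  have anti: "F t \<le> F s" if "s \<le> t" for s t
    using D.cdf_nondecreasing[OF that] by (simp add: F_cdf)
  have F0: "F 0 = 1" using \<tau>0_pos by (simp add: F_def)
  have pos: "0 < F t" for t
  proof (cases "t > 0")
    case True
    then have "F t \<noteq> 0" using \<tau>0_tail L_nonzero by (simp add: F_def)
    moreover have "0 \<le> F t" by (simp add: F_def)
    ultimately show ?thesis by simp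
  next
    case False
    then show ?thesis using anti[of t 0] F0 by simp
  qed
  show "tail_transfer F tail \<alpha>"
  proof
    show "continuous (at_right t) F" for t
      using D.cdf_is_right_cont[of t] unfolding F_cdf[abs_def] by (intro continuous_intros)
    show "((\<lambda>t. F (a * t) / F t) \<longlongrightarrow> a powr - \<alpha>) at_top" if a: "0 < a" for a
    proof (rule Lim_transform_eventually)
      have "((\<lambda>t. L (a * t) / L t) \<longlongrightarrow> 1) at_top"
        using L_slow a by (simp add: slowly_varying_at_infinity_def)
      from tendsto_mult[OF this tendsto_const[of "a powr - \<alpha>"]]
      show "((\<lambda>t. L (a * t) / L t * a powr - \<alpha>) \<longlongrightarrow> a powr - \<alpha>) at_top" by simp
      show "\<forall>\<^sub>F t in at_top. L (a * t) / L t * a powr - \<alpha> = F (a * t) / F t"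
        using eventually_gt_at_top[of 0]
      proof eventually_elim
        case (elim t)
        have Fs: "F (a * t) = L (a * t) / (a powr \<alpha> * t powr \<alpha>)" "F t = L t / t powr \<alpha>"
          using \<tau>0_tail[of "a * t"] \<tau>0_tail[of t] elim a by (simp_all add: F_def powr_mult)
        show ?case unfolding Fs using L_nonzero[OF elim] elim a by (simp add: powr_minus field_simps)
      qed
    qed
    show "(F \<longlongrightarrow> 0) at_top"
      using tendsto_diff[OF tendsto_const D.cdf_lim_at_top_prob, of 1] by (simp add: F_cdf[abs_def])
  qed (use \<alpha> anti F0 pos isCont_tail tail_0 tail_strict_antimono tail_tendsto_0 tail_regular in auto)
qed

lemma G_fun_eq: "G_fun N V M \<tau>0 = T.G"
  by (intro ext) (simp add: G_fun_def T.G_def tail_eq F_def)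

lemma c_eps_eq: "c_eps M \<tau>0 \<epsilon> = inverse (T.q \<epsilon>)"
  by (simp add: c_eps_def T.q_def F_def)

lemma g_eps_eq: "g_eps \<alpha> N V M \<tau>0 = T.g"
  by (intro ext) (simp add: g_eps_def T.g_def c_eps_eq G_fun_eq)

lemma tau_eps_eq:
  assumes "0 < \<epsilon>" "\<epsilon> < 1"
  shows "tau_eps \<alpha> N V M \<tau>0 \<epsilon> i \<omega> =
    right_cont_inverse T.G (\<epsilon> powr (- 1 / \<alpha>) * (V (\<epsilon> * (of_int i + 1)) \<omega> - V (\<epsilon> * of_int i) \<omega>))"
  using T.q_pos[OF assms] by (simp add: tau_eps_def g_eps_eq T.g_def c_eps_eq)

lemma measurable_G_inverse [measurable]: "right_cont_inverse T.G \<in> borel_measurable borel"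
  by (rule borel_measurable_mono[OF T.G_inverse_mono])

lemma G_mono: "0 \<le> s \<Longrightarrow> s \<le> t \<Longrightarrow> T.G s \<le> T.G t"
  using T.G_eq[of s] T.G_eq[of t] tail_strict_antimono[of "T.G t" "T.G s"] T.F_antimono[of s t]
  by (cases "T.G s \<le> T.G t") auto

text \<open>For \<open>t < s\<close> the event that the inverse of \<open>G\<close> at \<open>V 1\<close> is at most \<open>t\<close> lies between \<open>V 1 < G t\<close>
    and \<open>V 1 < G s\<close>,
  whose probabilities are \<open>1 - F t\<close> and \<open>1 - F s\<close> since \<open>V 1\<close> has no atoms. Let \<open>s\<close> decrease to \<open>t\<close>.\<close>

lemma distr_G_inverse: "distr N borel (\<lambda>\<omega>. right_cont_inverse T.G (V 1 \<omega>)) = distr M borel \<tau>0"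
proof (rule cdf_unique)
  show "real_distribution (distr N borel (\<lambda>\<omega>. right_cont_inverse T.G (V 1 \<omega>)))"
    "real_distribution (distr M borel \<tau>0)"
    by (auto intro!: real_distribution_distr M.real_distribution_distr)
  show "cdf (distr N borel (\<lambda>\<omega>. right_cont_inverse T.G (V 1 \<omega>))) = cdf (distr M borel \<tau>0)"
  proof
    fix t
    have cdf: "cdf (distr N borel (\<lambda>\<omega>. right_cont_inverse T.G (V 1 \<omega>))) t =
        prob {\<omega>\<in>space N. right_cont_inverse T.G (V 1 \<omega>) \<le> t}"
      unfolding cdf_def by (subst measure_distr) (auto intro!: arg_cong[where f=prob])
    have V1: "prob {\<omega>\<in>space N. V 1 \<omega> < T.G s} = 1 - F s" if "0 \<le> s" for s
    proof -
      have "prob {\<omega>\<in>space N. V 1 \<omega> < T.G s} = measure law {..<T.G s}"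
        by (subst measure_distr) (auto intro!: arg_cong[where f=prob])
      then show ?thesis using T.G_eq[OF that] by (simp add: prob_law_lessThan)
    qed
    show "cdf (distr N borel (\<lambda>\<omega>. right_cont_inverse T.G (V 1 \<omega>))) t = cdf (distr M borel \<tau>0) t"
    proof (cases "0 \<le> t")
      case False
      then have "\<not> right_cont_inverse T.G y \<le> t" for y using T.G_inverse_nonneg[of y] by linarith
      then have "cdf (distr N borel (\<lambda>\<omega>. right_cont_inverse T.G (V 1 \<omega>))) t = 0" unfolding cdf by simp
      moreover have "F t = 1" using T.F_antimono[of t 0] T.F_0 False
          by (intro antisym) (simp_all add: F_def)
      ultimately show ?thesis by (simp add: F_cdf)
    next
      case True
      have "1 - F t \<le> prob {\<omega>\<in>space N. right_cont_inverse T.G (V 1 \<omega>) \<le> t}"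
        unfolding V1[OF True, symmetric]
      proof (intro finite_measure_mono subsetI)
        fix \<omega> assume "\<omega> \<in> {\<omega>\<in>space N. V 1 \<omega> < T.G t}"
        moreover from this have "right_cont_inverse T.G (V 1 \<omega>) \<le> s" if "t < s" for s
          using True that by (intro less_imp_le) (auto simp: T.G_inverse_less_iff)
        then have "right_cont_inverse T.G (V 1 \<omega>) \<le> t" by (rule dense_ge)
        ultimately show "\<omega> \<in> {\<omega>\<in>space N. right_cont_inverse T.G (V 1 \<omega>) \<le> t}" by simp
      qed measurable
      moreover have "prob {\<omega>\<in>space N. right_cont_inverse T.G (V 1 \<omega>) \<le> t} \<le> 1 - F t"
      proof (rule tendsto_lowerbound)
        show "((\<lambda>s. 1 - F s) \<longlongrightarrow> 1 - F t) (at_right t)"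
          using T.F_right_cont[of t] by (intro tendsto_intros) (simp add: continuous_within)
        have "prob {\<omega>\<in>space N. right_cont_inverse T.G (V 1 \<omega>) \<le> t} \<le> 1 - F s" if s: "t < s" for s
        proof -
          have "0 \<le> s" using s True by simp
          then show ?thesis
            unfolding V1[OF \<open>0 \<le> s\<close>, symmetric]
          proof (intro finite_measure_mono subsetI)
            fix \<omega> assume \<omega>: "\<omega> \<in> {\<omega>\<in>space N. right_cont_inverse T.G (V 1 \<omega>) \<le> t}"
            then have "right_cont_inverse T.G (V 1 \<omega>) < s" using s by auto
            then obtain x where "0 \<le> x" "x < s" "V 1 \<omega> < T.G x" by (auto simp: T.G_inverse_less_iff)
            then show "\<omega> \<in> {\<omega>\<in>space N. V 1 \<omega> < T.G s}" using G_mono[of x s] \<omega> by auto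
          qed measurable
        qed
        then show "\<forall>\<^sub>F s in at_right t. prob {\<omega>\<in>space N. right_cont_inverse T.G (V 1 \<omega>) \<le> t} \<le> 1 - F s"
          by (auto simp: eventually_at_filter)
      qed simp
      ultimately show ?thesis unfolding cdf by (simp add: F_cdf)
    qed
  qed
qed

lemma tau_eps_measurable:
  assumes "0 < \<epsilon>" "\<epsilon> < 1"
  shows "tau_eps \<alpha> N V M \<tau>0 \<epsilon> i \<in> borel_measurable N"
  unfolding tau_eps_eq[OF assms, abs_def] by measurable

lemma distr_tau_eps:
  assumes "0 < \<epsilon>" "\<epsilon> < 1"
  shows "distr N borel (tau_eps \<alpha> N V M \<tau>0 \<epsilon> i) = distr M borel \<tau>0"
proof -
  let ?h = "\<lambda>y. right_cont_inverse T.G (\<epsilon> powr (- 1 / \<alpha>) * y)"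
  have inv: "\<epsilon> powr (- 1 / \<alpha>) * (\<epsilon> powr (1 / \<alpha>) * y) = y" for y
    using assms by (simp add: mult.assoc[symmetric] powr_add[symmetric])
  have "distr N borel (\<lambda>\<omega>. right_cont_inverse T.G (V 1 \<omega>)) =
      distr (distr N borel (\<lambda>\<omega>. \<epsilon> powr (1 / \<alpha>) * V 1 \<omega>)) borel ?h"
    by (subst distr_distr) (measurable, simp only: comp_def inv)
  also have "\<dots> = distr (distr N borel (\<lambda>\<omega>. V (\<epsilon> * of_int i + \<epsilon>) \<omega> - V (\<epsilon> * of_int i) \<omega>)) borel ?h"
    using increment_law[OF assms(1)] by simp
  also have "\<dots> = distr N borel (tau_eps \<alpha> N V M \<tau>0 \<epsilon> i)"
    unfolding tau_eps_eq[OF assms, abs_def]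
    by (subst distr_distr) (auto simp: comp_def algebra_simps)
  finally show ?thesis by (simp add: distr_G_inverse)
qed

lemma rho_eps_eq:
  assumes "0 < \<epsilon>" "\<epsilon> < 1"
  shows "rho_eps \<alpha> N V M \<tau>0 \<epsilon> \<omega> =
    point_mass_sum (\<lambda>i. T.g \<epsilon> (V (\<epsilon> * (of_int i + 1)) \<omega> - V (\<epsilon> * of_int i) \<omega>)) (\<lambda>i. \<epsilon> * of_int i)"
  using T.q_pos[OF assms] by (simp add: rho_eps_def tau_eps_def g_eps_eq c_eps_eq)

lemma AE_convergence:
  "AE \<omega> in N.
     vague_convergence (\<lambda>\<epsilon>. rho_eps \<alpha> N V M \<tau>0 \<epsilon> \<omega>) (stieltjes_random_measure V \<omega>) \<and>
     point_process_convergence (\<lambda>\<epsilon>. rho_eps \<alpha> N V M \<tau>0 \<epsilon> \<omega>) (stieltjes_random_measure V \<omega>)"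
proof -
  \<comment> \<open>Any exponent strictly between \<open>\<alpha>\<close> and 1 would do.\<close>
  define \<beta> where "\<beta> = (1 + \<alpha>) / 2"
  have \<beta>: "\<alpha> < \<beta>" "\<beta> < 1" using \<alpha> by (auto simp: \<beta>_def)
  show ?thesis
    using paths_mono paths_negligible_small_increments[OF \<beta>(1) less_imp_le[OF \<beta>(2)]] AE_space
  proof eventually_elim
    case (elim \<omega>)
    interpret A: mesh_approximation "\<lambda>x. V x \<omega>" T.g \<beta> "\<beta> / \<alpha>"
    proof
      show "0 < \<beta>" "\<beta> \<le> 1" "1 < \<beta> / \<alpha>" using \<alpha> \<beta> by auto
    qed (fact elim right_continuous[OF elim(3)] T.g_mono T.g_nonneg T.g_tendsto T.g_power_bound[OF \<beta>])+
    have eq: "\<forall>\<^sub>F \<epsilon> in at_right 0. A.\<rho>e \<epsilon> = rho_eps \<alpha> N V M \<tau>0 \<epsilon> \<omega>"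
      using T.small_eps by eventually_elim (simp add: A.\<rho>e_def A.incr_def rho_eps_eq)
    have \<rho>: "A.\<rho> = stieltjes_random_measure V \<omega>"
      by (simp add: A.\<rho>_def stieltjes_random_measure_def)
    have "vague_convergence (\<lambda>\<epsilon>. rho_eps \<alpha> N V M \<tau>0 \<epsilon> \<omega>) (stieltjes_random_measure V \<omega>)"
      unfolding vague_convergence_def
    proof (intro allI impI)
      fix f :: "real \<Rightarrow> real" assume "continuous_on UNIV f \<and> bounded {x. f x \<noteq> 0}"
      then have "((\<lambda>\<epsilon>. \<integral>x. f x \<partial>A.\<rho>e \<epsilon>) \<longlongrightarrow> (\<integral>x. f x \<partial>stieltjes_random_measure V \<omega>)) (at_right 0)"
        using A.vague by (simp add: vague_convergence_def \<rho>)
      then show "((\<lambda>\<epsilon>. \<integral>x. f x \<partial>rho_eps \<alpha> N V M \<tau>0 \<epsilon> \<omega>) \<longlongrightarrow>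
          (\<integral>x. f x \<partial>stieltjes_random_measure V \<omega>)) (at_right 0)"
        by (rule Lim_transform_eventually) (use eq in eventually_elim, simp)
    qed
    moreover have "point_process_convergence (\<lambda>\<epsilon>. rho_eps \<alpha> N V M \<tau>0 \<epsilon> \<omega>) (stieltjes_random_measure V \<omega>)"
      unfolding point_process_convergence_def
    proof (intro allI impI)
      fix U :: "(real \<times> real) set"
      assume "open U \<and> compact (closure U) \<and> closure U \<subseteq> UNIV \<times> {0<..} \<and>
        frontier U \<inter> atom_set (stieltjes_random_measure V \<omega>) = {}"
      then have "\<forall>\<^sub>F \<epsilon> in at_right 0. card (atom_set (A.\<rho>e \<epsilon>) \<inter> U) =
          card (atom_set (stieltjes_random_measure V \<omega>) \<inter> U)"
        using A.point_process by (simp add: point_process_convergence_def \<rho>)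
      with eq show "\<forall>\<^sub>F \<epsilon> in at_right 0. card (atom_set (rho_eps \<alpha> N V M \<tau>0 \<epsilon> \<omega>) \<inter> U) =
          card (atom_set (stieltjes_random_measure V \<omega>) \<inter> U)"
        by eventually_elim simp
    qed
    ultimately show ?case by blast
  qed
qed

end

theorem proposition3p1:
  fixes \<alpha> :: real
    and M :: "'b measure" and \<tau>0 :: "'b \<Rightarrow> real" and L :: "real \<Rightarrow> real"
    and N :: "'a measure" and V :: "real \<Rightarrow> 'a \<Rightarrow> real"
  assumes "0 < \<alpha>" and "\<alpha> < 1"
    and "prob_space M" and "\<tau>0 \<in> borel_measurable M"
    and "\<P>(\<omega> in M. \<tau>0 \<omega> > 0) = 1"
    and "\<forall>t>0. \<P>(\<omega> in M. \<tau>0 \<omega> > t) = L t / t powr \<alpha>"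
    and "\<forall>t>0. L t \<noteq> 0"
    and "slowly_varying_at_infinity L"
    and "stable_levy_process \<alpha> N V"
  shows "(\<forall>\<epsilon>\<in>{0<..<1}. \<forall>i::int.
            tau_eps \<alpha> N V M \<tau>0 \<epsilon> i \<in> borel_measurable N \<and>
            distr N borel (tau_eps \<alpha> N V M \<tau>0 \<epsilon> i) = distr M borel \<tau>0) \<and>
         (AE \<omega> in N.
            vague_convergence (\<lambda>\<epsilon>. rho_eps \<alpha> N V M \<tau>0 \<epsilon> \<omega>) (stieltjes_random_measure V \<omega>) \<and>
            point_process_convergence (\<lambda>\<epsilon>. rho_eps \<alpha> N V M \<tau>0 \<epsilon> \<omega>)
              (stieltjes_random_measure V \<omega>))"
proof -
  interpret M: prob_space M by fact
  interpret N: prob_space N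
    using assms(9) by (simp add: stable_levy_process_def levy_process_def)
  interpret coupled_trap_times N V \<alpha> M \<tau>0 L
    using assms by unfold_locales blast+
  show ?thesis
    using tau_eps_measurable distr_tau_eps AE_convergence by auto
qed

end
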